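(* Let $G$ be a nontrivial connected Lie group. Then $G$ has infinitely many conjugacy classes. Furthermore, if $G$ is not nilpotent, then there exists a subgroup $L$ of finite index in $\mathrm{Aut}(G)$ such that $R(\alpha)=\infty$ for every $\alpha\in L$; in particular, there exists $n\in\mathbb{N}$ such that $R(\varphi^n)=\infty$ for every $\varphi\in\mathrm{Aut}(G)$.
   Context: For a Lie group $G$, $\mathrm{Aut}(G)$ denotes the group of continuous automorphisms of $G$. For an automorphism $\varphi$ of a group $G$, the $\varphi$-twisted conjugacy classes are the equivalence classes of the relation $x\sim_\varphi y$ iff $y=gx\varphi(g)^{-1}$ for some $g\in G$; $R(\varphi)\in\mathbb{N}\cup\{\infty\}$ is the number of these classes (for $\varphi=\mathrm{Id}$ these are the ordinary conjugacy classes). *)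

theory Defs
  imports "HOL-Analysis.Analysis" "HOL-Algebra.Coset" "HOL-Algebra.Generated_Groups"
begin

text \<open>C-infinity on an open set S: f lies in a family of functions, each continuous and
  differentiable on S, that is closed under taking partial derivatives (along basis vectors).\<close>
definition smooth_on :: "'a::euclidean_space set \<Rightarrow> ('a \<Rightarrow> 'b::euclidean_space) \<Rightarrow> bool" where
  "smooth_on S f \<longleftrightarrow>
     (\<exists>D. f \<in> D \<and>
        (\<forall>g\<in>D. continuous_on S g \<and> (\<forall>x\<in>S. g differentiable (at x)) \<and>
               (\<forall>b\<in>Basis. (\<lambda>x. frechet_derivative g (at x) b) \<in> D)))"

definition is_chart :: "'g topology \<Rightarrow> 'g set \<Rightarrow> ('g \<Rightarrow> 'e::euclidean_space) \<Rightarrow> bool" where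
  "is_chart X U cf \<longleftrightarrow> openin X U \<and> open (cf ` U) \<and>
     homeomorphic_map (subtopology X U) (top_of_set (cf ` U)) cf"

definition smooth_atlas :: "'g topology \<Rightarrow> ('g set \<times> ('g \<Rightarrow> 'e::euclidean_space)) set \<Rightarrow> bool" where
  "smooth_atlas X A \<longleftrightarrow>
     (\<forall>(U,cf)\<in>A. is_chart X U cf) \<and>
     (\<Union>(U,cf)\<in>A. U) = topspace X \<and>
     (\<forall>(U,cf)\<in>A. \<forall>(V,cg)\<in>A. smooth_on (cf ` (U \<inter> V)) (cg \<circ> inv_into U cf))"

definition smooth_manifold :: "'g topology \<Rightarrow> ('g set \<times> ('g \<Rightarrow> 'e::euclidean_space)) set \<Rightarrow> bool" where
  "smooth_manifold X A \<longleftrightarrow> Hausdorff_space X \<and> second_countable X \<and> smooth_atlas X A"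

definition smooth_map ::
  "'g topology \<Rightarrow> ('g set \<times> ('g \<Rightarrow> 'e::euclidean_space)) set \<Rightarrow>
   'h topology \<Rightarrow> ('h set \<times> ('h \<Rightarrow> 'f::euclidean_space)) set \<Rightarrow> ('g \<Rightarrow> 'h) \<Rightarrow> bool" where
  "smooth_map X A Y B f \<longleftrightarrow> continuous_map X Y f \<and>
     (\<forall>(U,cf)\<in>A. \<forall>(V,cg)\<in>B.
        smooth_on (cf ` {x\<in>U. f x \<in> V}) (cg \<circ> f \<circ> inv_into U cf))"

definition product_atlas ::
  "('g set \<times> ('g \<Rightarrow> 'e::euclidean_space)) set \<Rightarrow> ('h set \<times> ('h \<Rightarrow> 'f::euclidean_space)) set
   \<Rightarrow> (('g \<times> 'h) set \<times> ('g \<times> 'h \<Rightarrow> 'e \<times> 'f)) set" where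
  "product_atlas A B = {(U \<times> V, \<lambda>(x,y). (cf x, cg y)) | U V cf cg. (U,cf) \<in> A \<and> (V,cg) \<in> B}"

definition lie_group ::
  "'g monoid \<Rightarrow> 'g topology \<Rightarrow> ('g set \<times> ('g \<Rightarrow> 'e::euclidean_space)) set \<Rightarrow> bool" where
  "lie_group G X A \<longleftrightarrow> group G \<and> topspace X = carrier G \<and> smooth_manifold X A \<and>
     smooth_map (prod_topology X X) (product_atlas A A) X A (\<lambda>(x,y). x \<otimes>\<^bsub>G\<^esub> y) \<and>
     smooth_map X A X A (\<lambda>x. inv\<^bsub>G\<^esub> x)"

text \<open>The group Aut(G) of continuous automorphisms, under composition (maps are taken
  extensional on the carrier so that they are determined by their values on G).\<close>
definition Aut :: "'g monoid \<Rightarrow> 'g topology \<Rightarrow> ('g \<Rightarrow> 'g) monoid" where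
  "Aut G X = \<lparr> carrier = {cf. cf \<in> iso G G \<and> continuous_map X X cf \<and> cf \<in> extensional (carrier G)},
               mult = (\<lambda>cf cg. compose (carrier G) cf cg),
               one = (\<lambda>x\<in>carrier G. x) \<rparr>"

definition twisted_classes :: "'g monoid \<Rightarrow> ('g \<Rightarrow> 'g) \<Rightarrow> 'g set set" where
  "twisted_classes G cf =
     (\<lambda>x. {y \<in> carrier G. \<exists>g\<in>carrier G. y = g \<otimes>\<^bsub>G\<^esub> x \<otimes>\<^bsub>G\<^esub> inv\<^bsub>G\<^esub> (cf g)}) ` carrier G"

definition reidemeister_infinite :: "'g monoid \<Rightarrow> ('g \<Rightarrow> 'g) \<Rightarrow> bool" where
  "reidemeister_infinite G cf \<longleftrightarrow> infinite (twisted_classes G cf)"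

fun lower_central :: "'g monoid \<Rightarrow> nat \<Rightarrow> 'g set" where
  "lower_central G 0 = carrier G"
| "lower_central G (Suc n) = generate G
     {a \<otimes>\<^bsub>G\<^esub> b \<otimes>\<^bsub>G\<^esub> inv\<^bsub>G\<^esub> a \<otimes>\<^bsub>G\<^esub> inv\<^bsub>G\<^esub> b | a b. a \<in> carrier G \<and> b \<in> lower_central G n}"

definition nilpotent_group :: "'g monoid \<Rightarrow> bool" where
  "nilpotent_group G \<longleftrightarrow> (\<exists>n. lower_central G n = {\<one>\<^bsub>G\<^esub>})"

end

theory Submission
  imports Defs "HOL-Computational_Algebra.Fundamental_Theorem_Algebra"
begin

text \<open>For a continuous automorphism \<open>\<alpha>\<close> let \<open>D\<alpha>\<close> be its derivative at the identity. Since
  conjugation by \<open>g x \<alpha>(g)\<inverse>\<close> followed by \<open>\<alpha>\<close> is conjugate to conjugation by \<open>x\<close> followed by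
  \<open>\<alpha>\<close>, the spectrum of \<open>Ad(x) D\<alpha>\<close> only depends on the \<open>\<alpha>\<close>-twisted class of \<open>x\<close>. If there are
  finitely many classes, only finitely many eigenvalues occur, so by connectedness the trace of
  \<open>Ad(x) D\<alpha>\<close> on every subquotient of the complexified Lie algebra stable under \<open>Ad(G)\<close> and
  \<open>D\<alpha>\<close> is independent of \<open>x\<close>.

  Let \<open>L\<close> consist of those \<open>\<alpha>\<close> for which conjugation by \<open>D\<alpha>\<close> fixes each of the finitely many
  maximal ideals of the algebra spanned by \<open>Ad(G)\<close>. For \<open>\<alpha> \<in> L\<close> an irreducible such subquotient is
  already irreducible under \<open>Ad(G)\<close>. If \<open>Ad(G)\<close> acted nontrivially, the ideal spanned by the
  differences \<open>Ad(x) - Ad(y)\<close> would by Burnside's theorem act as the full matrix algebra, while the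
  trace of its product with \<open>D\<alpha>\<close> vanishes; this is absurd. So \<open>Ad(G)\<close> is unipotent and \<open>G\<close>, whose
  centre is the kernel of \<open>Ad\<close>, is nilpotent. A nilpotent group with finitely many conjugacy classes
  has finite centre, and connectedness then kills the last nontrivial term of its lower central
  series.

  The derivatives are obtained from a single chart at the identity, in which the product is
  \<open>a + b + O(|a||b|)\<close>: a continuous homomorphism is Lipschitz there, hence additive up to
  \<open>O(|a||b|)\<close>, hence differentiable at the identity.\<close>

section \<open>Linear algebra over the complex matrices\<close>

text \<open>The subgroup L answers one obstacle. Restricted to Ad(G), an irreducible module of the
  larger algebra may split into several blocks that D\<alpha> permutes. Then Ad(x) D\<alpha> has
  zero diagonal blocks, its trace is 0 for every x, and constancy of the trace says nothing. The
  blocks are told apart by the annihilators of their simple constituents, which are maximal ideals,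
  so fixing these ideals excludes the permutation. Several copies of one simple module are excluded
  too, since a single operator D\<alpha> is added to Ad(G) and has an eigenvector in the space that
  counts the copies.

  Constancy itself comes from writing the trace on a subquotient of an n-dimensional module as a sum
  of at most n eigenvalues of Ad(x) D\<alpha>: finitely many eigenvalues leave finitely many values,
  and a continuous function with finitely many values on a connected space is constant.

  Subquotients are idempotent matrices of one fixed size, so that an induction over them never
  changes the type of the matrices.\<close>

lemma matrix_diff_ldistrib: "A ** (B - C) = A ** B - A ** (C :: complex^'n^'n)"
  by (vector matrix_matrix_mult_def sum_subtractf[symmetric] algebra_simps)

lemma matrix_diff_rdistrib: "(B - C) ** A = B ** A - C ** (A :: complex^'n^'n)"
  by (vector matrix_matrix_mult_def sum_subtractf[symmetric] algebra_simps)

lemma matrix_add_rdistrib: "(B + C) ** A = B ** A + C ** (A :: complex^'n^'n)"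
  by (vector matrix_matrix_mult_def sum.distrib[symmetric] algebra_simps)

lemma mat_vec_scalar: "mat c *v v = c *s (v :: complex^'n)"
  by (simp add: vec_eq_iff matrix_vector_mult_def mat_def if_distrib if_distribR cong: if_cong)

lemma mat_mul_scalar: "(mat c ** A) *v v = c *s (A *v (v :: complex^'n))"
  by (metis mat_vec_scalar matrix_vector_mul_assoc)

lemma mat_mul_commute: "A ** mat c = mat c ** (A :: complex^'n^'n)"
  by (simp add: vec_eq_iff matrix_matrix_mult_def mat_def if_distrib if_distribR mult.commute cong: if_cong)

lemma mult_mat_left: "(A :: complex^'n^'n) ** (mat c ** B) = mat c ** (A ** (B :: complex^'n^'n))"
  by (simp only: matrix_mul_assoc mat_mul_commute[of A c])

lemma trace_mat_mul: "trace (mat c ** A) = c * trace (A :: complex^'n^'n)"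
proof -
  have "(mat c ** A) $ i $ i = c * A $ i $ i" for i
    by (simp add: matrix_matrix_mult_def mat_def if_distrib if_distribR cong: if_cong)
  then show ?thesis by (simp add: trace_def sum_distrib_left)
qed

lemma scaleR_eq_mat_mul: "r *\<^sub>R A = mat (of_real r) ** (A :: complex^'n^'n)"
  unfolding vec_eq_iff matrix_matrix_mult_def mat_def 
  by (simp add: scaleR_conv_of_real[where 'a=complex] if_distrib if_distribR cong: if_cong)

section \<open>Evaluation of p(A) v by Horner's scheme; eigenvectors in invariant subspaces\<close>

definition poly_act :: "complex^'n^'n \<Rightarrow> complex poly \<Rightarrow> complex^'n \<Rightarrow> complex^'n" where
  "poly_act A p v = fold_coeffs (\<lambda>c w. c *s v + A *v w) p 0"

lemma poly_act_0 [simp]: "poly_act A 0 v = 0"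
  by (simp add: poly_act_def)

lemma poly_act_pCons [simp]: "poly_act A (pCons c p) v = c *s v + A *v poly_act A p v"
  by (cases "c = 0 \<and> p = 0") (auto simp: poly_act_def)

lemma poly_act_add: "poly_act A (p + q) v = poly_act A p v + poly_act A q v"
  by (induction p q rule: poly_induct2) (auto simp: algebra_simps matrix_vector_right_distrib vector_sadd_rdistrib)

lemma poly_act_smult: "poly_act A (smult c p) v = c *s poly_act A p v"
  by (induction p) (auto simp: vector_add_ldistrib vec.linear_scale vector_scalar_commute)

lemma poly_act_sum: "finite I \<Longrightarrow> poly_act A (\<Sum>i\<in>I. p i) v = (\<Sum>i\<in>I. poly_act A (p i) v)"
  by (induction I rule: finite_induct) (auto simp: poly_act_add)

lemma poly_act_monom: "poly_act A (monom c k) v = c *s (((*v) A) ^^ k) v"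
  by (induction k) (auto simp: monom_Suc monom_0 vector_scalar_commute)

lemma poly_act_linear_factor:
  "poly_act A ([:- z, 1:] * q) v = A *v poly_act A q v - z *s poly_act A q v"
proof -
  have "[:- z, 1:] * q = smult (- z) q + pCons 0 q"
    by simp
  then show ?thesis
    by (simp only: poly_act_add poly_act_smult poly_act_pCons) simp
qed

lemma poly_act_mem:
  assumes "vec.subspace U" "\<And>u. u \<in> U \<Longrightarrow> A *v u \<in> U" "v \<in> U"
  shows "poly_act A p v \<in> U"
  using assms by (induction p) (auto simp: vec.subspace_0 vec.subspace_add vec.subspace_scale)

lemma annihilating_poly:
  fixes A :: "complex^'n^'n"
  obtains p where "p \<noteq> 0" "poly_act A p v = 0"
proof -
  define w where "w = (\<lambda>i. (((*v) A) ^^ i) v)"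
  let ?N = "{..CARD('n)}"
  show ?thesis
  \<comment> \<open>\<open>vec.dependent\<close> concerns the set of iterates, not the family. A
    repetition A^i v = A^j v is therefore treated apart, with the polynomial X^i - X^j; otherwise
    there are CARD('n) + 1 distinct vectors.\<close>
  proof (cases "inj_on w ?N")
    case False
    then obtain i j where ij: "i \<noteq> j" "w i = w j"
      by (auto simp: inj_on_def)
    let ?p = "monom 1 i + monom (-1) j :: complex poly"
    have "coeff ?p i \<noteq> 0"
      using ij(1) by simp
    then have "?p \<noteq> 0" by (metis coeff_0)
    moreover have "poly_act A ?p v = 0"
      using ij(2) by (simp add: poly_act_add poly_act_monom w_def)
    ultimately show ?thesis using that by blast
  next
    case True
    have "card (w ` ?N) = CARD('n) + 1"
      using True by (simp add: card_image)
    then have "vec.dependent (w ` ?N)"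
      using vec.independent_card_le_dim[of "w ` ?N" UNIV] by (auto simp: card_cart_basis)
    then obtain u where u: "\<exists>x\<in>w ` ?N. u x \<noteq> 0" "(\<Sum>x\<in>w ` ?N. u x *s x) = 0"
      using vec.dependent_finite[of "w ` ?N"] by auto
    let ?p = "\<Sum>i\<in>?N. monom (u (w i)) i"
    obtain i where i: "i \<in> ?N" "u (w i) \<noteq> 0" using u(1) by auto
    have "coeff ?p i = u (w i)"
      using i(1) by (simp add: coeff_sum if_distrib cong: if_cong)
    then have "?p \<noteq> 0" using i(2) by (metis coeff_0)
    moreover have "poly_act A ?p v = (\<Sum>i\<in>?N. u (w i) *s w i)"
      by (simp add: poly_act_sum poly_act_monom w_def)
    then have "poly_act A ?p v = 0"
      using u(2) True by (simp add: sum.reindex)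
    ultimately show ?thesis using that by blast
  qed
qed

text \<open>A polynomial p of least degree with p(A) \<open>u0\<close> = 0 has a root z, say p = (X
  - z) q. By minimality q(A) \<open>u0\<close> is nonzero, and A - z kills it. Starting from a
  vector of \<open>U\<close> keeps the eigenvector inside the invariant subspace.\<close>

lemma eigenvector_exists:
  fixes A :: "complex^'n^'n"
  assumes U: "vec.subspace U" "\<And>u. u \<in> U \<Longrightarrow> A *v u \<in> U" and ne: "u0 \<in> U" "u0 \<noteq> 0"
  obtains \<mu> v where "v \<in> U" "v \<noteq> 0" "A *v v = \<mu> *s v"
proof -
  let ?P = "\<lambda>p. p \<noteq> 0 \<and> poly_act A p u0 = 0"
  obtain p0 where "?P p0" using annihilating_poly by blast
  then obtain p where p: "p \<noteq> 0" "poly_act A p u0 = 0"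
    and min: "\<And>q. ?P q \<Longrightarrow> degree p \<le> degree q"
    using ex_has_least_nat[of ?P p0 degree] by blast
  have "degree p \<noteq> 0"
  proof
    assume "degree p = 0"
    then obtain c where "p = [:c:]" by (meson degree_eq_zeroE)
    then show False using p ne(2) by auto
  qed
  then obtain z where "poly p z = 0"
    using fundamental_theorem_of_algebra[of p] constant_degree[of p] by auto
  then obtain q where q: "p = [:- z, 1:] * q"
    by (metis dvdE poly_eq_0_iff_dvd)
  then have "q \<noteq> 0" using p by auto
  then have "degree p = Suc (degree q)"
    unfolding q by (subst degree_mult_eq) auto
  then have "poly_act A q u0 \<noteq> 0"
    using min[of q] \<open>q \<noteq> 0\<close> by auto
  moreover have "poly_act A q u0 \<in> U"
    by (rule poly_act_mem) (use assms in auto)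
  moreover have "A *v poly_act A q u0 = z *s poly_act A q u0"
    using p(2) unfolding q poly_act_linear_factor by simp
  ultimately show ?thesis using that by blast
qed

section \<open>Idempotents: their ranges, and traces of the corners e M e\<close>

definition fixed_space :: "complex^'n^'n \<Rightarrow> (complex^'n) set" where
  "fixed_space e = {v. e *v v = v}"

lemma subspace_fixed_space [intro, simp]: "vec.subspace (fixed_space e)"
  by (auto simp: fixed_space_def vec.subspace_def matrix_vector_right_distrib vector_scalar_commute)

lemma fixed_space_eq_range: "e ** e = e \<Longrightarrow> fixed_space e = range ((*v) e)"
  by (auto simp: fixed_space_def matrix_vector_mul_assoc) (metis rangeI)

lemma fixed_space_nonzero:
  assumes "e ** e = e" "e \<noteq> 0"
  obtains v where "v \<in> fixed_space e" "v \<noteq> 0"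
proof -
  obtain x where "e *v x \<noteq> 0"
    using assms(2) matrix_eq[of e 0] by auto
  then show ?thesis using that fixed_space_eq_range[OF assms(1)] by blast
qed

lemma dim_fixed_space_psubset:
  assumes "fixed_space q \<subset> fixed_space e"
  shows "vec.dim (fixed_space q) < vec.dim (fixed_space e)"
  by (rule vec.dim_psubset) (use assms in \<open>simp add: vec.span_eq_iff[THEN iffD2]\<close>)

text \<open>Triangularisation without triangular matrices: split off an eigenvector of
  \<open>y\<close> in the range of \<open>e\<close> and compress \<open>y\<close> to a complement of
  it there. That the list is nonempty for \<open>e \<noteq> 0\<close> is recorded for the trace of a
  nonzero idempotent.\<close>

lemma trace_corner_eigenvalues:
  fixes e y :: "complex^'n^'n"
  assumes "e ** e = e" "e ** y = y" "y ** e = y"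
    and "\<And>\<mu> v. v \<noteq> 0 \<Longrightarrow> v \<in> fixed_space e \<Longrightarrow> y *v v = \<mu> *s v \<Longrightarrow> \<mu> \<in> \<Lambda>"
  shows "\<exists>ls. set ls \<subseteq> \<Lambda> \<and> length ls \<le> vec.dim (fixed_space e) \<and> (e \<noteq> 0 \<longrightarrow> ls \<noteq> []) \<and> trace y = sum_list ls"
  using assms
proof (induction "vec.dim (fixed_space e)" arbitrary: e y rule: less_induct)
  case less
  note e = less.prems
  show ?case
  proof (cases "e = 0")
    case True
    then have "y = 0" using e(2) by simp
    then show ?thesis using True trace_0 by (intro exI[of _ "[]"]) (simp add: trace_def)
  next
    case False
    obtain v0 where v0: "v0 \<in> fixed_space e" "v0 \<noteq> 0" using fixed_space_nonzero[OF e(1) False] .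
    have inv: "y *v u \<in> fixed_space e" for u
      using e(2) by (simp add: fixed_space_def matrix_vector_mul_assoc)
    obtain l v where v: "v \<in> fixed_space e" "v \<noteq> 0" "y *v v = l *s v"
      by (rule eigenvector_exists[of "fixed_space e" y v0]) (use inv v0 in auto)
    then have lL: "l \<in> \<Lambda>" using e(4) by blast
    have ev: "e *v v = v" using v(1) by (simp add: fixed_space_def)
    obtain i where i: "v $ i \<noteq> 0" using v(2) by (auto simp: vec_eq_iff)
    \<comment> \<open>The projection onto the line of \<open>v\<close> along the kernel of w -> (e
      w)_i / v_i. Passing through \<open>e\<close> puts it into the corner, so that
      \<open>q = e - p\<close> is again idempotent.\<close>
    define p where "p = (\<chi> j k. v $ j * e $ i $ k / v $ i)"
    have pw: "p *v w = ((e *v w) $ i / v $ i) *s v" for w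
      by (simp add: p_def vec_eq_iff matrix_vector_mult_def sum_distrib_left sum_divide_distrib mult_ac)
    have pe: "p ** e = p"
      by (simp add: matrix_eq pw flip: matrix_vector_mul_assoc) (simp add: matrix_vector_mul_assoc e(1))
    have ep: "e ** p = p"
      by (simp add: matrix_eq pw ev vector_scalar_commute flip: matrix_vector_mul_assoc)
    have pv: "p *v v = v" using i by (simp add: pw ev)
    have pp: "p ** p = p"
      by (simp add: matrix_eq pw ev vector_scalar_commute i flip: matrix_vector_mul_assoc)
    have yp: "y ** p = mat l ** p"
      by (simp add: matrix_eq pw v(3) vector_scalar_commute mat_vec_scalar flip: matrix_vector_mul_assoc)
    have "trace p = (e *v v) $ i / v $ i"
      by (simp add: p_def trace_def matrix_vector_mult_def sum_divide_distrib mult_ac)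
    then have tp: "trace p = 1" using i ev by simp
    define q where "q = e - p"
    have qq: "q ** q = q"
      by (simp add: q_def matrix_diff_ldistrib matrix_diff_rdistrib e(1) pe ep pp)
    have eq: "e ** q = q" "q ** e = q"
      by (simp_all add: q_def matrix_diff_ldistrib matrix_diff_rdistrib e(1) pe ep)
    have sub: "fixed_space q \<subseteq> fixed_space e"
      using eq(1) by (auto simp: fixed_space_def) (metis matrix_vector_mul_assoc)
    have qv: "q *v v = 0"
      by (simp add: q_def matrix_vector_mult_diff_rdistrib ev pv)
    then have "v \<notin> fixed_space q" using v(2) by (simp add: fixed_space_def)
    then have lt: "vec.dim (fixed_space q) < vec.dim (fixed_space e)"
      using dim_fixed_space_psubset sub v(1) by blast
    define z where "z = q ** y"
    have qyp: "q ** y ** p = 0"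
    proof -
      have "q ** p = 0" by (simp add: q_def matrix_diff_rdistrib ep pp)
      then show ?thesis
        by (metis matrix_mul_assoc mat_mul_commute yp times0_right)
    qed
    have z: "q ** z = z" "z ** q = z"
    proof -
      show "q ** z = z" by (simp add: z_def matrix_mul_assoc qq)
      have "z ** q = q ** y ** e - q ** y ** p"
        by (simp add: z_def q_def matrix_diff_ldistrib)
      also have "q ** y ** e = z" by (metis e(3) matrix_mul_assoc z_def)
      finally show "z ** q = z" by (simp add: qyp)
    qed
    have eig: "\<mu> \<in> \<Lambda>" if w: "w \<noteq> 0" "w \<in> fixed_space q" "z *v w = \<mu> *s w" for \<mu> w
    proof (cases "\<mu> = l")
      case False
      have we: "w \<in> fixed_space e" using sub w(2) by blast
      have "y *v w = z *v w + p *v (y *v w)"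
        by (simp add: z_def q_def matrix_diff_rdistrib e(2) matrix_vector_mult_diff_rdistrib matrix_vector_mul_assoc)
      then obtain c where c: "y *v w = \<mu> *s w + c *s v"
        using w(3) pw by metis
      \<comment> \<open>Modulo \<open>v\<close> the vector \<open>w\<close> is an eigenvector of
        \<open>y\<close>. The multiple of \<open>v\<close> is chosen to absorb the remaining term c
        v, which requires \<mu> \<noteq> l.\<close>
      let ?u = "w + (c / (\<mu> - l)) *s v"
      have "y *v ?u = \<mu> *s w + (c + l * c / (\<mu> - l)) *s v"
        by (simp add: matrix_vector_right_distrib c vector_scalar_commute v(3) vector_sadd_rdistrib vector_smult_assoc mult_ac)
      also have "c + l * c / (\<mu> - l) = \<mu> * (c / (\<mu> - l))"
        using False by (simp add: field_simps)
      finally have "y *v ?u = \<mu> *s ?u"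
        by (simp add: vector_add_ldistrib vector_smult_assoc)
      moreover have "?u \<noteq> 0"
      proof
        assume "?u = 0"
        then have "q *v ?u = 0" by simp
        then show False using w qv by (simp add: matrix_vector_right_distrib vector_scalar_commute fixed_space_def)
      qed
      moreover have "?u \<in> fixed_space e"
        using we v(1) vec.subspace_add vec.subspace_scale subspace_fixed_space by blast
      ultimately show ?thesis using e(4) by blast
    qed (use lL in simp)
    have "\<exists>ls. set ls \<subseteq> \<Lambda> \<and> length ls \<le> vec.dim (fixed_space q) \<and> (q \<noteq> 0 \<longrightarrow> ls \<noteq> []) \<and> trace z = sum_list ls"
      by (rule less.hyps[OF lt qq z]) (rule eig)
    then obtain ls where ls: "set ls \<subseteq> \<Lambda>" "length ls \<le> vec.dim (fixed_space q)" "trace z = sum_list ls"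
      by blast
    have "trace y = trace (y ** q) + trace (y ** p)"
      by (simp add: q_def matrix_diff_ldistrib e(3) trace_sub)
    also have "trace (y ** q) = trace z"
      by (metis trace_mul_sym z_def)
    also have "trace (y ** p) = l"
      by (simp add: yp trace_mat_mul tp)
    finally show ?thesis
      using ls lL lt by (intro exI[of _ "l # ls"]) auto
  qed
qed

text \<open>The only eigenvalue of \<open>e\<close> on its range is 1, so the trace is the length of
  a nonempty list of ones.\<close>

lemma trace_idempotent_nonzero:
  fixes e :: "complex^'n^'n"
  assumes "e ** e = e" "e \<noteq> 0"
  shows "trace e \<noteq> 0"
proof -
  have "\<exists>ls. set ls \<subseteq> {1} \<and> length ls \<le> vec.dim (fixed_space e) \<and> (e \<noteq> 0 \<longrightarrow> ls \<noteq> []) \<and> trace e = sum_list ls"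
    by (rule trace_corner_eigenvalues)
      (use assms vec.scale_cancel_right[of _ _ 1] in \<open>auto simp: fixed_space_def\<close>)
  then obtain ls where ls: "set ls \<subseteq> {1}" "ls \<noteq> []" "trace e = sum_list ls" using assms by blast
  have "set ls \<subseteq> {1} \<Longrightarrow> sum_list ls = of_nat (length ls)" for ls :: "complex list"
    by (induction ls) auto
  with ls show ?thesis by simp
qed

section \<open>Burnside's theorem\<close>

text \<open>A complex multiple of a matrix is written as a product with \<open>mat c\<close>. By
  \<open>scaleR_eq_mat_mul\<close> the real multiples are among these, so such a set is also a real
  subspace and \<open>dim\<close> applies to it.\<close>

definition complex_subspace :: "(complex^'n^'n) set \<Rightarrow> bool" where
  "complex_subspace N \<longleftrightarrow> 0 \<in> N \<and> (\<forall>a\<in>N. \<forall>b\<in>N. a + b \<in> N) \<and> (\<forall>c. \<forall>a\<in>N. mat c ** a \<in> N)"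

text \<open>Closure under products only, so that a two-sided ideal compressed to a corner also
  qualifies; Burnside's theorem is applied to such sets.\<close>

definition nonunital_algebra :: "(complex^'n^'n) set \<Rightarrow> bool" where
  "nonunital_algebra N \<longleftrightarrow> complex_subspace N \<and> (\<forall>a\<in>N. \<forall>b\<in>N. a ** b \<in> N)"

definition matrix_algebra :: "(complex^'n^'n) set \<Rightarrow> bool" where
  "matrix_algebra N \<longleftrightarrow> nonunital_algebra N \<and> mat 1 \<in> N"

lemma complex_subspaceI:
  assumes "0 \<in> N" "\<And>a b. a \<in> N \<Longrightarrow> b \<in> N \<Longrightarrow> a + b \<in> N" "\<And>c a. a \<in> N \<Longrightarrow> mat c ** a \<in> N"
  shows "complex_subspace N"
  using assms by (simp add: complex_subspace_def)

lemma matrix_algebraI: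
  assumes "complex_subspace N" "mat 1 \<in> N" "\<And>a b. a \<in> N \<Longrightarrow> b \<in> N \<Longrightarrow> a ** b \<in> N"
  shows "matrix_algebra N"
  using assms by (simp add: matrix_algebra_def nonunital_algebra_def)

lemma complex_subspaceD:
  assumes "complex_subspace N"
  shows "0 \<in> N" "a \<in> N \<Longrightarrow> b \<in> N \<Longrightarrow> a + b \<in> N" "a \<in> N \<Longrightarrow> mat c ** a \<in> N"
    "a \<in> N \<Longrightarrow> - a \<in> N" "a \<in> N \<Longrightarrow> b \<in> N \<Longrightarrow> a - b \<in> N"
proof -
  show *: "0 \<in> N" "\<And>a b. a \<in> N \<Longrightarrow> b \<in> N \<Longrightarrow> a + b \<in> N" "\<And>a c. a \<in> N \<Longrightarrow> mat c ** a \<in> N"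
    using assms by (auto simp: complex_subspace_def)
  have "- a = mat (-1) ** a" for a :: "complex^'n^'n"
    using scaleR_eq_mat_mul[of "-1" a] by simp
  then show m: "a \<in> N \<Longrightarrow> - a \<in> N" for a
    using * by metis
  show "a \<in> N \<Longrightarrow> b \<in> N \<Longrightarrow> a - b \<in> N" for a b
    using *(2)[OF _ m] by simp
qed

lemma complex_subspace_subspace: "complex_subspace N \<Longrightarrow> subspace N"
  by (auto simp: subspace_def complex_subspace_def scaleR_eq_mat_mul)

lemma complex_subspace_sum:
  "complex_subspace N \<Longrightarrow> (\<And>i. i \<in> F \<Longrightarrow> f i \<in> N) \<Longrightarrow> sum f F \<in> N"
  by (induction F rule: infinite_finite_induct) (auto simp: complex_subspaceD)

lemma complex_subspace_hull: "complex_subspace (complex_subspace hull R)"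
  by (rule hull_in) (auto simp: complex_subspace_def)

lemma matrix_algebra_hull: "matrix_algebra (matrix_algebra hull R)"
  by (rule hull_in) (auto simp: matrix_algebra_def nonunital_algebra_def complex_subspace_def)

lemma matrix_algebraD:
  assumes "matrix_algebra N"
  shows "complex_subspace N" "nonunital_algebra N" "mat 1 \<in> N" "mat c \<in> N"
    "a \<in> N \<Longrightarrow> b \<in> N \<Longrightarrow> a ** b \<in> N"
proof -
  show *: "complex_subspace N" "nonunital_algebra N" "mat 1 \<in> N" "a \<in> N \<Longrightarrow> b \<in> N \<Longrightarrow> a ** b \<in> N"
    using assms by (auto simp: matrix_algebra_def nonunital_algebra_def)
  show "mat c \<in> N" using complex_subspaceD(3)[OF *(1) *(3), of c] by simp
qed

lemma dim_image_less:
  fixes A :: "complex^'n^'n"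
  assumes "u \<in> U" "u \<noteq> 0" "A *v u = 0"
  shows "vec.dim ((*v) A ` U) < vec.dim U"
proof -
  have "vec.independent {u}" using assms(2) by simp
  then obtain B where B: "{u} \<subseteq> B" "B \<subseteq> U" "vec.independent B" "U \<subseteq> vec.span B"
    using vec.maximal_independent_subset_extend[of "{u}" U] assms(1) by auto
  have fin: "finite B" using B(3) vec.finiteI_independent by blast
  have "(*v) A ` U \<subseteq> (*v) A ` vec.span B" using B(4) by blast
  also have "\<dots> = vec.span ((*v) A ` B)" by (simp add: vec.span_image)
  also have "(*v) A ` B = insert 0 ((*v) A ` (B - {u}))" using B(1) assms(3) by force
  finally have "(*v) A ` U \<subseteq> vec.span ((*v) A ` (B - {u}))" by simp
  then have "vec.dim ((*v) A ` U) \<le> card ((*v) A ` (B - {u}))"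
    by (rule vec.dim_le_card) (use fin in simp)
  also have "\<dots> \<le> card (B - {u})" using fin by (simp add: card_image_le)
  also have "\<dots> < card B" using fin B(1) by (intro psubset_card_mono) auto
  also have "card B = vec.dim U" using B by (intro vec.basis_card_eq_dim) auto
  finally show ?thesis .
qed

text \<open>A nonzero operator of minimal rank has rank one, for otherwise \<open>TAT - \<mu>T\<close> with \<open>\<mu>\<close> an
  eigenvalue of \<open>TA\<close> on the image of \<open>T\<close> has smaller rank.\<close>
lemma transitive_algebra_rank_one:
  fixes N :: "(complex^'n^'n) set"
  assumes N: "nonunital_algebra N" and S: "vec.subspace S"
    and inv: "\<And>a s. a \<in> N \<Longrightarrow> s \<in> S \<Longrightarrow> a *v s \<in> S"
    and trans: "\<And>s t. s \<in> S \<Longrightarrow> s \<noteq> 0 \<Longrightarrow> t \<in> S \<Longrightarrow> \<exists>a\<in>N. a *v s = t"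
    and ne: "s0 \<in> S" "s0 \<noteq> 0"
  obtains T x y where "T \<in> N" "x \<in> S" "y \<noteq> 0" "T *v x = y" "\<And>s. s \<in> S \<Longrightarrow> \<exists>c. T *v s = c *s y"
proof -
  have N': "complex_subspace N" "\<And>a b. a \<in> N \<Longrightarrow> b \<in> N \<Longrightarrow> a ** b \<in> N"
    using N by (auto simp: nonunital_algebra_def)
  let ?P = "\<lambda>T. T \<in> N \<and> (\<exists>s\<in>S. T *v s \<noteq> 0)"
  obtain T0 where "?P T0" using trans[OF ne ne(1)] ne by metis
  then have "\<exists>T. ?P T \<and> (\<forall>T'. ?P T' \<longrightarrow> vec.dim ((*v) T ` S) \<le> vec.dim ((*v) T' ` S))"
    by (rule ex_has_least_nat[where m = "\<lambda>T. vec.dim ((*v) T ` S)"])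
  then obtain T where T: "?P T"
    and min: "\<And>T'. ?P T' \<Longrightarrow> vec.dim ((*v) T ` S) \<le> vec.dim ((*v) T' ` S)"
    by blast
  obtain x where x: "x \<in> S" "T *v x \<noteq> 0" using T by blast
  let ?U = "(*v) T ` S"
  have "\<exists>c. T *v s = c *s (T *v x)" if s: "s \<in> S" for s
  proof (rule ccontr)
    assume no: "\<nexists>c. T *v s = c *s (T *v x)"
    obtain A where A: "A \<in> N" "A *v (T *v x) = s"
      using trans[of "T *v x" s] x s inv T by blast
    have U: "vec.subspace ?U" using S vec.subspace_image by blast
    obtain \<mu> u where u: "u \<in> ?U" "u \<noteq> 0" "(T ** A) *v u = \<mu> *s u"
    proof (rule eigenvector_exists[OF U])
      show "(T ** A) *v u \<in> ?U" if "u \<in> ?U" for u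
        using that inv A(1) T by (auto simp flip: matrix_vector_mul_assoc)
    qed (use x in auto)
    let ?g = "T ** A - mat \<mu>"
    let ?T2 = "T ** A ** T - mat \<mu> ** T"
    have "?T2 \<in> N" using A T by (intro complex_subspaceD N') auto
    \<comment> \<open>On \<open>x\<close> the operator \<open>?T2\<close> takes the value T s -
      \<mu> T x, which is nonzero because T s is no multiple of T x. So \<open>?T2\<close> competes
      with \<open>T\<close> for minimal rank.\<close>
    moreover have "?T2 *v x \<noteq> 0"
      using no A(2) by (auto simp: matrix_vector_mult_diff_rdistrib mat_mul_scalar mat_vec_scalar simp flip: matrix_vector_mul_assoc)
    ultimately have "vec.dim ?U \<le> vec.dim ((*v) ?T2 ` S)" using min x(1) by blast
    moreover have "(*v) ?T2 ` S = (*v) ?g ` ?U"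
      by (simp add: image_image matrix_vector_mult_diff_rdistrib matrix_vector_mul_assoc)
    moreover have "vec.dim ((*v) ?g ` ?U) < vec.dim ?U"
      by (rule dim_image_less[OF u(1,2)]) (simp add: matrix_vector_mult_diff_rdistrib u(3) mat_vec_scalar)
    ultimately show False by simp
  qed
  then show ?thesis using that T x by blast
qed

text \<open>Let E s = \<phi>(s) y be a rank one operator of \<open>N\<close>. By transitivity the
  functionals \<phi> o b with b in \<open>N\<close> contain a dual basis of \<open>S\<close>, and
  \<open>y\<close> can be moved to any target. Hence T is the sum of C_f E B_f over a basis, with
  \<phi> o B_f dual to the basis vector f and C_f y = T f.\<close>

theorem burnside:
  fixes N :: "(complex^'n^'n) set"
  assumes N: "nonunital_algebra N" and S: "vec.subspace S"
    and inv: "\<And>a s. a \<in> N \<Longrightarrow> s \<in> S \<Longrightarrow> a *v s \<in> S"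
    and trans: "\<And>s t. s \<in> S \<Longrightarrow> s \<noteq> 0 \<Longrightarrow> t \<in> S \<Longrightarrow> \<exists>a\<in>N. a *v s = t"
    and T: "\<And>s. s \<in> S \<Longrightarrow> T *v s \<in> S"
  obtains a where "a \<in> N" "\<And>s. s \<in> S \<Longrightarrow> a *v s = T *v s"
proof (cases "S \<subseteq> {0}")
  case True
  then have "0 *v s = T *v s" if "s \<in> S" for s using that by auto
  moreover have "0 \<in> N" using N by (simp add: nonunital_algebra_def complex_subspace_def)
  ultimately show ?thesis using that by blast
next
  case False
  then obtain s0 where s0: "s0 \<in> S" "s0 \<noteq> 0" by blast
  have N': "complex_subspace N" "\<And>a b. a \<in> N \<Longrightarrow> b \<in> N \<Longrightarrow> a ** b \<in> N"
    using N by (auto simp: nonunital_algebra_def)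
  obtain E x y where E: "E \<in> N" "x \<in> S" "y \<noteq> 0" "E *v x = y" "\<And>s. s \<in> S \<Longrightarrow> \<exists>c. E *v s = c *s y"
    by (rule transitive_algebra_rank_one[OF N S _ _ s0]) (use inv trans in auto)
  have yS: "y \<in> S" using E inv by blast
  obtain i where i: "y $ i \<noteq> 0" using E(3) by (auto simp: vec_eq_iff)
  define \<phi> where "\<phi> s = (E *v s) $ i / y $ i" for s
  have \<phi>: "E *v s = \<phi> s *s y" if "s \<in> S" for s
    using E(5)[OF that] i by (auto simp: \<phi>_def)
  have \<phi>_add: "\<phi> (s + t) = \<phi> s + \<phi> t" and \<phi>_diff: "\<phi> (s - t) = \<phi> s - \<phi> t"
    and \<phi>_scale: "\<phi> (c *s s) = c * \<phi> s" for s t c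
    by (simp_all add: \<phi>_def matrix_vector_right_distrib matrix_vector_mult_diff_distrib vector_scalar_commute add_divide_distrib diff_divide_distrib)
  have \<phi>_sum: "finite F \<Longrightarrow> \<phi> (sum f F) = (\<Sum>j\<in>F. \<phi> (f j))" for f and F :: "(complex^'n) set"
    by (induction F rule: finite_induct) (simp_all add: \<phi>_add, simp add: \<phi>_def)
  have \<phi>x: "\<phi> x = 1" using i E(4) by (simp add: \<phi>_def)
  have dual: "\<exists>B. \<forall>f\<in>F. B f \<in> N \<and> (\<forall>g\<in>F. \<phi> (B f *v g) = (if f = g then 1 else 0))"
    if "finite F" "F \<subseteq> S" "vec.independent F" for F
    using that
  proof (induction F rule: finite_induct)
    case (insert z F)
    have zF: "z \<notin> vec.span F" and indF: "vec.independent F"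
      using insert.prems(2) insert.hyps(2) vec.independent_insert[of z F] by auto
    obtain B where B: "\<And>f. f \<in> F \<Longrightarrow> B f \<in> N"
      "\<And>f g. f \<in> F \<Longrightarrow> g \<in> F \<Longrightarrow> \<phi> (B f *v g) = (if f = g then 1 else 0)"
      using insert.IH insert.prems(1) indF by (metis insert_subset)
    \<comment> \<open>If every \<phi> o C that vanishes on F also vanished at z, then z minus its
      F-part would be killed by all \<phi> o C. Transitivity makes this difference 0, which puts z
      into the span of F.\<close>
    have "\<exists>C\<in>N. (\<forall>f\<in>F. \<phi> (C *v f) = 0) \<and> \<phi> (C *v z) \<noteq> 0"
    proof (rule ccontr)
      assume no: "\<not> ?thesis"
      define w where "w = z - (\<Sum>f\<in>F. \<phi> (B f *v z) *s f)"
      have "\<phi> (C *v w) = 0" if C: "C \<in> N" for C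
      proof -
        define C' where "C' = C - (\<Sum>f\<in>F. mat (\<phi> (C *v f)) ** B f)"
        have C'v: "\<phi> (C' *v v) = \<phi> (C *v v) - (\<Sum>f\<in>F. \<phi> (C *v f) * \<phi> (B f *v v))" for v
        proof -
          have "(\<Sum>f\<in>F. mat (\<phi> (C *v f)) ** B f) *v v = (\<Sum>f\<in>F. \<phi> (C *v f) *s (B f *v v))"
            using insert.hyps(1) by (induction F rule: finite_induct) (auto simp: matrix_vector_mult_add_rdistrib mat_mul_scalar)
          then show ?thesis
            by (simp add: C'_def matrix_vector_mult_diff_rdistrib \<phi>_diff \<phi>_sum[OF insert.hyps(1)] \<phi>_scale)
        qed
        have "C' \<in> N" unfolding C'_def
          by (intro complex_subspaceD(5)[OF N'(1)] C complex_subspace_sum[OF N'(1)] complex_subspaceD(3)[OF N'(1)] B)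
        moreover have "\<phi> (C' *v g) = 0" if "g \<in> F" for g
          using that insert.hyps(1) by (simp add: C'v B(2) if_distrib cong: if_cong)
        ultimately have "\<phi> (C' *v z) = 0" using no by blast
        then have "\<phi> (C *v z) = (\<Sum>f\<in>F. \<phi> (C *v f) * \<phi> (B f *v z))" by (simp add: C'v)
        then show ?thesis
          by (simp add: w_def matrix_vector_mult_diff_distrib \<phi>_diff vec.sum \<phi>_sum[OF insert.hyps(1)]
              vector_scalar_commute \<phi>_scale mult.commute)
      qed
      moreover have "w \<in> S"
        unfolding w_def using insert.prems(1)
        by (intro vec.subspace_diff[OF S] vec.subspace_sum[OF S] vec.subspace_scale[OF S]) auto
      ultimately have "w = 0" using trans[of w x] \<phi>x E(2) by force
      then have "z = (\<Sum>f\<in>F. \<phi> (B f *v z) *s f)" by (simp add: w_def)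
      also have "\<dots> \<in> vec.span F"
        by (intro vec.span_sum vec.span_scale vec.span_base)
      finally show False using zF by simp
    qed
    then obtain C0 where C0: "C0 \<in> N" "\<And>f. f \<in> F \<Longrightarrow> \<phi> (C0 *v f) = 0" "\<phi> (C0 *v z) \<noteq> 0" by blast
    define C where "C = mat (1 / \<phi> (C0 *v z)) ** C0"
    have C: "C \<in> N" "\<And>f. f \<in> F \<Longrightarrow> \<phi> (C *v f) = 0" "\<phi> (C *v z) = 1"
      using C0 complex_subspaceD(3)[OF N'(1)] by (auto simp: C_def mat_mul_scalar \<phi>_scale)
    \<comment> \<open>The new functional is 1 at z and 0 on F; each old one is corrected by a
      multiple of it so as to vanish at z.\<close>
    define B' where "B' f = (if f = z then C else B f - mat (\<phi> (B f *v z)) ** C)" for f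
    have "B' f \<in> N" if "f \<in> insert z F" for f
      using that B(1) C(1) complex_subspaceD[OF N'(1)] by (auto simp: B'_def)
    moreover have "\<phi> (B' f *v g) = (if f = g then 1 else 0)" if "f \<in> insert z F" "g \<in> insert z F" for f g
      using that insert.hyps(2) B(2) C
      by (auto simp: B'_def matrix_vector_mult_diff_rdistrib mat_mul_scalar \<phi>_diff \<phi>_scale)
    ultimately show ?case by blast
  qed simp
  obtain F where F: "F \<subseteq> S" "vec.independent F" "S \<subseteq> vec.span F"
    using vec.maximal_independent_subset[of S] by blast
  have fin: "finite F" using F(2) vec.finiteI_independent by blast
  obtain B where B: "\<And>f. f \<in> F \<Longrightarrow> B f \<in> N"
    "\<And>f g. f \<in> F \<Longrightarrow> g \<in> F \<Longrightarrow> \<phi> (B f *v g) = (if f = g then 1 else 0)"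
    using dual[OF fin F(1,2)] by blast
  have "\<forall>f\<in>F. \<exists>c\<in>N. c *v y = T *v f" using trans yS E(3) T F(1) by blast
  then obtain C where C: "\<And>f. f \<in> F \<Longrightarrow> C f \<in> N" "\<And>f. f \<in> F \<Longrightarrow> C f *v y = T *v f" by metis
  define a where "a = (\<Sum>f\<in>F. C f ** E ** B f)"
  have "a \<in> N" unfolding a_def by (intro complex_subspace_sum[OF N'(1)] N'(2) C B E)
  moreover have "a *v s = T *v s" if "s \<in> S" for s
  proof -
    have av: "a *v v = (\<Sum>f\<in>F. C f *v (E *v (B f *v v)))" for v
      unfolding a_def using fin
      by (induction F rule: finite_induct) (auto simp: matrix_vector_mult_add_rdistrib simp flip: matrix_vector_mul_assoc)
    have "a *v g = T *v g" if g: "g \<in> F" for g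
    proof -
      have "C f *v (E *v (B f *v g)) = (if f = g then T *v g else 0)" if f: "f \<in> F" for f
      proof -
        have "E *v (B f *v g) = \<phi> (B f *v g) *s y" using \<phi> inv B(1)[OF f] F(1) g by blast
        then show ?thesis using B(2)[OF f g] C(2)[OF f] by (simp add: vector_scalar_commute)
      qed
      then show ?thesis using g fin by (simp add: av)
    qed
    moreover have "s \<in> vec.span F" using that F(3) by blast
    then have "(\<forall>g\<in>F. a *v g = T *v g) \<longrightarrow> a *v s = T *v s"
      by (induction s rule: vec.span_induct_alt) (auto simp: matrix_vector_right_distrib vector_scalar_commute)
    ultimately show ?thesis by blast
  qed
  ultimately show ?thesis using that by blast
qed

section \<open>Matrix monoids normalised by an invertible matrix\<close>

text \<open>Left multiplication by \<open>a\<close> is an injective linear map of the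
  finite-dimensional space \<open>N\<close> into itself, hence onto, so it attains
  \<open>mat 1\<close>. The point is that the inverse lies in \<open>N\<close>.\<close>

lemma matrix_algebra_inverse:
  assumes N: "matrix_algebra N" and a: "a \<in> N" and inj: "\<And>v. a *v v = 0 \<Longrightarrow> v = 0"
  obtains b where "b \<in> N" "a ** b = mat 1" "b ** a = mat 1"
proof -
  note N' = matrix_algebraD[OF N]
  have lin: "linear (\<lambda>b. a ** b)"
    by (rule linearI) (simp_all add: matrix_add_ldistrib matrix_scalar_ac scalar_matrix_assoc)
  have inj': "inj_on (\<lambda>b. a ** b) N"
  proof (rule inj_onI)
    fix b c assume "a ** b = a ** c"
    then have "a *v (b *v v - c *v v) = 0" for v
      by (simp add: matrix_vector_mult_diff_distrib matrix_vector_mul_assoc)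
    then have "b *v v - c *v v = 0" for v by (rule inj)
    then show "b = c" by (simp add: matrix_eq)
  qed
  have sub: "subspace N" using N'(1) by (rule complex_subspace_subspace)
  have "dim ((\<lambda>b. a ** b) ` N) = dim N"
    by (rule dim_image_eq) (use lin inj' sub in \<open>auto simp: span_eq_iff[THEN iffD2]\<close>)
  moreover have "(\<lambda>b. a ** b) ` N \<subseteq> N" using N'(5) a by blast
  ultimately have "(\<lambda>b. a ** b) ` N = N"
    by (intro subspace_dim_equal) (use lin sub linear_subspace_image in auto)
  then obtain b where "b \<in> N" "a ** b = mat 1" using N'(3) by (metis (mono_tags, lifting) imageE)
  then show ?thesis using that matrix_left_right_inverse by blast
qed

definition algebra_ideal :: "(complex^'n^'n) set \<Rightarrow> (complex^'n^'n) set \<Rightarrow> bool" where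
  "algebra_ideal A J \<longleftrightarrow> complex_subspace J \<and> J \<subseteq> A \<and> (\<forall>a\<in>A. \<forall>j\<in>J. a ** j \<in> J \<and> j ** a \<in> J)"

definition maximal_algebra_ideal :: "(complex^'n^'n) set \<Rightarrow> (complex^'n^'n) set \<Rightarrow> bool" where
  "maximal_algebra_ideal A M \<longleftrightarrow> algebra_ideal A M \<and> mat 1 \<notin> M \<and>
     (\<forall>J. algebra_ideal A J \<longrightarrow> M \<subseteq> J \<longrightarrow> J = M \<or> mat 1 \<in> J)"

text \<open>The image of the augmentation ideal of the monoid ring of \<open>R\<close>. If
  \<open>R\<close> contains 1, a corner in which this ideal vanishes is one where all of
  \<open>R\<close> acts as the identity. A linear hull is enough to obtain an ideal, as r (s - t) =
  r s - r t.\<close>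

definition augmentation_ideal :: "(complex^'n^'n) set \<Rightarrow> (complex^'n^'n) set" where
  "augmentation_ideal R = complex_subspace hull {r - s | r s. r \<in> R \<and> s \<in> R}"

text \<open>These idempotents encode the subquotients of the \<open>B\<close>-module \<open>\<complex>\<^sup>n\<close>: the action of \<open>a\<close> on the
  subquotient is \<open>eae\<close>, acting on the range of \<open>e\<close>.\<close>
definition compressible :: "(complex^'n^'n) set \<Rightarrow> complex^'n^'n \<Rightarrow> bool" where
  "compressible B e \<longleftrightarrow> e ** e = e \<and> (\<forall>a\<in>B. \<forall>b\<in>B. e ** a ** e ** b ** e = e ** a ** b ** e)"

text \<open>\<open>R\<close> stands for Ad(G), \<alpha> for the derivative of the automorphism and
  \<alpha>' for its inverse; \<open>conj\<close> abstracts D\<alpha> Ad(g) D\<alpha>^-1 =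
  Ad(\<alpha>(g)). Ideals are taken in the algebra \<open>A\<close> of \<open>R\<close>,
  subquotients over the larger algebra \<open>B\<close>.\<close>

locale twisted_monoid =
  fixes R :: "(complex^'n^'n) set" and \<alpha> \<alpha>' :: "complex^'n^'n"
  assumes one: "mat 1 \<in> R" and mult: "r \<in> R \<Longrightarrow> s \<in> R \<Longrightarrow> r ** s \<in> R"
    and inverse: "\<alpha> ** \<alpha>' = mat 1" "\<alpha>' ** \<alpha> = mat 1"
    and conj: "r \<in> R \<Longrightarrow> \<alpha> ** r ** \<alpha>' \<in> R" "r \<in> R \<Longrightarrow> \<alpha>' ** r ** \<alpha> \<in> R"
begin

definition "A = matrix_algebra hull R"
definition "B = matrix_algebra hull (insert \<alpha> R)"
abbreviation "I \<equiv> augmentation_ideal R"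

lemma A: "matrix_algebra A" and B: "matrix_algebra B"
  by (simp_all add: A_def B_def matrix_algebra_hull)

lemmas AD = matrix_algebraD[OF A] and BD = matrix_algebraD[OF B]

lemma A_B: "a \<in> A \<Longrightarrow> a \<in> B"
  unfolding A_def B_def using hull_mono[of R "insert \<alpha> R" matrix_algebra] by blast

lemma R_A: "r \<in> R \<Longrightarrow> r \<in> A"
  unfolding A_def by (rule hull_inc)

lemma alpha_B: "\<alpha> \<in> B"
  unfolding B_def by (rule hull_inc) simp

text \<open>\<open>B\<close> is generated by \<open>R\<close> and \<alpha> alone; the inverse
  belongs to it because \<open>B\<close> is finite-dimensional.\<close>

lemma alpha'_B: "\<alpha>' \<in> B"
proof -
  have "v = 0" if "\<alpha> *v v = 0" for v
    using arg_cong[OF that, of "(*v) \<alpha>'"] by (simp add: matrix_vector_mul_assoc inverse)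
  then obtain b where "b \<in> B" "\<alpha> ** b = mat 1" using matrix_algebra_inverse[OF B alpha_B] by metis
  then show ?thesis by (metis inverse(2) matrix_mul_assoc matrix_mul_lid matrix_mul_rid)
qed

lemma conj_hull:
  assumes "\<And>r. r \<in> R \<Longrightarrow> b ** r ** b' \<in> R" "b' ** b = mat 1" "b ** b' = mat 1" "a \<in> A"
  shows "b ** a ** b' \<in> A"
proof -
  let ?Q = "{a. b ** a ** b' \<in> A}"
  have "matrix_algebra ?Q"
    unfolding matrix_algebra_def nonunital_algebra_def complex_subspace_def
  proof (intro conjI ballI allI; clarsimp)
    show "0 \<in> A" using complex_subspaceD[OF AD(1)] by simp
    show "b ** b' \<in> A" using assms(3) AD by simp
    fix x assume x: "b ** x ** b' \<in> A"
    show "b ** (mat c ** x) ** b' \<in> A" for c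
      using complex_subspaceD(3)[OF AD(1) x, of c] by (simp add: matrix_mul_assoc mat_mul_commute)
    fix y assume y: "b ** y ** b' \<in> A"
    show "b ** (x + y) ** b' \<in> A"
      using complex_subspaceD(2)[OF AD(1) x y] by (simp add: matrix_add_ldistrib matrix_add_rdistrib)
    have "(b ** x ** b') ** (b ** y ** b') = b ** x ** (b' ** b) ** y ** b'" by (simp add: matrix_mul_assoc)
    then show "b ** (x ** y) ** b' \<in> A"
      using AD(5)[OF x y] assms(2) by (simp add: matrix_mul_assoc)
  qed
  moreover have "R \<subseteq> ?Q" using assms(1) R_A by blast
  ultimately have "A \<subseteq> ?Q" unfolding A_def by (intro hull_minimal)
  then show ?thesis using assms(4) by blast
qed

lemma conj_A: "a \<in> A \<Longrightarrow> \<alpha> ** a ** \<alpha>' \<in> A" "a \<in> A \<Longrightarrow> \<alpha>' ** a ** \<alpha> \<in> A"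
  using conj_hull[of \<alpha> \<alpha>'] conj_hull[of \<alpha>' \<alpha>] conj inverse by auto

lemma I_subspace: "complex_subspace I"
  by (simp add: augmentation_ideal_def complex_subspace_hull)

lemma diff_I: "r \<in> R \<Longrightarrow> s \<in> R \<Longrightarrow> r - s \<in> I"
  unfolding augmentation_ideal_def by (rule hull_inc) blast

lemma I_induct:
  assumes "x \<in> I" "\<And>r s. r \<in> R \<Longrightarrow> s \<in> R \<Longrightarrow> r - s \<in> Q" "complex_subspace Q"
  shows "x \<in> Q"
  using assms hull_minimal[of "{r - s | r s. r \<in> R \<and> s \<in> R}" Q complex_subspace]
  unfolding augmentation_ideal_def by blast

lemma I_mult: assumes "r \<in> R" "x \<in> I" shows "r ** x \<in> I" "x ** r \<in> I"
proof -
  have "x \<in> {x. r ** x \<in> I \<and> x ** r \<in> I}"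
  proof (rule I_induct[OF assms(2)])
    show "s - t \<in> {x. r ** x \<in> I \<and> x ** r \<in> I}" if "s \<in> R" "t \<in> R" for s t
      using that assms(1) by (simp add: matrix_diff_ldistrib matrix_diff_rdistrib diff_I mult)
    show "complex_subspace {x. r ** x \<in> I \<and> x ** r \<in> I}"
    proof (intro complex_subspaceI)
      fix c a assume "a \<in> {x. r ** x \<in> I \<and> x ** r \<in> I}"
      then have "mat c ** (r ** a) \<in> I" "mat c ** (a ** r) \<in> I"
        using complex_subspaceD(3)[OF I_subspace] by auto
      then show "mat c ** a \<in> {x. r ** x \<in> I \<and> x ** r \<in> I}"
        by (metis (lifting) mem_Collect_eq mult_mat_left matrix_mul_assoc)
    qed (use complex_subspaceD(1,2)[OF I_subspace] in \<open>simp_all add: matrix_add_ldistrib matrix_add_rdistrib\<close>)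
  qed
  then show "r ** x \<in> I" "x ** r \<in> I" by auto
qed

lemma ideal_I: "algebra_ideal A I"
proof -
  have "x \<in> A" if "x \<in> I" for x
    using that by (rule I_induct) (simp_all add: AD R_A complex_subspaceD(5))
  moreover have "A \<subseteq> {a. \<forall>x\<in>I. a ** x \<in> I \<and> x ** a \<in> I}" (is "_ \<subseteq> ?Q")
    unfolding A_def
  proof (rule hull_minimal)
    show "R \<subseteq> ?Q" using I_mult by blast
    show "matrix_algebra ?Q"
    proof (intro matrix_algebraI complex_subspaceI)
      show "a \<in> ?Q \<Longrightarrow> b \<in> ?Q \<Longrightarrow> a ** b \<in> ?Q" for a b
        by (simp add: matrix_mul_assoc) (simp flip: matrix_mul_assoc)
    qed (use complex_subspaceD(1-3)[OF I_subspace] in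
        \<open>simp_all add: matrix_add_ldistrib matrix_add_rdistrib mult_mat_left flip: matrix_mul_assoc\<close>)
  qed
  ultimately show ?thesis unfolding algebra_ideal_def using I_subspace by blast
qed

text \<open>The zero corner counts as irreducible, so a corner that is not irreducible has a nonzero
  proper submodule along which to split.\<close>

definition irreducible_corner :: "complex^'n^'n \<Rightarrow> bool" where
  "irreducible_corner e \<longleftrightarrow> (\<forall>U. vec.subspace U \<longrightarrow> U \<subseteq> fixed_space e \<longrightarrow>
     (\<forall>b\<in>B. \<forall>u\<in>U. (e ** b ** e) *v u \<in> U) \<longrightarrow> U = {0} \<or> U = fixed_space e)"

end

section \<open>Subquotients as corners, and simple modules over A\<close>

locale corner = twisted_monoid R \<alpha> \<alpha>' for R :: "(complex^'n^'n) set" and \<alpha> \<alpha>' +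
  fixes e :: "complex^'n^'n"
  assumes good: "compressible B e"
begin

abbreviation "W \<equiv> fixed_space e"

text \<open>The module structure of the subquotient. It is multiplicative on \<open>B\<close>, where
  compressibility applies, and not on arbitrary matrices.\<close>

definition act :: "complex^'n^'n \<Rightarrow> complex^'n \<Rightarrow> complex^'n" where
  "act a w = (e ** a ** e) *v w"

lemma ee: "e ** e = e"
  using good by (simp add: compressible_def)

lemma corner_mult: "a \<in> B \<Longrightarrow> b \<in> B \<Longrightarrow> e ** (a ** b) ** e = (e ** a ** e) ** (e ** b ** e)"
proof -
  assume "a \<in> B" "b \<in> B"
  then have "e ** (a ** b) ** e = e ** a ** e ** b ** e"
    using good by (simp add: compressible_def matrix_mul_assoc)
  also have "\<dots> = (e ** a ** e) ** (e ** b ** e)"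
    by (metis ee matrix_mul_assoc)
  finally show ?thesis .
qed

lemma act_mult: "a \<in> B \<Longrightarrow> b \<in> B \<Longrightarrow> act (a ** b) w = act a (act b w)"
  by (simp add: act_def corner_mult matrix_vector_mul_assoc)

lemma act_in: "act a w \<in> W"
  by (simp add: act_def fixed_space_def matrix_vector_mul_assoc) (simp add: matrix_mul_assoc ee)

lemma act_one: "w \<in> W \<Longrightarrow> act (mat 1) w = w"
  by (simp add: act_def fixed_space_def ee)

lemma act_linear:
  "act a (v + w) = act a v + act a w" "act a (v - w) = act a v - act a w"
  "act a (c *s w) = c *s act a w" "act a 0 = 0"
  "act (a + b) w = act a w + act b w" "act (a - b) w = act a w - act b w" "act 0 w = 0"
  "act (mat c ** a) w = c *s act a w"
proof -
  show "act (mat c ** a) w = c *s act a w"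
    by (simp add: act_def mat_mul_scalar mult_mat_left flip: matrix_mul_assoc)
qed (simp_all add: act_def matrix_vector_right_distrib matrix_vector_mult_diff_distrib vector_scalar_commute
    matrix_add_ldistrib matrix_add_rdistrib matrix_diff_ldistrib matrix_diff_rdistrib
    matrix_vector_mult_diff_rdistrib matrix_vector_mult_add_rdistrib)

lemma subspace_orbit: "complex_subspace N \<Longrightarrow> vec.subspace {act a s | a. a \<in> N}"
  unfolding vec.subspace_def
  by (auto simp: complex_subspace_def) (metis act_linear)+

lemma B_invariant:
  assumes U: "vec.subspace U" and R: "\<And>r u. r \<in> R \<Longrightarrow> u \<in> U \<Longrightarrow> act r u \<in> U"
    and a: "\<And>u. u \<in> U \<Longrightarrow> act \<alpha> u \<in> U" and W: "U \<subseteq> W" and b: "b \<in> B" and u: "u \<in> U"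
  shows "act b u \<in> U"
proof -
  \<comment> \<open>Membership in \<open>B\<close> is carried along because \<open>act_mult\<close>
    holds only there.\<close>
  have "B \<subseteq> {b. b \<in> B \<and> (\<forall>u\<in>U. act b u \<in> U)}" (is "_ \<subseteq> ?Q")
    unfolding B_def
  proof (rule hull_minimal; fold B_def)
    show "insert \<alpha> R \<subseteq> ?Q" using R a alpha_B R_A A_B by blast
    show "matrix_algebra ?Q"
    proof (intro matrix_algebraI complex_subspaceI)
      show "mat 1 \<in> ?Q" using act_one W BD(3) by auto
    qed (use complex_subspaceD(1-3)[OF BD(1)] BD(5) in
        \<open>auto simp: act_linear act_mult vec.subspace_0[OF U] vec.subspace_add[OF U] vec.subspace_scale[OF U]\<close>)
  qed
  then show ?thesis using b u by blast
qed

definition A_module :: "(complex^'n) set \<Rightarrow> bool" where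
  "A_module S \<longleftrightarrow> vec.subspace S \<and> S \<subseteq> W \<and> (\<forall>a\<in>A. \<forall>s\<in>S. act a s \<in> S)"

definition A_simple :: "(complex^'n) set \<Rightarrow> bool" where
  "A_simple S \<longleftrightarrow> A_module S \<and> (\<forall>s\<in>S. s \<noteq> 0 \<longrightarrow> (\<forall>t\<in>S. \<exists>a\<in>A. act a s = t))"

lemma act_A: "a \<in> A \<Longrightarrow> b \<in> A \<Longrightarrow> act (a ** b) w = act a (act b w)"
  by (simp add: act_mult A_B)

text \<open>A two-sided ideal acting nontrivially on a simple module is already transitive: move
  \<open>s\<close> to \<open>z\<close> by an element of \<open>A\<close>, apply \<open>j0\<close>,
  and move the nonzero result to \<open>t\<close>. The product stays in \<open>J\<close>, so
  Burnside's theorem applies to \<open>J\<close>.\<close>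

lemma ideal_density:
  assumes S: "A_simple S" and J: "algebra_ideal A J"
    and nz: "j0 \<in> J" "z \<in> S" "act j0 z \<noteq> 0" and T: "\<And>s. s \<in> S \<Longrightarrow> T *v s \<in> S"
  obtains j where "j \<in> J" "\<And>s. s \<in> S \<Longrightarrow> act j s = T *v s"
proof -
  have J': "complex_subspace J" "J \<subseteq> A" "\<And>a j. a \<in> A \<Longrightarrow> j \<in> J \<Longrightarrow> a ** j \<in> J"
     "\<And>a j. a \<in> A \<Longrightarrow> j \<in> J \<Longrightarrow> j ** a \<in> J" using J by (auto simp: algebra_ideal_def)
  have S': "vec.subspace S" "\<And>a s. a \<in> A \<Longrightarrow> s \<in> S \<Longrightarrow> act a s \<in> S"
    "\<And>s t. s \<in> S \<Longrightarrow> s \<noteq> 0 \<Longrightarrow> t \<in> S \<Longrightarrow> \<exists>a\<in>A. act a s = t"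
    using S unfolding A_simple_def A_module_def by blast+
  let ?N = "(\<lambda>j. e ** j ** e) ` J"
  have cs: "complex_subspace ?N"
    unfolding complex_subspace_def
  proof (intro conjI ballI allI)
    show "0 \<in> ?N" using complex_subspaceD(1)[OF J'(1)] by force
    fix x assume "x \<in> ?N"
    then obtain a where a: "x = e ** a ** e" "a \<in> J" by blast
    show "mat c ** x \<in> ?N" for c
    proof (rule image_eqI)
      show "mat c ** a \<in> J" using complex_subspaceD(3)[OF J'(1) a(2)] .
      show "mat c ** x = e ** (mat c ** a) ** e"
        unfolding a(1) mult_mat_left by (simp only: matrix_mul_assoc)
    qed
    fix y assume "y \<in> ?N"
    then obtain b where b: "y = e ** b ** e" "b \<in> J" by blast
    show "x + y \<in> ?N"
    proof (rule image_eqI)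
      show "a + b \<in> J" using complex_subspaceD(2)[OF J'(1) a(2) b(2)] .
      show "x + y = e ** (a + b) ** e"
        unfolding a(1) b(1) by (simp only: matrix_add_ldistrib matrix_add_rdistrib)
    qed
  qed
  have N: "nonunital_algebra ?N"
    unfolding nonunital_algebra_def
  proof (intro conjI cs ballI)
    fix x y assume "x \<in> ?N" "y \<in> ?N"
    then obtain a b where ab: "x = e ** a ** e" "a \<in> J" "y = e ** b ** e" "b \<in> J" by blast
    have "x ** y = e ** (a ** b) ** e"
      using ab J'(2) A_B corner_mult[of a b] by (simp add: subset_iff)
    then show "x ** y \<in> ?N" using J'(2,3) ab by blast
  qed
  have "\<exists>x\<in>?N. x *v s = t" if s: "s \<in> S" "s \<noteq> 0" and t: "t \<in> S" for s t
  proof -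
    obtain a where a: "a \<in> A" "act a s = z" using S'(3) s nz(2) by blast
    obtain b where b: "b \<in> A" "act b (act j0 z) = t"
      using S'(3)[of "act j0 z" t] S'(2) nz J'(2) t by blast
    have "b ** j0 ** a \<in> J" using J'(3,4) a b nz(1) by blast
    moreover have "act (b ** j0 ** a) s = t"
      using a b nz(1) J'(2) by (simp add: act_A AD(5) subset_iff)
    ultimately show ?thesis unfolding act_def by blast
  qed
  moreover have "x *v s \<in> S" if "x \<in> ?N" "s \<in> S" for x s
    using that S'(2) J'(2) unfolding act_def by blast
  ultimately obtain x where "x \<in> ?N" "\<And>s. s \<in> S \<Longrightarrow> x *v s = T *v s"
    using burnside[OF N S'(1) _ _ T] by (metis (no_types, lifting))
  then show ?thesis using that unfolding act_def by blast
qed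

text \<open>A nonzero submodule of least dimension is simple, since the orbit of any of its nonzero
  vectors is again a nonzero submodule.\<close>

lemma ex_A_simple:
  assumes "e \<noteq> 0"
  obtains S s where "A_simple S" "s \<in> S" "s \<noteq> 0"
proof -
  let ?P = "\<lambda>S. A_module S \<and> (\<exists>s\<in>S. s \<noteq> 0)"
  have "?P W" using fixed_space_nonzero[OF ee assms] act_in by (metis A_module_def subspace_fixed_space order_refl)
  then have "\<exists>S. ?P S \<and> (\<forall>S'. ?P S' \<longrightarrow> vec.dim S \<le> vec.dim S')"
    by (rule ex_has_least_nat[where m = vec.dim])
  then obtain S where S: "?P S" and min: "\<And>S'. ?P S' \<Longrightarrow> vec.dim S \<le> vec.dim S'" by blast
  have S': "vec.subspace S" "S \<subseteq> W" "\<And>a s. a \<in> A \<Longrightarrow> s \<in> S \<Longrightarrow> act a s \<in> S"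
    using S by (auto simp: A_module_def)
  have "\<exists>a\<in>A. act a s = t" if s: "s \<in> S" "s \<noteq> 0" and t: "t \<in> S" for s t
  proof -
    let ?Y = "{act a s | a. a \<in> A}"
    have sub: "?Y \<subseteq> S" using S' s by blast
    have Y: "vec.subspace ?Y" using subspace_orbit AD(1) by blast
    have mod: "A_module ?Y" unfolding A_module_def
      using Y sub S'(2) by (auto simp flip: act_A) (use AD(5) in blast)
    have "act (mat 1) s \<in> ?Y" using AD(3) by blast
    moreover have "act (mat 1) s = s" using act_one s(1) S'(2) by blast
    ultimately have "s \<in> ?Y" by metis
    then have "vec.dim S \<le> vec.dim ?Y" using min mod s(2) by blast
    then have "?Y = S" using vec.subspace_dim_equal[OF Y S'(1) sub] by simp
    then show ?thesis using t by blast
  qed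
  then show ?thesis using that S A_simple_def by blast
qed

text \<open>By density, an ideal strictly above the annihilator contains some k acting on
  \<open>S\<close> as the identity. Then 1 - k annihilates \<open>S\<close>, so the ideal contains
  1.\<close>

lemma annihilator_maximal:
  assumes S: "A_simple S" and s0: "s0 \<in> S" "s0 \<noteq> 0"
  shows "maximal_algebra_ideal A {a \<in> A. \<forall>s\<in>S. act a s = 0}" (is "maximal_algebra_ideal A ?M")
proof -
  have S': "S \<subseteq> W" "\<And>a s. a \<in> A \<Longrightarrow> s \<in> S \<Longrightarrow> act a s \<in> S"
    using S by (auto simp: A_simple_def A_module_def)
  have "algebra_ideal A ?M"
    unfolding algebra_ideal_def
    by (intro conjI complex_subspaceI)
       (use complex_subspaceD(1-3)[OF AD(1)] AD(5) S'(2) in \<open>simp_all add: act_linear act_A subset_iff\<close>)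
  moreover have "mat 1 \<notin> ?M" using s0 act_one S'(1) by force
  moreover have "mat 1 \<in> J" if J: "algebra_ideal A J" and sub: "?M \<subseteq> J" and ne: "J \<noteq> ?M" for J
  proof -
    have J': "complex_subspace J" "J \<subseteq> A" using J by (auto simp: algebra_ideal_def)
    obtain j z where "j \<in> J" "z \<in> S" "act j z \<noteq> 0" using sub ne J'(2) by blast
    from ideal_density[OF S J this, of "mat 1"] obtain k where k: "k \<in> J" "\<And>s. s \<in> S \<Longrightarrow> act k s = s"
      by auto
    have "mat 1 - k \<in> ?M"
      using k J'(2) AD(3) complex_subspaceD(5)[OF AD(1)] act_one S'(1) by (auto simp: act_linear)
    then show ?thesis using complex_subspaceD(2)[OF J'(1) _ k(1), of "mat 1 - k"] sub by auto
  qed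
  ultimately show ?thesis unfolding maximal_algebra_ideal_def by blast
qed

end

context corner
begin

text \<open>If the annihilator \<open>M\<close> of a simple \<open>A\<close>-submodule is stable under conjugation by \<open>\<alpha>\<close>, it kills
  the whole irreducible corner, on which \<open>A\<close> then acts through a full matrix algebra. For a
  rank one idempotent \<open>t\<close> of it, an eigenvector of \<open>tc\<alpha>\<close> on the image of \<open>t\<close> (with \<open>c\<close> in \<open>A\<close>
  suitably chosen) generates an \<open>\<alpha>\<close>-stable simple \<open>A\<close>-module, so \<open>A\<close> itself acts irreducibly.\<close>
lemma corner_A_simple:
  assumes irr: "irreducible_corner e" and ne: "e \<noteq> 0"
    and fix_max: "\<And>M m. maximal_algebra_ideal A M \<Longrightarrow> m \<in> M \<Longrightarrow> \<alpha>' ** m ** \<alpha> \<in> M"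
  shows "A_simple W"
proof -
  obtain S s0 where S: "A_simple S" and s0: "s0 \<in> S" "s0 \<noteq> 0" using ex_A_simple[OF ne] .
  have S': "S \<subseteq> W" "\<And>a s. a \<in> A \<Longrightarrow> s \<in> S \<Longrightarrow> act a s \<in> S"
    "\<And>s t. s \<in> S \<Longrightarrow> s \<noteq> 0 \<Longrightarrow> t \<in> S \<Longrightarrow> \<exists>a\<in>A. act a s = t" "vec.subspace S"
    using S unfolding A_simple_def A_module_def by blast+
  define M where "M = {a \<in> A. \<forall>s\<in>S. act a s = 0}"
  have M: "maximal_algebra_ideal A M"
    unfolding M_def by (rule annihilator_maximal[OF S s0])
  have idM: "algebra_ideal A M" using M by (simp add: maximal_algebra_ideal_def)
  have MA: "M \<subseteq> A" by (auto simp: M_def)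
  have irr': "U = W" if "vec.subspace U" "U \<subseteq> W" "u \<in> U" "u \<noteq> 0"
    "\<And>a u. a \<in> A \<Longrightarrow> u \<in> U \<Longrightarrow> act a u \<in> U" "\<And>u. u \<in> U \<Longrightarrow> act \<alpha> u \<in> U" for U u
  proof -
    have "\<forall>b\<in>B. \<forall>u\<in>U. act b u \<in> U"
      using B_invariant[OF that(1) _ that(6) that(2)] that(5) R_A by blast
    then show ?thesis using irr that(1-4) unfolding irreducible_corner_def act_def by blast
  qed
  \<comment> \<open>The vectors killed by M are stable under \<open>A\<close> because M is an ideal,
    and under \<alpha> because m \<alpha> = \<alpha> (\<alpha>' m \<alpha>) with the bracket again
    in M. They include S, so irreducibility makes them all of W.\<close>
  have "{w \<in> W. \<forall>m\<in>M. act m w = 0} = W" (is "?Y = W")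
  proof (rule irr')
    show "vec.subspace ?Y"
      unfolding vec.subspace_def using vec.subspace_0[OF subspace_fixed_space]
        vec.subspace_add[OF subspace_fixed_space] vec.subspace_scale[OF subspace_fixed_space]
      by (auto simp: act_linear)
    show "s0 \<in> ?Y" using s0 S'(1) by (auto simp: M_def)
    show "act a u \<in> ?Y" if "a \<in> A" "u \<in> ?Y" for a u
      using that idM MA act_in by (auto simp: algebra_ideal_def subset_iff simp flip: act_A)
    show "act \<alpha> u \<in> ?Y" if u: "u \<in> ?Y" for u
    proof -
      have "act m (act \<alpha> u) = 0" if m: "m \<in> M" for m
      proof -
        have mB: "m \<in> B" "\<alpha>' ** m ** \<alpha> \<in> B" using m fix_max[OF M m] MA A_B by auto
        have "act m (act \<alpha> u) = act (\<alpha> ** (\<alpha>' ** m ** \<alpha>)) u"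
          using mB(1) alpha_B by (simp add: matrix_mul_assoc inverse act_mult)
        also have "\<dots> = act \<alpha> (act (\<alpha>' ** m ** \<alpha>) u)"
          using mB alpha_B by (rule_tac act_mult)
        finally show ?thesis using u fix_max[OF M m] by (simp add: act_linear)
      qed
      then show ?thesis using act_in by simp
    qed
  qed (use s0 in auto)
  then have killM: "act m w = 0" if "m \<in> M" "w \<in> W" for m w using that by blast
  \<comment> \<open>An identity between elements of \<open>A\<close> that is checked on S thus holds
    on all of W. The relations for \<open>t\<close> below are transferred in this way.\<close>
  have killX: "act a w = act b w" if "a \<in> A" "b \<in> A" "\<And>s. s \<in> S \<Longrightarrow> act a s = act b s" "w \<in> W" for a b w
    using killM[of "a - b" w] that complex_subspaceD(5)[OF AD(1)] by (simp add: M_def act_linear)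
  obtain i where i: "s0 $ i \<noteq> 0" using s0(2) by (auto simp: vec_eq_iff)
  define P where "P = (\<chi> j k. if k = i then s0 $ j / s0 $ i else 0)"
  have Pw: "P *v w = (w $ i / s0 $ i) *s s0" for w
    by (simp add: P_def vec_eq_iff matrix_vector_mult_def if_distrib if_distribR cong: if_cong)
  have idA: "algebra_ideal A A" using AD by (simp add: algebra_ideal_def)
  have one_s0: "act (mat 1) s0 \<noteq> 0" using act_one s0 S'(1) by (metis subsetD)
  obtain t where t: "t \<in> A" "\<And>s. s \<in> S \<Longrightarrow> act t s = P *v s"
  proof (rule ideal_density[OF S idA AD(3) s0(1) one_s0, of P])
    show "P *v s \<in> S" for s unfolding Pw using vec.subspace_scale[OF S'(4) s0(1)] .
  qed blast
  define \<psi> where "\<psi> s = s $ i / s0 $ i" for s :: "complex^'n"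
  have ts: "act t s = \<psi> s *s s0" if "s \<in> S" for s using t(2)[OF that] by (simp add: Pw \<psi>_def)
  have ts0: "act t s0 = s0" using ts[OF s0(1)] i by (simp add: \<psi>_def)
  have tt: "act t (act t w) = act t w" if "w \<in> W" for w
  proof -
    have "act (t ** t) w = act t w"
      by (rule killX) (use that t(1) AD(5) in \<open>auto simp: act_A ts ts0 act_linear\<close>)
    then show ?thesis by (simp add: act_A t(1))
  qed
  define t' where "t' = \<alpha> ** t ** \<alpha>'"
  have t'A: "t' \<in> A" unfolding t'_def by (rule conj_A(1)[OF t(1)])
  note inB = A_B[OF t(1)] A_B[OF t'A] alpha_B alpha'_B
  have conj_act: "act (\<alpha> ** b ** \<alpha>') w = act \<alpha> (act b (act \<alpha>' w))" if "b \<in> A" for b w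
    using that by (simp add: act_mult BD(5) inB A_B)
  have inv_act: "act \<alpha> (act \<alpha>' w) = w" "act \<alpha>' (act \<alpha> w) = w" if "w \<in> W" for w
    using that by (simp_all add: inverse act_one inB flip: act_mult)
  have t't': "act t' (act t' w) = act t' w" if "w \<in> W" for w
    by (simp add: t'_def conj_act t(1) inv_act act_in tt)
  have t'\<alpha>: "act t' (act \<alpha> w) = act \<alpha> (act t w)" if "w \<in> W" for w
    by (simp add: t'_def conj_act t(1) inv_act that)
  have "\<exists>s\<in>S. act t' s \<noteq> 0"
  proof (rule ccontr)
    assume "\<not> ?thesis"
    then have zero: "act t' s = act 0 s" if "s \<in> S" for s using that by (simp add: act_linear)
    have s0W: "s0 \<in> W" using s0 S'(1) by blast
    have "act t' (act \<alpha> s0) = act 0 (act \<alpha> s0)"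
      by (rule killX[OF t'A complex_subspaceD(1)[OF AD(1)] zero act_in])
    then have "act \<alpha> s0 = 0" using t'\<alpha>[OF s0W] ts0 by (simp add: act_linear)
    then show False using inv_act(2)[OF s0W] s0 by (simp add: act_linear)
  qed
  then obtain s1 where s1: "s1 \<in> S" "act t' s1 \<noteq> 0" by blast
  have t's1: "act t' s1 \<in> S" using S'(2) t'A s1 by blast
  obtain c where c: "c \<in> A" "act c (act t' s1) = s0" using S'(3) t's1 s1 s0 by blast
  obtain d where d: "d \<in> A" "act d s0 = act t' s1" using S'(3) t's1 s0 by blast
  \<comment> \<open>On S the element t b' t acts as \<psi>(b' s0) t, because t has rank one there.
    This transfers to W and is then conjugated by \<alpha>.\<close>
  have scal: "\<exists>\<kappa>. \<forall>w\<in>W. act t' (act b (act t' w)) = \<kappa> *s act t' w" if b: "b \<in> A" for b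
  proof -
    define b' where "b' = \<alpha>' ** b ** \<alpha>"
    have b': "b' \<in> A" unfolding b'_def by (rule conj_A(2)[OF b])
    have "act (t ** b' ** t) w = act (mat (\<psi> (act b' s0)) ** t) w" if "w \<in> W" for w
    proof (rule killX[OF _ _ _ that])
      fix s assume s: "s \<in> S"
      show "act (t ** b' ** t) s = act (mat (\<psi> (act b' s0)) ** t) s"
        using s0 S'(2) b' by (simp add: act_A AD(5) t(1) b' ts[OF s] act_linear ts mult.commute)
    qed (use t(1) b' AD(5) complex_subspaceD(3)[OF AD(1)] in auto)
    then have tbt: "act t (act b' (act t w)) = \<psi> (act b' s0) *s act t w" if "w \<in> W" for w
      using that by (simp add: act_A AD(5) t(1) b' act_linear)
    have bb: "act b (act \<alpha> w) = act \<alpha> (act b' w)" for w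
    proof -
      have "b ** \<alpha> = \<alpha> ** b'" by (simp add: b'_def matrix_mul_assoc inverse)
      then show ?thesis by (metis act_mult A_B b b' alpha_B)
    qed
    have "act t' (act b (act t' w)) = \<psi> (act b' s0) *s act t' w" if "w \<in> W" for w
      by (simp add: t'_def conj_act t(1) bb inv_act act_in tbt act_linear)
    then show ?thesis by blast
  qed
  \<comment> \<open>\<open>c\<close> carries t' s1 to s0, which t fixes, and \<open>d\<close>
    carries it back. So the scalar that \<open>scal\<close> gives for d t c is 1, as its value at s1
    shows.\<close>
  have t'b: "act t' (act d (act t (act c (act t' w)))) = act t' w" if w: "w \<in> W" for w
  proof -
    obtain \<kappa> where \<kappa>: "\<And>w. w \<in> W \<Longrightarrow> act t' (act (d ** t ** c) (act t' w)) = \<kappa> *s act t' w"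
      using scal[of "d ** t ** c"] AD(5) d c t by blast
    have eq: "act (d ** t ** c) v = act d (act t (act c v))" for v
      using d c t by (simp add: act_A AD(5))
    have "act t' s1 = \<kappa> *s act t' s1"
      using \<kappa>[of s1] s1 S'(1) by (auto simp: eq c(2) ts0 d(2) t't')
    then have "\<kappa> = 1" using s1(2) vec.scale_cancel_right[of 1 "act t' s1" \<kappa>] by simp
    then show ?thesis using \<kappa>[OF w] by (simp add: eq)
  qed
  define X where "X = {w \<in> W. act t w = w}"
  obtain l x where x: "x \<in> X" "x \<noteq> 0" "act t (act c (act \<alpha> x)) = l *s x"
  proof (rule eigenvector_exists[of X "e ** (t ** c ** \<alpha>) ** e" s0])
    show "vec.subspace X"
      unfolding X_def vec.subspace_def using vec.subspace_0[OF subspace_fixed_space]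
        vec.subspace_add[OF subspace_fixed_space] vec.subspace_scale[OF subspace_fixed_space]
      by (auto simp: act_linear)
    show "s0 \<in> X" using s0 S'(1) ts0 by (auto simp: X_def)
    have eq: "(e ** (t ** c ** \<alpha>) ** e) *v u = act t (act c (act \<alpha> u))" for u
      using inB c by (simp add: act_mult BD(5) A_B flip: act_def)
    show "(e ** (t ** c ** \<alpha>) ** e) *v u \<in> X" if "u \<in> X" for u
      unfolding eq X_def using act_in tt by simp
    fix \<mu> v assume "v \<in> X" "v \<noteq> 0" "(e ** (t ** c ** \<alpha>) ** e) *v v = \<mu> *s v"
    then show thesis using that unfolding eq by blast
  qed (use s0 in auto)
  have xW: "x \<in> W" and tx: "act t x = x" using x(1) by (auto simp: X_def)
  define Y where "Y = {act a x | a. a \<in> A}"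
  \<comment> \<open>As x = t x, the vector \<alpha> x is fixed by t'. Inserting t' d t c t' = t' and
    the eigenvector equation turns it into l t' d x. Hence \<alpha> x lies in A x, which makes A x
    stable under \<alpha>.\<close>
  have \<alpha>x: "act \<alpha> x = l *s act (t' ** d) x"
  proof -
    have "act \<alpha> x = act t' (act \<alpha> x)" using t'\<alpha>[OF xW] tx by simp
    also have "\<dots> = act t' (act d (act t (act c (act t' (act \<alpha> x)))))"
      using t'b[OF act_in] by simp
    also have "act t' (act \<alpha> x) = act \<alpha> x" using t'\<alpha>[OF xW] tx by simp
    finally show ?thesis by (simp add: x(3) act_linear act_A t'A d)
  qed
  have "Y = W"
  proof (rule irr'[of _ x])
    show "vec.subspace Y" unfolding Y_def using subspace_orbit AD(1) by blast
    show "Y \<subseteq> W" unfolding Y_def using act_in by blast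
    show "x \<in> Y" unfolding Y_def using act_one[OF xW] AD(3) by (metis (mono_tags, lifting) mem_Collect_eq)
    show "act a u \<in> Y" if "a \<in> A" "u \<in> Y" for a u
      using that AD(5) by (auto simp: Y_def simp flip: act_A)
    show "act \<alpha> u \<in> Y" if u: "u \<in> Y" for u
    proof -
      obtain a where a: "a \<in> A" "u = act a x" using u unfolding Y_def by blast
      have "act \<alpha> u = act (\<alpha> ** a ** \<alpha>') (act \<alpha> x)"
        by (simp add: conj_act a inv_act xW)
      also have "\<dots> = act (mat l ** (\<alpha> ** a ** \<alpha>' ** (t' ** d))) x"
        using AD(5)[OF t'A d(1)] conj_A(1)[OF a(1)] by (simp add: \<alpha>x act_linear act_A)
      also have "\<dots> \<in> Y" unfolding Y_def
        using AD(5)[OF t'A d(1)] conj_A(1)[OF a(1)] AD(5) complex_subspaceD(3)[OF AD(1)] by blast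
      finally show ?thesis .
    qed
  qed (rule x(2))
  \<comment> \<open>Every vector is some a x, and x = t x, so a acts on x as a t does. If b moves a
    s0 back to s0, then b a t = t on S, hence on W, and b takes a x back to x.\<close>
  have "\<exists>a\<in>A. act a w = y" if w: "w \<in> W" "w \<noteq> 0" and y: "y \<in> W" for w y
  proof -
    obtain a where a: "a \<in> A" "w = act a x" using w(1) \<open>Y = W\<close> unfolding Y_def by blast
    obtain a' where a': "a' \<in> A" "y = act a' x" using y \<open>Y = W\<close> unfolding Y_def by blast
    have ats: "act a (act t s) = \<psi> s *s act a s0" if "s \<in> S" for s
      by (simp add: ts[OF that] act_linear)
    have "act a s0 \<noteq> 0"
    proof
      assume z: "act a s0 = 0"
      have "act (a ** t) x = act 0 x"
      proof (rule killX[OF AD(5)[OF a(1) t(1)] complex_subspaceD(1)[OF AD(1)] _ xW])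
        show "act (a ** t) s = act 0 s" if "s \<in> S" for s
          using ats[OF that] by (simp add: act_A[OF a(1) t(1)] act_linear z)
      qed
      then show False using a w(2) tx t(1) by (simp add: act_A act_linear)
    qed
    then obtain b where b: "b \<in> A" "act b (act a s0) = s0" using S'(2,3) s0(1) a(1) by blast
    have "act (b ** a ** t) x = act t x"
    proof (rule killX[OF AD(5)[OF AD(5)[OF b(1) a(1)] t(1)] t(1) _ xW])
      show "act (b ** a ** t) s = act t s" if "s \<in> S" for s
        using ats[OF that] ts[OF that]
        by (simp add: act_A[OF AD(5)[OF b(1) a(1)] t(1)] act_A[OF b(1) a(1)] act_linear b(2))
    qed
    then have "act b w = x" using a b t(1) tx AD(5) by (simp add: act_A)
    then have "act (a' ** b) w = y" using a' b by (simp add: act_A)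
    then show ?thesis using AD(5)[OF a'(1) b(1)] by blast
  qed
  then show ?thesis
    unfolding A_simple_def A_module_def using act_in by auto
qed

lemma trace_functional_I:
  assumes tr: "\<And>r s. r \<in> R \<Longrightarrow> s \<in> R \<Longrightarrow> trace (e ** r ** \<alpha> ** e) = trace (e ** s ** \<alpha> ** e)"
    and x: "x \<in> I"
  shows "trace (e ** x ** \<alpha> ** e) = 0"
proof -
  have "x \<in> {x. trace (e ** x ** \<alpha> ** e) = 0}"
  proof (rule I_induct[OF x])
    show "complex_subspace {x. trace (e ** x ** \<alpha> ** e) = 0}"
    proof (intro complex_subspaceI; clarsimp)
      show "trace (0 :: complex^'n^'n) = 0" by (simp add: trace_def)
      show "trace (e ** a ** \<alpha> ** e) = 0 \<Longrightarrow> trace (e ** (mat c ** a) ** \<alpha> ** e) = 0" for c a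
        unfolding mult_mat_left by (simp add: trace_mat_mul flip: matrix_mul_assoc)
    qed (simp add: matrix_add_ldistrib matrix_add_rdistrib trace_add)
    show "r - s \<in> {x. trace (e ** x ** \<alpha> ** e) = 0}" if "r \<in> R" "s \<in> R" for r s
      using tr[OF that] by (simp add: matrix_diff_ldistrib matrix_diff_rdistrib trace_sub)
  qed
  then show ?thesis by simp
qed

lemma irreducible_corner_I:
  assumes irr: "irreducible_corner e"
    and fix_max: "\<And>M m. maximal_algebra_ideal A M \<Longrightarrow> m \<in> M \<Longrightarrow> \<alpha>' ** m ** \<alpha> \<in> M"
    and tr: "\<And>r s. r \<in> R \<Longrightarrow> s \<in> R \<Longrightarrow> trace (e ** r ** \<alpha> ** e) = trace (e ** s ** \<alpha> ** e)"
    and x: "x \<in> I"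
  shows "e ** x ** e = 0"
proof (rule ccontr)
  assume nz: "e ** x ** e \<noteq> 0"
  then have ne: "e \<noteq> 0" by auto
  obtain v where "(e ** x ** e) *v v \<noteq> 0" using nz matrix_eq[of "e ** x ** e" 0] by auto
  moreover have "(e ** x ** e) *v v = act x (e *v v)"
    by (simp add: act_def matrix_vector_mul_assoc) (simp add: ee flip: matrix_mul_assoc)
  moreover have "e *v v \<in> W" by (simp add: fixed_space_def matrix_vector_mul_assoc ee)
  ultimately obtain z where z: "z \<in> W" "act x z \<noteq> 0" by metis
  have S: "A_simple W" by (rule corner_A_simple[OF irr ne fix_max])
  \<comment> \<open>The target is \<alpha>^-1 because b \<alpha> then acts on W as the identity: a
    trace that vanishes for b in I becomes the trace of \<open>e\<close>.\<close>
  obtain b where b: "b \<in> I" "\<And>w. w \<in> W \<Longrightarrow> act b w = (e ** \<alpha>' ** e) *v w"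
    using ideal_density[OF S ideal_I x z, of "e ** \<alpha>' ** e"] act_in[unfolded act_def] by metis
  have bB: "b \<in> B" using b(1) ideal_I A_B by (auto simp: algebra_ideal_def)
  have "(e ** b ** e) *v v = (e ** \<alpha>' ** e) *v v" for v
  proof -
    have "e *v v \<in> W" by (simp add: fixed_space_def matrix_vector_mul_assoc ee)
    from b(2)[OF this] show ?thesis
      by (simp add: act_def matrix_vector_mul_assoc) (simp add: ee flip: matrix_mul_assoc)
  qed
  then have eq: "e ** b ** e = e ** \<alpha>' ** e" by (simp add: matrix_eq)
  have "e ** (b ** \<alpha>) ** e = (e ** \<alpha>' ** e) ** (e ** \<alpha> ** e)"
    using corner_mult[OF bB alpha_B] eq by simp
  also have "\<dots> = e"
    using corner_mult[OF alpha'_B alpha_B] by (simp add: inverse ee)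
  finally have "trace e = 0" using trace_functional_I[OF tr b(1)] by (simp add: matrix_mul_assoc)
  then show False using trace_idempotent_nonzero[OF ee ne] by simp
qed

end

text \<open>A linear retraction onto \<open>U\<close>, precomposed with \<open>e\<close>, also kills
  the kernel of \<open>e\<close>. This makes both \<open>p\<close> and \<open>e - p\<close>
  idempotents inside the corner.\<close>

lemma projection_exists:
  fixes U :: "(complex^'n) set"
  assumes U: "vec.subspace U" "U \<subseteq> fixed_space e" and e: "e ** e = e"
  obtains p where "p ** p = p" "p ** e = p" "e ** p = p" "fixed_space p = U" "\<And>w. p *v w \<in> U"
proof -
  have "Vector_Spaces.linear (*s) (*s) (\<lambda>x :: complex^'n. x)"
    by (rule vec.linear_ident)
  then obtain g where g: "g ` UNIV \<subseteq> U" "Vector_Spaces.linear (*s) (*s) g" "\<And>v. v \<in> U \<Longrightarrow> g v = v"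
    using vec.linear_exists_left_inverse_on[of "\<lambda>x. x" U] U(1) by (auto simp: inj_on_def)
  define p where "p = matrix g ** e"
  have pw: "p *v w = g (e *v w)" for w
    by (simp add: p_def matrix_works[OF g(2)] flip: matrix_vector_mul_assoc)
  have pU: "p *v w \<in> U" for w unfolding pw using g(1) by blast
  have eU: "e *v u = u" if "u \<in> U" for u using that U(2) by (auto simp: fixed_space_def)
  have "p ** p = p" "e ** p = p"
    using pU by (simp_all add: matrix_eq pw eU g(3) flip: matrix_vector_mul_assoc)
  moreover have "p ** e = p" by (simp add: p_def e flip: matrix_mul_assoc)
  moreover have "fixed_space p = U"
    using pU by (auto simp: fixed_space_def pw eU g(3)) (metis pw)
  ultimately show ?thesis using that pU by blast
qed

primrec mat_prod :: "(complex^'n^'n) list \<Rightarrow> complex^'n^'n" where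
  "mat_prod [] = mat 1"
| "mat_prod (x # xs) = x ** mat_prod xs"

lemma mat_prod_append: "mat_prod (xs @ ys) = mat_prod xs ** mat_prod ys"
  by (induction xs) (simp_all add: matrix_mul_assoc)

context twisted_monoid
begin

lemma mat_prod_B: "set xs \<subseteq> I \<Longrightarrow> mat_prod xs \<in> B"
  by (induction xs) (use BD ideal_I A_B in \<open>auto simp: algebra_ideal_def\<close>)

text \<open>\<open>p\<close> carries a submodule and q = e - p the quotient by it; \<open>B\<close>
  is block triangular, q b p = 0. If x has zero p-block and y has zero q-block, then e x e = (p + q)
  x q and e y e = p y (p + q), and q p = 0 kills the product.\<close>

lemma reducible_corner_split:
  assumes good: "compressible B e" and red: "\<not> irreducible_corner e"
  obtains p q where "compressible B p" "compressible B q"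
    "vec.dim (fixed_space p) < vec.dim (fixed_space e)" "vec.dim (fixed_space q) < vec.dim (fixed_space e)"
    "\<And>x y. x \<in> B \<Longrightarrow> y \<in> B \<Longrightarrow> p ** x ** p = 0 \<Longrightarrow> q ** y ** q = 0 \<Longrightarrow> e ** (x ** y) ** e = 0"
proof -
  interpret corner R \<alpha> \<alpha>' e by unfold_locales (rule good)
  obtain U where U: "vec.subspace U" "U \<subseteq> W" "\<And>b u. b \<in> B \<Longrightarrow> u \<in> U \<Longrightarrow> (e ** b ** e) *v u \<in> U"
    "U \<noteq> {0}" "U \<noteq> W"
    using red unfolding irreducible_corner_def by blast
  obtain p where p: "p ** p = p" "p ** e = p" "e ** p = p" "fixed_space p = U" "\<And>w. p *v w \<in> U"
    using projection_exists[OF U(1,2) ee] by blast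
  define q where "q = e - p"
  have q: "q ** q = q" "q ** e = q" "e ** q = q" "q ** p = 0" "p ** q = 0" "e = p + q"
    by (simp_all add: q_def matrix_diff_ldistrib matrix_diff_rdistrib p ee)
  have pxp: "p ** b ** p = e ** b ** p" if "b \<in> B" for b
  proof -
    have "p *v ((e ** b ** e) *v (p *v w)) = (e ** b ** e) *v (p *v w)" for w
      using U(3)[OF that p(5)] p(4) by (auto simp: fixed_space_def)
    then have "p ** (e ** b ** e) ** p = (e ** b ** e) ** p"
      by (simp add: matrix_eq flip: matrix_vector_mul_assoc)
    then show ?thesis by (simp add: matrix_mul_assoc p) (simp add: p flip: matrix_mul_assoc)
  qed
  have qxp: "q ** b ** p = 0" if "b \<in> B" for b
    by (simp add: q_def matrix_diff_rdistrib pxp[OF that])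
  have ab: "e ** a ** e ** b ** e = e ** a ** b ** e" if "a \<in> B" "b \<in> B" for a b
    using good that by (simp add: compressible_def)
  have "p ** a ** p ** b ** p = p ** a ** b ** p" if "a \<in> B" "b \<in> B" for a b
  proof -
    have "p ** a ** p ** b ** p = p ** a ** (p ** b ** p)" by (simp add: matrix_mul_assoc)
    also have "\<dots> = (p ** e) ** a ** e ** b ** (e ** p)" 
      unfolding pxp[OF that(2)] p(2,3) by (simp add: matrix_mul_assoc)
    also have "\<dots> = p ** (e ** a ** e ** b ** e) ** p" by (simp add: matrix_mul_assoc)
    also have "\<dots> = (p ** e) ** a ** b ** (e ** p)" unfolding ab[OF that] by (simp add: matrix_mul_assoc)
    finally show ?thesis by (simp add: p)
  qed
  then have goodp: "compressible B p" by (simp add: compressible_def p)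
  have "q ** a ** q ** b ** q = q ** a ** b ** q" if "a \<in> B" "b \<in> B" for a b
  proof -
    \<comment> \<open>The inner q is written as e - p; the term containing q a p drops out.\<close>
    have "q ** a ** q ** b ** q = q ** a ** e ** b ** q - (q ** a ** p) ** b ** q"
      by (subst (2) q_def) (simp add: matrix_diff_ldistrib matrix_diff_rdistrib)
    also have "\<dots> = (q ** e) ** a ** e ** b ** (e ** q)" using that by (simp add: qxp q(1-5))
    also have "\<dots> = q ** (e ** a ** e ** b ** e) ** q" by (simp add: matrix_mul_assoc)
    also have "\<dots> = (q ** e) ** a ** b ** (e ** q)" unfolding ab[OF that] by (simp add: matrix_mul_assoc)
    finally show ?thesis by (simp add: q(1-5))
  qed
  then have goodq: "compressible B q" by (simp add: compressible_def q(1))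
  have "fixed_space p \<subset> W" using p(4) U by blast
  then have dp: "vec.dim (fixed_space p) < vec.dim W" by (rule dim_fixed_space_psubset)
  obtain u where u: "u \<in> U" "u \<noteq> 0" using U(1,4) vec.subspace_0 by blast
  have "q *v u = 0" using u p(4) U(2) by (auto simp: q_def matrix_vector_mult_diff_rdistrib fixed_space_def)
  then have "u \<notin> fixed_space q" using u by (simp add: fixed_space_def)
  moreover have "fixed_space q \<subseteq> W"
    using q(3) by (auto simp: fixed_space_def) (metis matrix_vector_mul_assoc)
  ultimately have dq: "vec.dim (fixed_space q) < vec.dim W"
    using u U(2) by (intro dim_fixed_space_psubset) blast
  have "e ** (x ** y) ** e = 0" if xy: "x \<in> B" "y \<in> B" "p ** x ** p = 0" "q ** y ** q = 0" for x y
  proof -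
    have x: "e ** x ** e = (p + q) ** x ** q"
    proof -
      have "e ** x ** e = (p ** x ** p + q ** x ** p) + (p + q) ** x ** q"
        unfolding q(6) by (simp only: matrix_add_ldistrib matrix_add_rdistrib add_ac)
      then show ?thesis by (simp add: xy qxp)
    qed
    have y: "e ** y ** e = p ** y ** (p + q)"
    proof -
      have "e ** y ** e = (q ** y ** p + q ** y ** q) + p ** y ** (p + q)"
        unfolding q(6) by (simp only: matrix_add_ldistrib matrix_add_rdistrib add_ac)
      then show ?thesis by (simp add: xy qxp)
    qed
    have "e ** (x ** y) ** e = ((p + q) ** x ** q) ** (p ** y ** (p + q))"
      using corner_mult[OF xy(1,2)] x y by simp
    also have "\<dots> = (p + q) ** x ** (q ** p) ** y ** (p + q)" by (simp add: matrix_mul_assoc)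
    finally show ?thesis by (simp add: q(1-5))
  qed
  then show ?thesis using that goodp goodq dp dq by blast
qed

text \<open>Exponents add along a composition series: an irreducible corner is killed by a single
  factor, a split one by \<open>k + l\<close> factors, the first k for the submodule and the last l
  for the quotient. The corner of \<open>mat 1\<close> is the whole module.\<close>

theorem augmentation_ideal_nilpotent:
  assumes fix_max: "\<And>M m. maximal_algebra_ideal A M \<Longrightarrow> m \<in> M \<Longrightarrow> \<alpha>' ** m ** \<alpha> \<in> M"
    and tr: "\<And>e r s. compressible B e \<Longrightarrow> r \<in> R \<Longrightarrow> s \<in> R \<Longrightarrow>
        trace (e ** r ** \<alpha> ** e) = trace (e ** s ** \<alpha> ** e)"
  obtains k where "\<And>xs. set xs \<subseteq> I \<Longrightarrow> length xs = k \<Longrightarrow> mat_prod xs = 0"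
proof -
  have "\<exists>k. \<forall>xs. set xs \<subseteq> I \<longrightarrow> length xs = k \<longrightarrow> e ** mat_prod xs ** e = 0" if "compressible B e" for e
    using that
  proof (induction "vec.dim (fixed_space e)" arbitrary: e rule: less_induct)
    case less
    show ?case
    proof (cases "irreducible_corner e")
      case True
      interpret corner R \<alpha> \<alpha>' e by unfold_locales (rule less.prems)
      have "e ** x ** e = 0" if "x \<in> I" for x
        by (rule irreducible_corner_I[OF True fix_max tr[OF less.prems] that])
      then show ?thesis by (intro exI[of _ 1]) (auto simp: length_Suc_conv)
    next
      case False
      obtain p q where pq: "compressible B p" "compressible B q"
        "vec.dim (fixed_space p) < vec.dim (fixed_space e)" "vec.dim (fixed_space q) < vec.dim (fixed_space e)"
        "\<And>x y. x \<in> B \<Longrightarrow> y \<in> B \<Longrightarrow> p ** x ** p = 0 \<Longrightarrow> q ** y ** q = 0 \<Longrightarrow> e ** (x ** y) ** e = 0"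
        using reducible_corner_split[OF less.prems False] by blast
      obtain k where k: "\<And>xs. set xs \<subseteq> I \<Longrightarrow> length xs = k \<Longrightarrow> p ** mat_prod xs ** p = 0"
        using less.hyps[OF pq(3,1)] by blast
      obtain l where l: "\<And>xs. set xs \<subseteq> I \<Longrightarrow> length xs = l \<Longrightarrow> q ** mat_prod xs ** q = 0"
        using less.hyps[OF pq(4,2)] by blast
      have "e ** mat_prod xs ** e = 0" if xs: "set xs \<subseteq> I" "length xs = k + l" for xs
      proof -
        let ?a = "take k xs" and ?b = "drop k xs"
        have sub: "set ?a \<subseteq> I" "set ?b \<subseteq> I" using xs(1) set_take_subset[of k xs] set_drop_subset[of k xs] by blast+
        have "e ** (mat_prod ?a ** mat_prod ?b) ** e = 0"
          by (rule pq(5)) (use sub mat_prod_B k[OF sub(1)] l[OF sub(2)] xs(2) in auto)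
        then show ?thesis by (simp flip: mat_prod_append)
      qed
      then show ?thesis by blast
    qed
  qed
  from this[of "mat 1"] obtain k where "\<And>xs. set xs \<subseteq> I \<Longrightarrow> length xs = k \<Longrightarrow> mat_prod xs = 0"
    by (auto simp: compressible_def)
  then show ?thesis using that by blast
qed

end

section \<open>Maximal ideals and eigenvalues\<close>

text \<open>The sum of the two ideals is an ideal above both; were it proper, maximality would
  identify both with it.\<close>

lemma maximal_ideals_comaximal:
  assumes A: "matrix_algebra A" and M: "maximal_algebra_ideal A M" and N: "maximal_algebra_ideal A N"
    and ne: "M \<noteq> N"
  obtains y where "y \<in> N" "mat 1 - y \<in> M"
proof -
  note AD = matrix_algebraD[OF A]
  have iM: "complex_subspace M" "M \<subseteq> A" "\<And>a m. a \<in> A \<Longrightarrow> m \<in> M \<Longrightarrow> a ** m \<in> M \<and> m ** a \<in> M"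
    and iN: "complex_subspace N" "N \<subseteq> A" "\<And>a m. a \<in> A \<Longrightarrow> m \<in> N \<Longrightarrow> a ** m \<in> N \<and> m ** a \<in> N"
    using M N by (auto simp: maximal_algebra_ideal_def algebra_ideal_def)
  define J where "J = {m + n | m n. m \<in> M \<and> n \<in> N}"
  have "complex_subspace J"
  proof (rule complex_subspaceI)
    show "0 \<in> J" using complex_subspaceD(1)[OF iM(1)] complex_subspaceD(1)[OF iN(1)] unfolding J_def
      by (metis (mono_tags, lifting) add_0 mem_Collect_eq)
    fix x c assume "x \<in> J"
    then obtain m n where mn: "x = m + n" "m \<in> M" "n \<in> N" by (auto simp: J_def)
    then have "mat c ** x = mat c ** m + mat c ** n" by (simp add: matrix_add_ldistrib)
    then show "mat c ** x \<in> J"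
      using complex_subspaceD(3)[OF iM(1) mn(2)] complex_subspaceD(3)[OF iN(1) mn(3)] unfolding J_def by blast
  next
    fix x y assume "x \<in> J" "y \<in> J"
    then obtain m n m' n' where mn: "x = m + n" "m \<in> M" "n \<in> N" "y = m' + n'" "m' \<in> M" "n' \<in> N"
      unfolding J_def by blast
    then have "x + y = (m + m') + (n + n')" by simp
    then show "x + y \<in> J"
      using complex_subspaceD(2)[OF iM(1) mn(2,5)] complex_subspaceD(2)[OF iN(1) mn(3,6)] unfolding J_def by blast
  qed
  moreover have "J \<subseteq> A" using iM(2) iN(2) complex_subspaceD(2)[OF AD(1)] by (auto simp: J_def)
  moreover have "a ** j \<in> J \<and> j ** a \<in> J" if "a \<in> A" "j \<in> J" for a j
  proof -
    obtain m n where mn: "j = m + n" "m \<in> M" "n \<in> N" using \<open>j \<in> J\<close> unfolding J_def by blast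
    have "a ** j = a ** m + a ** n" "j ** a = m ** a + n ** a"
      by (simp_all add: mn matrix_add_ldistrib matrix_add_rdistrib)
    then show ?thesis using iM(3)[OF that(1) mn(2)] iN(3)[OF that(1) mn(3)] unfolding J_def by blast
  qed
  ultimately have J: "algebra_ideal A J" by (simp add: algebra_ideal_def)
  have MJ: "M \<subseteq> J" and NJ: "N \<subseteq> J"
    using complex_subspaceD(1)[OF iM(1)] complex_subspaceD(1)[OF iN(1)] unfolding J_def
    by (metis (mono_tags, lifting) add_0 add_0_right mem_Collect_eq subsetI)+
  have "mat 1 \<in> J"
  proof (rule ccontr)
    assume "mat 1 \<notin> J"
    then have "J = M" "J = N" using M N J MJ NJ unfolding maximal_algebra_ideal_def by blast+
    then show False using ne by simp
  qed
  then obtain m n where "mat 1 = m + n" "m \<in> M" "n \<in> N" unfolding J_def by blast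
  then show ?thesis using that[of n] by simp
qed

text \<open>A Chinese remainder argument: each further maximal ideal strictly lowers the dimension
  of the intersection of the previous ones, so there are at most \<open>dim A\<close> of
  them.\<close>

lemma finite_maximal_ideals:
  assumes A: "matrix_algebra A"
  shows "finite {M. maximal_algebra_ideal A M}"
proof -
  note AD = matrix_algebraD[OF A]
  \<comment> \<open>The element is a product of comaximality witnesses: one factor for each member
    of F, lying in that member and congruent to 1 modulo M.\<close>
  have sep: "\<exists>x\<in>A \<inter> \<Inter>F. mat 1 - x \<in> M"
    if "finite F" "F \<subseteq> {M. maximal_algebra_ideal A M}" "maximal_algebra_ideal A M" "M \<notin> F" for F M
    using that
  proof (induction F rule: finite_induct)
    case empty
    then show ?case using AD(3) complex_subspaceD(1)[of M]
      by (intro bexI[of _ "mat 1"]) (auto simp: maximal_algebra_ideal_def algebra_ideal_def)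
  next
    case (insert N F)
    obtain x where x: "x \<in> A" "x \<in> \<Inter>F" "mat 1 - x \<in> M" using insert by blast
    have N: "maximal_algebra_ideal A N" and M: "maximal_algebra_ideal A M" using insert.prems by auto
    obtain y where y: "y \<in> N" "mat 1 - y \<in> M"
      using maximal_ideals_comaximal[OF A M N] insert.prems by auto
    have yA: "y \<in> A" using y(1) N by (auto simp: maximal_algebra_ideal_def algebra_ideal_def)
    have M': "complex_subspace M" "\<And>a m. a \<in> A \<Longrightarrow> m \<in> M \<Longrightarrow> a ** m \<in> M"
      using M by (auto simp: maximal_algebra_ideal_def algebra_ideal_def)
    have "x ** y \<in> P" if "P \<in> F" for P
      using that x(2) yA insert.prems(1) by (auto simp: maximal_algebra_ideal_def algebra_ideal_def)
    moreover have "x ** y \<in> N" using y(1) x(1) N by (auto simp: maximal_algebra_ideal_def algebra_ideal_def)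
    moreover have "mat 1 - x ** y \<in> M"
    proof -
      have "mat 1 - x ** y = (mat 1 - x) + x ** (mat 1 - y)" by (simp add: matrix_diff_ldistrib)
      then show ?thesis using complex_subspaceD(2)[OF M'(1) x(3) M'(2)[OF x(1) y(2)]] by (simp only:)
    qed
    ultimately show ?case using AD(5)[OF x(1) yA] by blast
  qed
  have "dim (A \<inter> \<Inter>F) + card F \<le> dim A"
    if "finite F" "F \<subseteq> {M. maximal_algebra_ideal A M}" for F
    using that
  proof (induction F rule: finite_induct)
    case (insert M F)
    have M: "maximal_algebra_ideal A M" using insert.prems by auto
    obtain x where x: "x \<in> A \<inter> \<Inter>F" "mat 1 - x \<in> M"
      using sep[OF insert.hyps(1) _ M insert.hyps(2)] insert.prems by blast
    have "x \<notin> M"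
    proof
      assume "x \<in> M"
      then have "mat 1 - x + x \<in> M"
        using M x(2) complex_subspaceD(2)[of M "mat 1 - x" x]
          by (simp add: maximal_algebra_ideal_def algebra_ideal_def)
      then show False using M by (simp add: maximal_algebra_ideal_def)
    qed
    then have ps: "A \<inter> \<Inter>(insert M F) \<subset> A \<inter> \<Inter>F" using x(1) by blast
    have sub: "subspace (A \<inter> \<Inter>G)" if "G \<subseteq> insert M F" for G
    proof (intro subspace_inter subspace_Inter ballI)
      show "subspace A" using complex_subspace_subspace AD(1) .
      fix P assume "P \<in> G"
      then have "maximal_algebra_ideal A P" using that insert.prems(1) by blast
      then show "subspace P"
        by (simp add: maximal_algebra_ideal_def algebra_ideal_def complex_subspace_subspace)
    qed
    have "dim (A \<inter> \<Inter>(insert M F)) < dim (A \<inter> \<Inter>F)"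
    proof (rule dim_psubset)
      have "span (A \<inter> \<Inter>F) = A \<inter> \<Inter>F" "span (A \<inter> \<Inter>(insert M F)) = A \<inter> \<Inter>(insert M F)"
        by (rule span_eq_iff[THEN iffD2] sub subset_insertI order_refl)+
      then show "span (A \<inter> \<Inter>(insert M F)) \<subset> span (A \<inter> \<Inter>F)" using ps by (simp only:)
    qed
    moreover have "dim (A \<inter> \<Inter>F) + card F \<le> dim A"
      using insert.IH insert.prems by blast
    moreover have "card (insert M F) = Suc (card F)" using insert.hyps by simp
    ultimately show ?case by linarith
  qed simp
  then have "\<forall>F. F \<subseteq> {M. maximal_algebra_ideal A M} \<longrightarrow> finite F \<longrightarrow> card F \<le> dim A" by fastforce
  then show ?thesis using finite_if_finite_subsets_card_bdd by blast
qed

definition eigenvalues :: "complex^'n^'n \<Rightarrow> complex set" where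
  "eigenvalues a = {\<mu>. \<exists>v. v \<noteq> 0 \<and> a *v v = \<mu> *s v}"

lemma finite_eigenvalues: "finite (eigenvalues (a :: complex^'n^'n))"
proof -
  have zero: "\<forall>\<mu>\<in>F. w \<mu> = 0"
    if "finite F" "\<And>\<mu>. \<mu> \<in> F \<Longrightarrow> a *v w \<mu> = \<mu> *s w \<mu>" "(\<Sum>\<mu>\<in>F. w \<mu>) = 0" for F w
    using that
  proof (induction F arbitrary: w rule: finite_induct)
    case (insert \<nu> F)
    have sum0: "w \<nu> + (\<Sum>\<mu>\<in>F. w \<mu>) = 0" using insert by simp
    \<comment> \<open>Applying a - \<nu> removes the term of \<nu> and rescales the others by the
      nonzero factors \<mu> - \<nu>.\<close>
    have "(\<Sum>\<mu>\<in>F. (\<mu> - \<nu>) *s w \<mu>) = 0"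
    proof -
      have "(\<Sum>\<mu>\<in>F. (\<mu> - \<nu>) *s w \<mu>) = (\<Sum>\<mu>\<in>F. a *v w \<mu>) - (\<Sum>\<mu>\<in>F. \<nu> *s w \<mu>)"
        unfolding sum_subtractf[symmetric]
        using insert.prems(1) by (intro sum.cong) (auto simp: vec.scale_left_diff_distrib)
      also have "\<dots> = a *v (\<Sum>\<mu>\<in>F. w \<mu>) - \<nu> *s (\<Sum>\<mu>\<in>F. w \<mu>)"
        by (simp add: vec.sum vec.scale_sum_right)
      also have "(\<Sum>\<mu>\<in>F. w \<mu>) = - w \<nu>" using sum0 by (simp add: eq_neg_iff_add_eq_0 add.commute)
      finally show ?thesis using insert.prems(1)[of \<nu>] by (simp add: vec.neg vec.scale_minus_right)
    qed
    then have "\<forall>\<mu>\<in>F. (\<mu> - \<nu>) *s w \<mu> = 0"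
    proof (rule insert.IH[rotated])
      show "a *v ((\<mu> - \<nu>) *s w \<mu>) = \<mu> *s ((\<mu> - \<nu>) *s w \<mu>)" if "\<mu> \<in> F" for \<mu>
        using insert.prems(1) that by (simp only: vector_scalar_commute insertI2 vec.scale_left_commute)
    qed
    then have "\<forall>\<mu>\<in>F. w \<mu> = 0" using insert.hyps(2) by auto
    then show ?case using sum0 by simp
  qed simp
  have "card F \<le> CARD('n)" if F: "F \<subseteq> eigenvalues a" "finite F" for F
  proof -
    obtain v where v: "\<And>\<mu>. \<mu> \<in> F \<Longrightarrow> v \<mu> \<noteq> 0 \<and> a *v v \<mu> = \<mu> *s v \<mu>"
      using F(1) unfolding eigenvalues_def subset_iff mem_Collect_eq by metis
    have inj: "inj_on v F"
    proof (rule inj_onI)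
      fix \<mu> \<nu> assume h: "\<mu> \<in> F" "\<nu> \<in> F" "v \<mu> = v \<nu>"
      then have "\<mu> *s v \<mu> = \<nu> *s v \<mu>" using v by metis
      then show "\<mu> = \<nu>" using v h by simp
    qed
    have "vec.independent (v ` F)"
    proof (rule vec.independent_if_scalars_zero)
      fix f x assume s: "(\<Sum>x\<in>v ` F. f x *s x) = 0" and x: "x \<in> v ` F"
      have "(\<Sum>\<mu>\<in>F. f (v \<mu>) *s v \<mu>) = 0" using s inj by (simp add: sum.reindex)
      then have "\<forall>\<mu>\<in>F. f (v \<mu>) *s v \<mu> = 0"
      proof (rule zero[OF F(2), rotated])
        show "a *v (f (v \<mu>) *s v \<mu>) = \<mu> *s (f (v \<mu>) *s v \<mu>)" if "\<mu> \<in> F" for \<mu>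
          using v[OF that] by (simp only: vector_scalar_commute vec.scale_left_commute)
      qed
      then show "f x = 0" using x v by auto
    qed (use F(2) in simp)
    then have "card (v ` F) \<le> vec.dim (UNIV :: (complex^'n) set)"
      by (intro vec.independent_card_le_dim) auto
    then show ?thesis using inj by (simp add: card_image card_cart_basis)
  qed
  then show ?thesis using finite_if_finite_subsets_card_bdd by blast
qed

text \<open>An eigenvalue \<mu> of the compression is one of \<open>x\<close>: otherwise x - \<mu>
  has an inverse in \<open>N\<close>, and by compressibility the compressed inverse inverts the
  compression of x - \<mu>. The length bound CARD('n) does not depend on \<open>x\<close>, so
  finitely many eigenvalues leave finitely many traces.\<close>

lemma trace_compression:
  fixes e x :: "complex^'n^'n"
  assumes N: "matrix_algebra N" and e: "compressible N e" and x: "x \<in> N"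
  shows "trace (e ** x ** e) \<in> sum_list ` {ls. set ls \<subseteq> eigenvalues x \<and> length ls \<le> CARD('n)}"
proof -
  have ee: "e ** e = e" using e by (simp add: compressible_def)
  have "\<mu> \<in> eigenvalues x" if v: "v \<noteq> 0" "v \<in> fixed_space e" "(e ** x ** e) *v v = \<mu> *s v" for \<mu> v
  proof (rule ccontr)
    assume no: "\<mu> \<notin> eigenvalues x"
    let ?x = "x - mat \<mu>"
    have xN: "?x \<in> N" using complex_subspaceD(5)[OF matrix_algebraD(1)[OF N] x] matrix_algebraD(4)[OF N] by blast
    have "w = 0" if "?x *v w = 0" for w
    proof -
      have "x *v w = \<mu> *s w" using that by (simp add: matrix_vector_mult_diff_rdistrib mat_vec_scalar)
      then show ?thesis using no unfolding eigenvalues_def by blast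
    qed
    then obtain b where b: "b \<in> N" "b ** ?x = mat 1" using matrix_algebra_inverse[OF N xN] by metis
    have ev: "e *v v = v" using v(2) by (simp add: fixed_space_def)
    have "(e ** ?x ** e) *v v = 0"
      using v(3) ev by (simp add: matrix_diff_ldistrib matrix_diff_rdistrib matrix_vector_mult_diff_rdistrib)
        (simp add: ev vector_scalar_commute mat_vec_scalar flip: matrix_vector_mul_assoc)
    moreover have "e ** b ** e ** ?x ** e = e ** b ** ?x ** e"
      using e b(1) xN by (simp add: compressible_def)
    then have "(e ** b) *v ((e ** ?x ** e) *v v) = (e ** (b ** ?x) ** e) *v v"
      by (simp add: matrix_vector_mul_assoc matrix_mul_assoc)
    ultimately have "0 = (e ** e) *v v" by (simp add: b(2))
    then show False using v(1) ee ev by simp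
  qed
  then have "\<exists>ls. set ls \<subseteq> eigenvalues x \<and> length ls \<le> vec.dim (fixed_space e) \<and>
      (e \<noteq> 0 \<longrightarrow> ls \<noteq> []) \<and> trace (e ** x ** e) = sum_list ls"
  proof (intro trace_corner_eigenvalues)
    show "e ** (e ** x ** e) = e ** x ** e" by (simp add: matrix_mul_assoc ee)
    show "e ** x ** e ** e = e ** x ** e" by (simp add: ee flip: matrix_mul_assoc)
  qed (rule ee, blast)
  moreover have "vec.dim (fixed_space e) \<le> CARD('n)"
    using vec.dim_subset[of "fixed_space e" UNIV] by (simp only: vec_dim_card subset_UNIV)
  ultimately show ?thesis by fastforce
qed

lemma finite_trace_compressions:
  fixes e :: "complex^'n^'n"
  assumes N: "matrix_algebra N" and e: "compressible N e"
    and D: "D \<subseteq> N" and fin: "finite (\<Union>x\<in>D. eigenvalues x)"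
  shows "finite ((\<lambda>x. trace (e ** x ** e)) ` D)"
proof (rule finite_subset)
  let ?L = "{ls. set ls \<subseteq> (\<Union>x\<in>D. eigenvalues x) \<and> length ls \<le> CARD('n)}"
  show "finite (sum_list ` ?L)" using finite_lists_length_le[OF fin] by blast
  show "(\<lambda>x. trace (e ** x ** e)) ` D \<subseteq> sum_list ` ?L"
  proof clarify
    fix x assume x: "x \<in> D"
    then have "trace (e ** x ** e) \<in> sum_list ` {ls. set ls \<subseteq> eigenvalues x \<and> length ls \<le> CARD('n)}"
      by (intro trace_compression[OF N e]) (use D in blast)
    then show "trace (e ** x ** e) \<in> sum_list ` ?L" using x by blast
  qed
qed

lemma eigenvalues_similar:
  fixes b b' x :: "complex^'n^'n"
  assumes "b ** b' = mat 1" "b' ** b = mat 1"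
  shows "eigenvalues (b ** x ** b') = eigenvalues x"
proof -
  have sub: "eigenvalues (c ** y ** c') \<subseteq> eigenvalues y"
    if "c ** c' = mat 1" "c' ** c = mat 1" for c c' y :: "complex^'n^'n"
  proof
    fix \<mu> assume "\<mu> \<in> eigenvalues (c ** y ** c')"
    then obtain v where v: "v \<noteq> 0" "(c ** y ** c') *v v = \<mu> *s v" by (auto simp: eigenvalues_def)
    have "y *v (c' *v v) = c' *v ((c ** y ** c') *v v)"
      by (simp add: matrix_vector_mul_assoc matrix_mul_assoc that)
    then have "y *v (c' *v v) = \<mu> *s (c' *v v)" by (simp add: v vector_scalar_commute)
    moreover have "c' *v v \<noteq> 0"
    proof
      assume "c' *v v = 0"
      then have "c *v (c' *v v) = 0" by simp
      then show False using v(1) by (simp add: matrix_vector_mul_assoc that)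
    qed
    ultimately show "\<mu> \<in> eigenvalues y" by (auto simp: eigenvalues_def)
  qed
  have "x = b' ** (b ** x ** b') ** b"
    by (simp add: matrix_mul_assoc assms) (simp add: assms flip: matrix_mul_assoc)
  then show ?thesis using sub[OF assms, of x] sub[OF assms(2,1), of "b ** x ** b'"] by auto
qed

section \<open>Linear approximation of local homomorphisms\<close>

text \<open>For fixed x the function g(t) = L(t x) - t L(x) is additive, vanishes on the integers
  and is bounded on [0, 1]. Hence n g(c) = g(frac(n c)) is bounded in n, which forces g(c) =
  0.\<close>

lemma bounded_additive_imp_linear:
  fixes L :: "'a::real_normed_vector \<Rightarrow> 'b::real_normed_vector"
  assumes add: "\<And>x y. L (x + y) = L x + L y" and bd: "\<And>x. norm (L x) \<le> C * norm x"
  shows "bounded_linear L"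
proof (rule bounded_linear_intro[of _ C])
  fix c :: real and x
  define g where "g t = L (t *\<^sub>R x) - t *\<^sub>R L x" for t
  have g_add: "g (s + t) = g s + g t" for s t
    by (simp add: g_def scaleR_left_distrib add)
  have g0: "g 0 = 0" using g_add[of 0 0] by simp
  have g_minus: "g (- t) = - g t" for t using g_add[of t "- t"] g0 by (simp add: eq_neg_iff_add_eq_0 add.commute)
  have g1: "g 1 = 0" by (simp add: g_def)
  have g_nat: "g (of_nat n * t) = of_nat n *\<^sub>R g t" for n t
    by (induction n) (simp_all add: g0 g_add distrib_right scaleR_left_distrib)
  have g_int: "g (of_int k) = 0" for k
  proof (cases k)
    case (nonneg n) then show ?thesis using g_nat[of n 1] g1 by simp
  next
    case (neg n)
    then show ?thesis using g_nat[of "Suc n" 1] g_minus[of "of_nat (Suc n)"] g1 by simp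
  qed
  define B where "B = C * norm x + norm (L x)"
  have B: "norm (g t) \<le> B" if "0 \<le> t" "t \<le> 1" for t
  proof -
    have "norm (g t) \<le> norm (L (t *\<^sub>R x)) + norm (t *\<^sub>R L x)" unfolding g_def by (rule norm_triangle_ineq4)
    also have "\<dots> \<le> t * (C * norm x) + t * norm (L x)" using bd[of "t *\<^sub>R x"] that by (simp add: mult_ac)
    also have "\<dots> = t * B" by (simp add: B_def distrib_left)
    also have "\<dots> \<le> B"
      using that bd[of x] order_trans[OF norm_ge_zero bd[of x]] unfolding B_def by (intro mult_left_le_one_le) auto
    finally show ?thesis .
  qed
  have "real n * norm (g c) \<le> B" for n
  proof -
    have "real n *\<^sub>R g c = g (of_int \<lfloor>of_nat n * c\<rfloor>) + g (frac (of_nat n * c))"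
      by (simp flip: g_nat g_add add: frac_def)
    then have "norm (real n *\<^sub>R g c) \<le> B"
      using B[of "frac (of_nat n * c)"] frac_lt_1[of "of_nat n * c"] by (simp add: g_int)
    then show ?thesis by simp
  qed
  then have "norm (g c) \<le> 0" by (metis ex_less_of_nat_mult linorder_not_le mult.commute)
  then show "L (c *\<^sub>R x) = c *\<^sub>R L x" by (simp add: g_def)
qed (use add bd in \<open>simp_all add: mult.commute\<close>)

text \<open>Hyers' method: L x is the limit of 2^n f(x / 2^n). Stage n changes the value by at most
  C |x|^2 2^-n / 4, which is summable, and the defect of additivity shrinks like 2^-n. The limit
  exists for every x because x / 2^n eventually enters the ball.\<close>

lemma quasi_additive_imp_linear_approx:
  fixes f :: "'a::banach \<Rightarrow> 'b::banach"
  assumes d: "\<delta> > 0" and lip: "\<And>x. norm x < \<delta> \<Longrightarrow> norm (f x) \<le> C * norm x"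
    and qa: "\<And>x y. norm x < \<delta> \<Longrightarrow> norm y < \<delta> \<Longrightarrow> norm (f (x + y) - f x - f y) \<le> C * norm x * norm y"
  obtains L where "bounded_linear L" "\<And>x. norm x < \<delta> \<Longrightarrow> norm (f x - L x) \<le> C * (norm x)\<^sup>2"
proof -
  define s where "s n x = 2 ^ n *\<^sub>R f ((1/2) ^ n *\<^sub>R x)" for n x
  have small: "\<forall>\<^sub>F n in sequentially. norm ((1/2) ^ n *\<^sub>R x) < \<delta>" for x :: 'a
  proof -
    have "(\<lambda>n. (1/2) ^ n * norm x) \<longlonglongrightarrow> 0"
      by (intro tendsto_mult_left_zero LIMSEQ_power_zero) simp
    then have "\<forall>\<^sub>F n in sequentially. (1/2) ^ n * norm x < \<delta>" using d by (rule order_tendstoD)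
    then show ?thesis by simp
  qed
  have small': "norm ((1/2) ^ Suc n *\<^sub>R x) < \<delta>" if "norm ((1/2) ^ n *\<^sub>R x) < \<delta>" for x :: 'a and n
  proof -
    have "norm ((1/2) ^ Suc n *\<^sub>R x) = norm ((1/2) ^ n *\<^sub>R x) / 2" by simp
    then show ?thesis using that norm_ge_zero[of "(1/2) ^ n *\<^sub>R x"] by linarith
  qed
  have step: "norm (s (Suc n) x - s n x) \<le> C * (norm x)\<^sup>2 * (1/2) ^ n / 4"
    if "norm ((1/2) ^ n *\<^sub>R x) < \<delta>" for n x
  proof -
    let ?y = "(1/2) ^ Suc n *\<^sub>R x"
    have yy: "?y + ?y = (1/2) ^ n *\<^sub>R x" by (simp flip: scaleR_left_distrib)
    have "s (Suc n) x - s n x = - (2 ^ n *\<^sub>R (f (?y + ?y) - f ?y - f ?y))"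
    proof -
      have "(2::real) ^ Suc n *\<^sub>R u = 2 ^ n *\<^sub>R u + 2 ^ n *\<^sub>R u" for u :: 'b
        by (simp flip: scaleR_left_distrib)
      then show ?thesis unfolding s_def yy by (simp only: scaleR_right_diff_distrib) (simp add: algebra_simps)
    qed
    then have "norm (s (Suc n) x - s n x) = 2 ^ n * norm (f (?y + ?y) - f ?y - f ?y)" by simp
    also have "\<dots> \<le> 2 ^ n * (C * norm ?y * norm ?y)"
      by (intro mult_left_mono qa small' that) auto
    also have "\<dots> = C * (norm x)\<^sup>2 * (1/2) ^ n / 4"
      by (simp add: power2_eq_square power_one_over field_simps)
    finally show ?thesis .
  qed
  have "convergent (\<lambda>n. s n x)" for x
  proof -
    have "summable (\<lambda>n. C * (norm x)\<^sup>2 / 4 * (1/2) ^ n)"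
      by (intro summable_mult summable_geometric) simp
    moreover have "\<forall>\<^sub>F n in sequentially. norm (s (Suc n) x - s n x) \<le> C * (norm x)\<^sup>2 / 4 * (1/2) ^ n"
      using small[of x] by eventually_elim (use step in \<open>simp add: field_simps\<close>)
    ultimately have "summable (\<lambda>n. s (Suc n) x - s n x)" by (rule summable_comparison_test_ev[rotated])
    then have "convergent (\<lambda>n. \<Sum>i<n. s (Suc i) x - s i x)" by (simp add: summable_iff_convergent)
    then have "convergent (\<lambda>n. (\<Sum>i<n. s (Suc i) x - s i x) + s 0 x)"
      by (rule convergent_add) (rule convergent_const)
    moreover have "(\<Sum>i<n. s (Suc i) x - s i x) + s 0 x = s n x" for n
      using sum_lessThan_telescope[of "\<lambda>i. s i x" n] by simp
    ultimately show ?thesis by (simp only:)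
  qed
  then obtain L where L: "\<And>x. (\<lambda>n. s n x) \<longlonglongrightarrow> L x" unfolding convergent_def by metis
  have "L (x + y) = L x + L y" for x y
  proof -
    have "(\<lambda>n. s n (x + y) - s n x - s n y) \<longlonglongrightarrow> 0"
    proof (rule Lim_null_comparison)
      show "\<forall>\<^sub>F n in sequentially. norm (s n (x + y) - s n x - s n y) \<le> (1/2) ^ n * (C * norm x * norm y)"
        using small[of x] small[of y]
      proof eventually_elim
        case (elim n)
        let ?x = "(1/2) ^ n *\<^sub>R x" and ?y = "(1/2) ^ n *\<^sub>R y"
        have "s n (x + y) - s n x - s n y = 2 ^ n *\<^sub>R (f (?x + ?y) - f ?x - f ?y)"
          by (simp only: s_def scaleR_right_distrib scaleR_right_diff_distrib)
        then have "norm (s n (x + y) - s n x - s n y) = 2 ^ n * norm (f (?x + ?y) - f ?x - f ?y)" by simp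
        also have "\<dots> \<le> 2 ^ n * (C * norm ?x * norm ?y)" by (intro mult_left_mono qa elim) auto
        also have "\<dots> = (1/2) ^ n * (C * norm x * norm y)" by (simp add: power_one_over field_simps)
        finally show ?case .
      qed
      show "(\<lambda>n. (1/2) ^ n * (C * norm x * norm y)) \<longlonglongrightarrow> 0"
        by (intro tendsto_mult_left_zero LIMSEQ_power_zero) simp
    qed
    moreover have "(\<lambda>n. s n (x + y) - s n x - s n y) \<longlonglongrightarrow> L (x + y) - L x - L y"
      by (intro tendsto_diff L)
    ultimately have "L (x + y) - L x - L y = 0" using LIMSEQ_unique by blast
    then show ?thesis by (simp add: algebra_simps)
  qed
  moreover have "norm (L x) \<le> C * norm x" for x
  proof (rule tendsto_upperbound[OF tendsto_norm[OF L]])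
    show "\<forall>\<^sub>F n in sequentially. norm (s n x) \<le> C * norm x"
      using small[of x]
    proof eventually_elim
      case (elim n)
      have "norm (s n x) = 2 ^ n * norm (f ((1/2) ^ n *\<^sub>R x))" by (simp add: s_def)
      also have "\<dots> \<le> 2 ^ n * (C * norm ((1/2) ^ n *\<^sub>R x))" by (intro mult_left_mono lip elim) auto
      also have "\<dots> = C * norm x" by (simp add: power_one_over field_simps)
      finally show ?case .
    qed
  qed simp
  ultimately have lin: "bounded_linear L" by (rule bounded_additive_imp_linear)
  have "norm (f x - L x) \<le> C * (norm x)\<^sup>2" if x: "norm x < \<delta>" for x
  proof -
    have sm: "norm ((1/2) ^ n *\<^sub>R x) < \<delta>" for n
    proof (induction n)
      case (Suc n) then show ?case by (rule small')
    qed (use x in simp)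
    have C: "0 \<le> C * (norm x)\<^sup>2" using order_trans[OF norm_ge_zero lip[OF x]]
      by (simp add: power2_eq_square mult.assoc[symmetric])
    \<comment> \<open>The factor 1 - 2^-n closes the induction: the increment 2^-n / 4 fits into the
      gap 2^-n / 2.\<close>
    have "norm (s n x - f x) \<le> C * (norm x)\<^sup>2 * (1 - (1/2) ^ n)" for n
    proof (induction n)
      case (Suc n)
      have "norm (s (Suc n) x - f x) \<le> norm (s (Suc n) x - s n x) + norm (s n x - f x)"
        using norm_triangle_ineq[of "s (Suc n) x - s n x" "s n x - f x"] by simp
      also have "\<dots> \<le> C * (norm x)\<^sup>2 * (1/2) ^ n / 4 + C * (norm x)\<^sup>2 * (1 - (1/2) ^ n)"
        by (rule add_mono[OF step[OF sm] Suc])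
      also have "\<dots> \<le> C * (norm x)\<^sup>2 * (1 - (1/2) ^ Suc n)"
        using mult_nonneg_nonneg[OF C, of "(1/2)^n"] by (simp add: algebra_simps)
      finally show ?case .
    qed (simp add: s_def)
    moreover have "C * (norm x)\<^sup>2 * (1 - (1/2) ^ n) \<le> C * (norm x)\<^sup>2" for n
      using C by (intro mult_left_le) auto
    ultimately have "norm (s n x - f x) \<le> C * (norm x)\<^sup>2" for n by (rule order_trans)
    then have "norm (L x - f x) \<le> C * (norm x)\<^sup>2"
      by (intro tendsto_upperbound[OF tendsto_norm[OF tendsto_diff[OF L tendsto_const]]]) auto
    then show ?thesis by (simp add: norm_minus_commute)
  qed
  then show ?thesis using that lin by blast
qed

section \<open>First order estimates for a smooth product with unit\<close>

lemma smooth_on_deriv_lipschitz: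
  assumes sm: "smooth_on S F" and S: "open S" "z0 \<in> S"
  obtains r K where "r > 0" "K \<ge> 0" "ball z0 r \<subseteq> S"
    "\<And>z. z \<in> ball z0 r \<Longrightarrow> (F has_derivative frechet_derivative F (at z)) (at z)"
    "\<And>z z' h. z \<in> ball z0 r \<Longrightarrow> z' \<in> ball z0 r \<Longrightarrow>
       norm (frechet_derivative F (at z) h - frechet_derivative F (at z') h) \<le> K * norm (z - z') * norm h"
proof -
  obtain D where FD: "F \<in> D" and D: "\<And>g. g \<in> D \<Longrightarrow> continuous_on S g"
    "\<And>g x. g \<in> D \<Longrightarrow> x \<in> S \<Longrightarrow> g differentiable (at x)"
    "\<And>g b. g \<in> D \<Longrightarrow> b \<in> Basis \<Longrightarrow> (\<lambda>x. frechet_derivative g (at x) b) \<in> D"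
    using sm unfolding smooth_on_def by metis
  obtain r where r: "r > 0" "cball z0 r \<subseteq> S" using S open_contains_cball by blast
  have bS: "z \<in> S" if "z \<in> ball z0 r" for z using that r(2) by auto
  have der: "(g has_derivative frechet_derivative g (at z)) (at z)" if "g \<in> D" "z \<in> S" for g z
    using D(2)[OF that] frechet_derivative_works by blast
  have expand: "frechet_derivative g (at z) h = (\<Sum>b\<in>Basis. (h \<bullet> b) *\<^sub>R frechet_derivative g (at z) b)"
    if "g \<in> D" "z \<in> S" for g z h
  proof -
    have lin: "linear (frechet_derivative g (at z))" using der[OF that] has_derivative_linear by blast
    have "frechet_derivative g (at z) h = frechet_derivative g (at z) (\<Sum>b\<in>Basis. (h \<bullet> b) *\<^sub>R b)"
      by (simp add: euclidean_representation)
    also have "\<dots> = (\<Sum>b\<in>Basis. (h \<bullet> b) *\<^sub>R frechet_derivative g (at z) b)"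
      by (simp add: linear_sum[OF lin] linear_scale[OF lin])
    finally show ?thesis .
  qed
  have coeff: "norm (\<Sum>b\<in>Basis. (h \<bullet> b) *\<^sub>R v b) \<le> norm h * (\<Sum>b\<in>Basis. norm (v b))" for h :: 'a and v :: "'a \<Rightarrow> 'b"
    unfolding sum_distrib_left
    by (intro order_trans[OF norm_sum] sum_mono) (simp add: Basis_le_norm mult_right_mono)
  define G where "G b = (\<lambda>x. frechet_derivative F (at x) b)" for b
  have GD: "G b \<in> D" if "b \<in> Basis" for b using D(3)[OF FD that] by (simp add: G_def)
  \<comment> \<open>The second partial derivatives lie in the family D again, so they are
    continuous, hence bounded on the compact ball. The mean value inequality then makes the first
    ones Lipschitz.\<close>
  have "\<exists>K\<ge>0. \<forall>z\<in>ball z0 r. \<forall>z'\<in>ball z0 r. norm (G b z - G b z') \<le> K * norm (z - z')" if b: "b \<in> Basis" for b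
  proof -
    have "\<exists>B. \<forall>x\<in>cball z0 r. norm (frechet_derivative (G b) (at x) c) \<le> B" if c: "c \<in> Basis" for c
    proof -
      have "continuous_on (cball z0 r) (\<lambda>x. frechet_derivative (G b) (at x) c)"
        using D(1)[OF D(3)[OF GD[OF b] c]] r(2) continuous_on_subset by blast
      then have "bounded ((\<lambda>x. frechet_derivative (G b) (at x) c) ` cball z0 r)"
        by (intro compact_imp_bounded compact_continuous_image) auto
      then show ?thesis unfolding bounded_iff by auto
    qed
    then obtain B where B: "\<And>c x. c \<in> Basis \<Longrightarrow> x \<in> cball z0 r \<Longrightarrow> norm (frechet_derivative (G b) (at x) c) \<le> B c"
      by metis
    let ?K = "\<Sum>c\<in>Basis. \<bar>B c\<bar>"
    have "norm (G b z - G b z') \<le> ?K * norm (z - z')" if z: "z \<in> ball z0 r" "z' \<in> ball z0 r" for z z'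
    proof (rule differentiable_bound[OF convex_ball[of z0 r] _ _ z])
      fix x assume x: "x \<in> ball z0 r"
      show "(G b has_derivative frechet_derivative (G b) (at x)) (at x within ball z0 r)"
        using der[OF GD[OF b] bS[OF x]] has_derivative_at_withinI by blast
      show "onorm (frechet_derivative (G b) (at x)) \<le> ?K"
      proof (rule onorm_le)
        fix h
        have "norm (frechet_derivative (G b) (at x) h)
          \<le> norm h * (\<Sum>c\<in>Basis. norm (frechet_derivative (G b) (at x) c))"
          unfolding expand[OF GD[OF b] bS[OF x], of h] by (rule coeff)
        also have "\<dots> \<le> norm h * ?K"
          by (intro mult_left_mono sum_mono order_trans[OF B] abs_ge_self) (use x in auto)
        finally show "norm (frechet_derivative (G b) (at x) h) \<le> ?K * norm h" by (simp add: mult.commute)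
      qed
    qed
    then show ?thesis by (intro exI[of _ ?K]) (auto intro: sum_nonneg)
  qed
  then obtain K where K: "\<And>b. b \<in> Basis \<Longrightarrow> K b \<ge> 0"
    "\<And>b z z'. b \<in> Basis \<Longrightarrow> z \<in> ball z0 r \<Longrightarrow> z' \<in> ball z0 r \<Longrightarrow> norm (G b z - G b z') \<le> K b * norm (z - z')"
    using bchoice[of Basis "\<lambda>b K. K \<ge> 0 \<and> (\<forall>z\<in>ball z0 r. \<forall>z'\<in>ball z0 r. norm (G b z - G b z')
      \<le> K * norm (z - z'))"]
    by blast
  show ?thesis
  proof (rule that[of r "\<Sum>b\<in>Basis. K b"])
    show "0 \<le> (\<Sum>b\<in>Basis. K b)" using K(1) by (rule sum_nonneg)
    fix z assume z: "z \<in> ball z0 r"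
    show "(F has_derivative frechet_derivative F (at z)) (at z)" using der[OF FD bS[OF z]] .
    fix z' h assume z': "z' \<in> ball z0 r"
    have "frechet_derivative F (at z) h - frechet_derivative F (at z') h
      = (\<Sum>b\<in>Basis. (h \<bullet> b) *\<^sub>R (G b z - G b z'))"
      unfolding expand[OF FD bS[OF z], of h] expand[OF FD bS[OF z'], of h]
      by (simp add: G_def scaleR_right_diff_distrib sum_subtractf)
    then have "norm (frechet_derivative F (at z) h - frechet_derivative F (at z') h)
      \<le> norm h * (\<Sum>b\<in>Basis. norm (G b z - G b z'))"
      using coeff by simp
    also have "\<dots> \<le> norm h * (\<Sum>b\<in>Basis. K b * norm (z - z'))"
      by (intro mult_left_mono sum_mono K z z') auto
    finally show "norm (frechet_derivative F (at z) h - frechet_derivative F (at z') h)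
      \<le> (\<Sum>b\<in>Basis. K b) * norm (z - z') * norm h"
      by (simp add: sum_distrib_right mult_ac flip: sum_distrib_left)
  qed (use r in auto)
qed

text \<open>Since F(a, p) = a, the first estimate bounds the increment in a of F(a, b) - F(a, p),
  whose derivative is at most K |b - p|; the second is symmetric. Increments are estimated, and not
  only F itself, so that products of nearby points can be compared.\<close>

lemma smooth_unital_product_estimate:
  fixes F :: "'e::euclidean_space \<times> 'e \<Rightarrow> 'e"
  assumes sm: "smooth_on S F" and S: "open S" "(p, p) \<in> S"
    and unit: "\<And>a. (a, p) \<in> S \<Longrightarrow> F (a, p) = a" "\<And>b. (p, b) \<in> S \<Longrightarrow> F (p, b) = b"
  obtains r K where "r > 0" "K \<ge> 0" "ball p r \<times> ball p r \<subseteq> S"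
    "\<And>a a' b. a \<in> ball p r \<Longrightarrow> a' \<in> ball p r \<Longrightarrow> b \<in> ball p r \<Longrightarrow>
       norm (F (a, b) - F (a', b) - (a - a')) \<le> K * norm (a - a') * norm (b - p)"
    "\<And>a b b'. a \<in> ball p r \<Longrightarrow> b \<in> ball p r \<Longrightarrow> b' \<in> ball p r \<Longrightarrow>
       norm (F (a, b) - F (a, b') - (b - b')) \<le> K * norm (a - p) * norm (b - b')"
proof -
  obtain r K where r: "r > 0" "K \<ge> 0" "ball (p, p) r \<subseteq> S"
    "\<And>z. z \<in> ball (p, p) r \<Longrightarrow> (F has_derivative frechet_derivative F (at z)) (at z)"
    "\<And>z z' h. z \<in> ball (p, p) r \<Longrightarrow> z' \<in> ball (p, p) r \<Longrightarrow>
       norm (frechet_derivative F (at z) h - frechet_derivative F (at z') h) \<le> K * norm (z - z') * norm h"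
    using smooth_on_deriv_lipschitz[OF sm S] by metis
  let ?F = "\<lambda>z. frechet_derivative F (at z)"
  \<comment> \<open>The radius is halved so that a product of two balls fits into a ball of the
    product metric.\<close>
  have sub: "(a, b) \<in> ball (p, p) r" if "a \<in> ball p (r/2)" "b \<in> ball p (r/2)" for a b
  proof -
    have "dist (p, p) (a, b) \<le> dist p a + dist p b"
      unfolding dist_Pair_Pair by (rule sqrt_sum_squares_le_sum) auto
    then show ?thesis using that by simp
  qed
  have pin: "p \<in> ball p (r/2)" using r(1) by simp
  have E1: "norm (F (a, b) - F (a', b) - (a - a')) \<le> K * norm (a - a') * norm (b - p)"
    if ab: "a \<in> ball p (r/2)" "a' \<in> ball p (r/2)" "b \<in> ball p (r/2)" for a a' b
  proof -
    define g where "g x = F (x, b) - F (x, p)" for x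
    have "norm (g a - g a') \<le> (K * norm (b - p)) * norm (a - a')"
    proof (rule differentiable_bound[OF convex_ball[of p "r/2"] _ _ ab(1,2)])
      fix x assume x: "x \<in> ball p (r/2)"
      have 1: "((\<lambda>x. F (x, b)) has_derivative (\<lambda>h. ?F (x, b) (h, 0))) (at x)"
        by (rule has_derivative_compose[of "\<lambda>x. (x, b)" "\<lambda>h. (h, 0)", OF _ r(4)[OF sub[OF x ab(3)]]])
           (auto intro!: derivative_eq_intros)
      have 2: "((\<lambda>x. F (x, p)) has_derivative (\<lambda>h. ?F (x, p) (h, 0))) (at x)"
        by (rule has_derivative_compose[of "\<lambda>x. (x, p)" "\<lambda>h. (h, 0)", OF _ r(4)[OF sub[OF x pin]]])
           (auto intro!: derivative_eq_intros)
      show "(g has_derivative (\<lambda>h. ?F (x, b) (h, 0) - ?F (x, p) (h, 0))) (at x within ball p (r/2))"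
        unfolding g_def
        by (intro has_derivative_diff has_derivative_at_withinI[OF 1] has_derivative_at_withinI[OF 2])
      show "onorm (\<lambda>h. ?F (x, b) (h, 0) - ?F (x, p) (h, 0)) \<le> K * norm (b - p)"
      proof (rule onorm_le)
        show "norm (?F (x, b) (h, 0) - ?F (x, p) (h, 0)) \<le> K * norm (b - p) * norm h" for h
          using r(5)[OF sub[OF x ab(3)] sub[OF x pin], of "(h, 0)"] by (simp add: norm_Pair)
      qed
    qed
    moreover have "F (a, p) = a" "F (a', p) = a'"
      using unit(1) sub[OF ab(1) pin] sub[OF ab(2) pin] r(3) by blast+
    moreover have "F (a, b) - F (a', b) - (a - a') = F (a, b) - a - (F (a', b) - a')" by simp
    ultimately show ?thesis unfolding g_def by (metis mult.commute mult.left_commute)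
  qed
  have E2: "norm (F (a, b) - F (a, b') - (b - b')) \<le> K * norm (a - p) * norm (b - b')"
    if ab: "a \<in> ball p (r/2)" "b \<in> ball p (r/2)" "b' \<in> ball p (r/2)" for a b b'
  proof -
    define g where "g x = F (a, x) - F (p, x)" for x
    have "norm (g b - g b') \<le> (K * norm (a - p)) * norm (b - b')"
    proof (rule differentiable_bound[OF convex_ball[of p "r/2"] _ _ ab(2,3)])
      fix x assume x: "x \<in> ball p (r/2)"
      have 1: "((\<lambda>x. F (a, x)) has_derivative (\<lambda>h. ?F (a, x) (0, h))) (at x)"
        by (rule has_derivative_compose[of "\<lambda>x. (a, x)" "\<lambda>h. (0, h)", OF _ r(4)[OF sub[OF ab(1) x]]])
           (auto intro!: derivative_eq_intros)
      have 2: "((\<lambda>x. F (p, x)) has_derivative (\<lambda>h. ?F (p, x) (0, h))) (at x)"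
        by (rule has_derivative_compose[of "\<lambda>x. (p, x)" "\<lambda>h. (0, h)", OF _ r(4)[OF sub[OF pin x]]])
           (auto intro!: derivative_eq_intros)
      show "(g has_derivative (\<lambda>h. ?F (a, x) (0, h) - ?F (p, x) (0, h))) (at x within ball p (r/2))"
        unfolding g_def
        by (intro has_derivative_diff has_derivative_at_withinI[OF 1] has_derivative_at_withinI[OF 2])
      show "onorm (\<lambda>h. ?F (a, x) (0, h) - ?F (p, x) (0, h)) \<le> K * norm (a - p)"
      proof (rule onorm_le)
        show "norm (?F (a, x) (0, h) - ?F (p, x) (0, h)) \<le> K * norm (a - p) * norm h" for h
          using r(5)[OF sub[OF ab(1) x] sub[OF pin x], of "(0, h)"] by (simp add: norm_Pair)
      qed
    qed
    moreover have "F (p, b) = b" "F (p, b') = b'"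
      using unit(2) sub[OF pin ab(2)] sub[OF pin ab(3)] r(3) by blast+
    moreover have "F (a, b) - F (a, b') - (b - b') = F (a, b) - b - (F (a, b') - b')" by simp
    ultimately show ?thesis unfolding g_def by (metis mult.commute mult.left_commute)
  qed
  have "ball p (r/2) \<times> ball p (r/2) \<subseteq> S" using sub r(3) by auto
  then show ?thesis using that[of "r/2" K] r(1,2) E1 E2 by simp
qed

text \<open>The group law read in a chart with the identity at 0. The bound
  \<open>K * r \<le> 1/4\<close> turns each error term into a quarter of one factor, and
  \<open>division\<close> is continuity of (d, c) -> d^-1 c at the identity.\<close>

locale local_group =
  fixes m :: "'e::euclidean_space \<Rightarrow> 'e \<Rightarrow> 'e" and r K :: real
  assumes r: "r > 0" and K: "K \<ge> 0" and Kr: "K * r \<le> 1/4"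
    and unit: "norm a < r \<Longrightarrow> m a 0 = a" "norm a < r \<Longrightarrow> m 0 a = a"
    and left_lipschitz: "norm a < r \<Longrightarrow> norm a' < r \<Longrightarrow> norm b < r \<Longrightarrow>
      norm (m a b - m a' b - (a - a')) \<le> K * norm (a - a') * norm b"
    and right_lipschitz: "norm a < r \<Longrightarrow> norm b < r \<Longrightarrow> norm b' < r \<Longrightarrow>
      norm (m a b - m a b' - (b - b')) \<le> K * norm a * norm (b - b')"
    and division: "\<rho> > 0 \<Longrightarrow> \<exists>\<sigma>>0. \<forall>c d. norm c < \<sigma> \<longrightarrow> norm d < \<sigma> \<longrightarrow> (\<exists>e. norm e < \<rho> \<and> m d e = c)"
begin

definition local_hom :: "('e \<Rightarrow> 'e) \<Rightarrow> real \<Rightarrow> bool" where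
  "local_hom f \<delta> \<longleftrightarrow> 0 < \<delta> \<and> \<delta> \<le> r \<and> f 0 = 0 \<and> (\<forall>a. norm a < \<delta> \<longrightarrow> norm (f a) < r) \<and>
     (\<forall>a b. norm a < \<delta> \<longrightarrow> norm b < \<delta> \<longrightarrow> f (m a b) = m (f a) (f b))"

lemma K_small: "norm a < r \<Longrightarrow> K * norm a \<le> 1/4"
  using mult_left_mono[of "norm a" r K] K Kr by linarith

lemma product_estimate:
  assumes "norm a < r" "norm b < r"
  shows "norm (m a b - a - b) \<le> K * norm a * norm b"
  using left_lipschitz[of a 0 b] assms unit r by (simp add: algebra_simps)

lemma product_estimate':
  assumes "norm a < r" "norm b < r"
  shows "norm (m a b - a - b) \<le> norm b / 4" "norm (m a b - a - b) \<le> norm a / 4"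
  using product_estimate[OF assms] mult_right_mono[OF K_small[OF assms(1)], of "norm b"]
    mult_right_mono[OF K_small[OF assms(2)], of "norm a"]
  by (simp_all add: mult_ac)

text \<open>Compare the powers \<open>a\<^sup>n \<approx> na\<close> and \<open>f(a)\<^sup>n \<approx> nf(a)\<close> for the largest \<open>n\<close> for which \<open>a\<^sup>n\<close> stays in
  the domain of \<open>f\<close>.\<close>
lemma local_hom_bound:
  assumes f: "local_hom f \<delta>" and a: "norm a < \<delta> / 2"
  shows "norm (f a) \<le> 6 * r / \<delta> * norm a"
proof (cases "a = 0")
  case True then show ?thesis using f by (simp add: local_hom_def)
next
  case False
  have d: "\<delta> > 0" "\<delta> \<le> r" "f 0 = 0" and fr: "\<And>a. norm a < \<delta> \<Longrightarrow> norm (f a) < r"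
    and hom: "\<And>a b. norm a < \<delta> \<Longrightarrow> norm b < \<delta> \<Longrightarrow> f (m a b) = m (f a) (f b)"
    using f by (auto simp: local_hom_def)
  have na: "norm a > 0" "norm a < \<delta>" "norm a < r" using False a d by auto
  \<comment> \<open>Up to q steps of length |a| cover half of \<delta>. The accumulated errors, a
    quarter of |a| per step, still leave the powers inside the ball.\<close>
  define q where "q = \<delta> / (2 * norm a)"
  have q1: "q > 1" using a na by (simp add: q_def field_simps)
  define N where "N = nat \<lfloor>q\<rfloor>"
  have N: "real N \<le> q" "q / 2 \<le> real N" 
  proof -
    have "real N = of_int \<lfloor>q\<rfloor>" using q1 by (simp add: N_def)
    moreover have "1 \<le> \<lfloor>q\<rfloor>" using q1 by simp
    then have "1 \<le> real_of_int \<lfloor>q\<rfloor>" by linarith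
    ultimately show "real N \<le> q" "q / 2 \<le> real N" using q1 by linarith+
  qed
  define p where "p = (\<lambda>n. ((\<lambda>x. m x a) ^^ n) 0)"
  have p: "p 0 = 0" "p (Suc n) = m (p n) a" for n by (simp_all add: p_def)
  have small: "5/4 * real n * norm a < \<delta>" if "n \<le> N" for n
  proof -
    have "real n * norm a \<le> q * norm a" using that N na by (intro mult_right_mono) auto
    also have "\<dots> = \<delta> / 2" using na by (simp add: q_def)
    finally show ?thesis using d by linarith
  qed
  have pb: "norm (p n) \<le> 5/4 * real n * norm a" if "n \<le> N" for n
    using that
  proof (induction n)
    case (Suc n)
    then have IH: "norm (p n) \<le> 5/4 * real n * norm a" by simp
    then have "norm (p n) < r" using small[of n] Suc.prems d by simp
    then have "norm (m (p n) a - p n - a) \<le> norm a / 4" using product_estimate' na by blast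
    moreover have "norm (m (p n) a) \<le> norm (m (p n) a - p n - a) + norm (p n) + norm a"
      using norm_triangle_ineq[of "m (p n) a - p n - a" "p n + a"] norm_triangle_ineq[of "p n" a] by simp
    ultimately show ?case using IH by (simp add: p algebra_simps)
  qed (simp add: p)
  have p\<delta>: "norm (p n) < \<delta>" if "n \<le> N" for n using pb[OF that] small[OF that] by linarith
  have fp: "norm (f (p n) - real n *\<^sub>R f a) \<le> real n * norm (f a) / 4" if "n \<le> N" for n
    using that
  proof (induction n)
    case (Suc n)
    have e: "f (p (Suc n)) = m (f (p n)) (f a)" using p\<delta>[of n] Suc.prems na by (simp add: p hom)
    have "norm (m (f (p n)) (f a) - f (p n) - f a) \<le> norm (f a) / 4"
      using product_estimate' fr p\<delta>[of n] Suc.prems na by simp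
    moreover have "f (p (Suc n)) - real (Suc n) *\<^sub>R f a
      = (m (f (p n)) (f a) - f (p n) - f a) + (f (p n) - real n *\<^sub>R f a)"
      by (simp add: e scaleR_left_distrib)
    ultimately have "norm (f (p (Suc n)) - real (Suc n) *\<^sub>R f a)
      \<le> norm (f a) / 4 + norm (f (p n) - real n *\<^sub>R f a)"
      by (smt (verit) norm_triangle_ineq)
    then show ?case using Suc by (simp add: field_simps)
  qed (simp add: p d)
  have "norm (real N *\<^sub>R f a) \<le> norm (f (p N)) + norm (f (p N) - real N *\<^sub>R f a)"
    by (metis norm_minus_commute norm_triangle_sub)
  then have "real N * norm (f a) * (3/4) \<le> r"
    using fp[of N] fr[OF p\<delta>[of N]] by simp
  moreover have "q / 2 * norm (f a) \<le> real N * norm (f a)" using N(2) by (rule mult_right_mono) simp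
  ultimately have "q / 2 * norm (f a) * (3/4) \<le> r" by linarith
  \<comment> \<open>The deviation of a quarter and N \<ge> q / 2 together give the constant 16/3,
    rounded up to 6.\<close>
  then have "\<delta> * norm (f a) * 3 \<le> 16 * r * norm a" using na by (simp add: q_def field_simps)
  moreover have "0 \<le> r * norm a" using r by simp
  ultimately have "\<delta> * norm (f a) \<le> 6 * r * norm a" by linarith
  then show ?thesis using d by (simp add: field_simps)
qed

lemma quotient_bound:
  assumes "norm d < r" "norm e < r" "m d e = c"
  shows "norm e \<le> 2 * norm (c - d)"
proof -
  have "norm (c - d - e) \<le> norm e / 4" using product_estimate'(1)[OF assms(1,2)] assms(3) by simp
  moreover have "norm e \<le> norm (c - d) + norm (c - d - e)"
    using norm_triangle_ineq4[of "c - d" "c - d - e"] by simp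
  ultimately show ?thesis using norm_ge_zero[of "c - d"] by linarith
qed

text \<open>Write c = d e with |e| \<le> 2 |c - d|. Then f c - f d differs from f e by at most |f e|
  / 4, and the linear bound on f e finishes the estimate.\<close>

lemma local_hom_lipschitz:
  assumes f: "local_hom f \<delta>"
  obtains \<sigma> C where "\<sigma> > 0" "\<sigma> \<le> \<delta> / 2" "C \<ge> 0" "\<And>a. norm a < \<sigma> \<Longrightarrow> norm (f a) \<le> C * norm a"
    "\<And>c d. norm c < \<sigma> \<Longrightarrow> norm d < \<sigma> \<Longrightarrow> norm (f c - f d) \<le> C * norm (c - d)"
proof -
  have d: "\<delta> > 0" "\<delta> \<le> r" "f 0 = 0" and fr: "\<And>a. norm a < \<delta> \<Longrightarrow> norm (f a) < r"
    and hom: "\<And>a b. norm a < \<delta> \<Longrightarrow> norm b < \<delta> \<Longrightarrow> f (m a b) = m (f a) (f b)"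
    using f by (auto simp: local_hom_def)
  define C where "C = 6 * r / \<delta>"
  have C: "C \<ge> 0" using r d by (simp add: C_def)
  obtain \<sigma> where s: "\<sigma> > 0" "\<And>c d. norm c < \<sigma> \<Longrightarrow> norm d < \<sigma> \<Longrightarrow> \<exists>e. norm e < \<delta> / 2 \<and> m d e = c"
    using division[of "\<delta> / 2"] d by auto
  show ?thesis
  proof (rule that[of "min \<sigma> (\<delta> / 2)" "4 * C"])
    show "norm (f a) \<le> 4 * C * norm a" if "norm a < min \<sigma> (\<delta> / 2)" for a
      using local_hom_bound[OF f, of a, folded C_def] that mult_nonneg_nonneg[OF C norm_ge_zero[of a]] by simp
    fix c' d' :: 'e assume cd: "norm c' < min \<sigma> (\<delta> / 2)" "norm d' < min \<sigma> (\<delta> / 2)"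
    obtain e where e: "norm e < \<delta> / 2" "m d' e = c'" using s(2) cd by auto
    have le: "norm e \<le> 2 * norm (c' - d')" using quotient_bound[OF _ _ e(2)] cd e d by auto
    have "norm (f c' - f d' - f e) \<le> norm (f e) / 4"
      using product_estimate'(1)[of "f d'" "f e"] hom[of d' e] fr[of d'] fr[of e] cd e d by auto
    then have "norm (f c' - f d') \<le> 2 * norm (f e)"
      using norm_triangle_sub[of "f c' - f d'" "f e"] norm_ge_zero[of "f e"] by linarith
    also have "\<dots> \<le> 2 * (C * norm e)" using local_hom_bound[OF f e(1)] by (simp add: C_def)
    also have "\<dots> \<le> 2 * (C * (2 * norm (c' - d')))" using le C by (intro mult_left_mono) auto
    finally show "norm (f c' - f d') \<le> 4 * C * norm (c' - d')" by simp
  qed (use s d C in auto)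
qed

text \<open>Compare f(x + y) with f(x y) by the Lipschitz bound, and f(x y) = f(x) f(y) with f(x) +
  f(y) by the product estimate. Both errors are O(|x||y|), which is the quasi-additivity required by
  \<open>quasi_additive_imp_linear_approx\<close>.\<close>

lemma local_hom_linear_approx:
  assumes f: "local_hom f \<delta>"
  obtains L C \<sigma> where "bounded_linear L" "\<sigma> > 0" "\<And>a. norm a < \<sigma> \<Longrightarrow> norm (f a - L a) \<le> C * (norm a)\<^sup>2"
proof -
  have d: "\<delta> > 0" "\<delta> \<le> r" and fr: "\<And>a. norm a < \<delta> \<Longrightarrow> norm (f a) < r"
    and hom: "\<And>a b. norm a < \<delta> \<Longrightarrow> norm b < \<delta> \<Longrightarrow> f (m a b) = m (f a) (f b)"
    using f by (auto simp: local_hom_def)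
  obtain \<sigma> C where s: "\<sigma> > 0" "\<sigma> \<le> \<delta> / 2" "C \<ge> 0"
    and fC: "\<And>a. norm a < \<sigma> \<Longrightarrow> norm (f a) \<le> C * norm a"
    and lip: "\<And>c d. norm c < \<sigma> \<Longrightarrow> norm d < \<sigma> \<Longrightarrow> norm (f c - f d) \<le> C * norm (c - d)"
    using local_hom_lipschitz[OF f] by metis
  \<comment> \<open>C bounds f linearly, C K comes from the Lipschitz comparison and K C C from the
    product of the images.\<close>
  define C' where "C' = C + C * K + K * C * C"
  have C': "C \<le> C'" "C * K + K * C * C \<le> C'" using s K by (simp_all add: C'_def)
  have qa: "norm (f (x + y) - f x - f y) \<le> C' * norm x * norm y" if xy: "norm x < \<sigma> / 3" "norm y < \<sigma> / 3" for x y
  proof -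
    have xr: "norm x < r" "norm y < r" "norm x < \<delta>" "norm y < \<delta>" "norm x < \<sigma>" "norm y < \<sigma>" using xy s d by auto
    have pe: "norm (m x y - x - y) \<le> K * norm x * norm y" by (rule product_estimate[OF xr(1,2)])
    have pe': "norm (m x y - x - y) \<le> norm y / 4" by (rule product_estimate'[OF xr(1,2)])
    have "norm (m x y) \<le> norm (m x y - x - y) + norm x + norm y"
      using norm_triangle_ineq[of "m x y - x - y" "x + y"] norm_triangle_ineq[of x y] by simp
    then have ms: "norm (m x y) < \<sigma>" using pe' xy s(1) by linarith
    have xys: "norm (x + y) < \<sigma>" using norm_triangle_ineq[of x y] xy s(1) by linarith
    have "norm (f (x + y) - f (m x y)) \<le> C * norm (x + y - m x y)" by (rule lip[OF xys ms])
    also have "norm (x + y - m x y) = norm (m x y - x - y)" by (metis diff_diff_eq norm_minus_commute)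
    also have "C * norm (m x y - x - y) \<le> C * (K * norm x * norm y)" by (intro mult_left_mono pe s)
    finally have 1: "norm (f (x + y) - f (m x y)) \<le> C * K * norm x * norm y" by (simp add: mult_ac)
    have "norm (f (m x y) - f x - f y) \<le> K * norm (f x) * norm (f y)"
      using product_estimate[of "f x" "f y"] hom fr xr by simp
    also have "\<dots> \<le> K * (C * norm x) * (C * norm y)"
      by (intro mult_mono mult_left_mono fC xr K mult_nonneg_nonneg s) auto
    finally have 2: "norm (f (m x y) - f x - f y) \<le> K * C * C * norm x * norm y" by (simp add: mult_ac)
    have "norm (f (x + y) - f x - f y) \<le> norm (f (x + y) - f (m x y)) + norm (f (m x y) - f x - f y)"
      using norm_triangle_ineq[of "f (x + y) - f (m x y)" "f (m x y) - f x - f y"] by (simp add: algebra_simps)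
    also have "\<dots> \<le> (C * K + K * C * C) * (norm x * norm y)" using 1 2 by (simp add: algebra_simps)
    also have "\<dots> \<le> C' * (norm x * norm y)" by (intro mult_right_mono C') auto
    finally show ?thesis by (simp add: mult_ac)
  qed
  have "norm (f x) \<le> C' * norm x" if "norm x < \<sigma> / 3" for x
    using fC[of x] that mult_right_mono[OF C'(1), of "norm x"] norm_ge_zero[of x] by linarith
  then obtain L where "bounded_linear L" "\<And>x. norm x < \<sigma> / 3 \<Longrightarrow> norm (f x - L x) \<le> C' * (norm x)\<^sup>2"
    using quasi_additive_imp_linear_approx[of "\<sigma> / 3" f C'] qa s by auto
  then show ?thesis using that[of L "\<sigma> / 3" C'] s by auto
qed

lemma quadratic_approx_has_derivative:
  fixes f :: "'e \<Rightarrow> 'e"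
  assumes L: "bounded_linear L" and s: "\<sigma> > 0" and a: "\<And>a. norm a < \<sigma> \<Longrightarrow> norm (f a - L a) \<le> C * (norm a)\<^sup>2"
  shows "(f has_derivative L) (at 0)"
  unfolding has_derivative_iff_norm
proof (intro conjI L)
  have f0: "f 0 = 0" using a[of 0] s linear_0[OF bounded_linear.linear[OF L]] by simp
  show "((\<lambda>y. norm (f y - f 0 - L (y - 0)) / norm (y - 0)) \<longlongrightarrow> 0) (at 0)"
  proof (rule Lim_null_comparison)
    show "((\<lambda>y. C * norm (y :: 'e)) \<longlongrightarrow> 0) (at 0)" by (auto intro!: tendsto_eq_intros)
    have "norm (norm (f y - f 0 - L (y - 0)) / norm (y - 0)) \<le> C * norm y" if "norm y < \<sigma>" "y \<noteq> 0" for y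
      using a[OF that(1)] that(2) by (simp add: f0 field_simps power2_eq_square)
    then show "\<forall>\<^sub>F y in at 0. norm (norm (f y - f 0 - L (y - 0)) / norm (y - 0)) \<le> C * norm y"
      using s by (auto simp: eventually_at dist_norm intro!: exI[of _ \<sigma>])
  qed
qed

lemma local_hom_derivative:
  assumes f: "local_hom f \<delta>"
  obtains L C \<sigma> where "(f has_derivative L) (at 0)" "\<sigma> > 0" "\<And>a. norm a < \<sigma> \<Longrightarrow> norm (f a - L a) \<le> C * (norm a)\<^sup>2"
proof (rule local_hom_linear_approx[OF f])
  fix L C \<sigma> assume "bounded_linear L" "\<sigma> > 0" "\<And>a. norm a < \<sigma> \<Longrightarrow> norm (f a - L a) \<le> C * (norm a)\<^sup>2"
  then show thesis using that[of L \<sigma> C] quadratic_approx_has_derivative[of L \<sigma> f C] by blast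
qed

text \<open>With \<open>g(a) = f(a) - a = O(|a|\<^sup>2)\<close>, writing \<open>c\<close> as \<open>m d e\<close> shows that near \<open>d\<close> the function \<open>g\<close> has
  Lipschitz constant at most \<open>4K|g(d)|\<close>. Since \<open>g(0) = 0\<close>, this forces \<open>g = 0\<close> on a small ball.\<close>
lemma local_hom_identity:
  assumes f: "local_hom f \<delta>" and der: "(f has_derivative (\<lambda>x. x)) (at 0)"
  obtains t where "t > 0" "\<And>a. norm a \<le> t \<Longrightarrow> f a = a"
proof -
  have d: "\<delta> > 0" "\<delta> \<le> r" "f 0 = 0" and fr: "\<And>a. norm a < \<delta> \<Longrightarrow> norm (f a) < r"
    and hom: "\<And>a b. norm a < \<delta> \<Longrightarrow> norm b < \<delta> \<Longrightarrow> f (m a b) = m (f a) (f b)"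
    using f by (auto simp: local_hom_def)
  obtain L C' \<sigma> where L: "(f has_derivative L) (at 0)" and s: "\<sigma> > 0"
    and fC': "\<And>a. norm a < \<sigma> \<Longrightarrow> norm (f a - L a) \<le> C' * (norm a)\<^sup>2"
    using local_hom_derivative[OF f] by metis
  have "L = (\<lambda>x. x)" using has_derivative_unique[OF L der] .
  define C where "C = \<bar>C'\<bar>"
  have C: "C \<ge> 0" by (simp add: C_def)
  define g where "g a = f a - a" for a
  have gC: "norm (g a) \<le> C * (norm a)\<^sup>2" if "norm a < \<sigma>" for a
  proof -
    have "C' * (norm a)\<^sup>2 \<le> C * (norm a)\<^sup>2" by (rule mult_right_mono) (simp_all add: C_def)
    then show ?thesis using fC'[OF that] \<open>L = _\<close> by (simp add: g_def)
  qed
  \<comment> \<open>The bound 1 / (C + 1) ensures |g e| \<le> |e| for the quotients \<open>e\<close>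
    below; the 1 covers C = 0.\<close>
  define \<rho> where "\<rho> = Min {\<delta>, \<sigma>, 1 / (C + 1)}"
  have \<rho>: "\<rho> > 0" "\<rho> \<le> \<delta>" "\<rho> \<le> \<sigma>" "\<rho> \<le> 1 / (C + 1)" using d s C by (simp_all add: \<rho>_def)
  obtain \<tau> where \<tau>: "\<tau> > 0" "\<And>c d. norm c < \<tau> \<Longrightarrow> norm d < \<tau> \<Longrightarrow> \<exists>e. norm e < \<rho> \<and> m d e = c"
    using division[OF \<rho>(1)] by auto
  \<comment> \<open>From t \<le> \<delta> / 2 \<le> r / 2 follows K t \<le> 1/8, so a slope of 4 K M
    over a distance t amounts to at most M / 2.\<close>
  define t where "t = Min {\<tau> / 2, \<sigma> / 2, \<delta> / 2}"
  have t: "t > 0" "t < \<tau>" "t < \<sigma>" "t < \<delta>" "t \<le> \<delta> / 2" using \<tau> s d by (simp_all add: t_def min_less_iff_disj)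
  have Kt: "K * t \<le> 1/8"
    using mult_left_mono[of t "r / 2" K] K Kr t d by auto
  have key: "norm (g c - g d') \<le> 4 * K * norm (g d') * norm (c - d') + 8 * C * (norm (c - d'))\<^sup>2"
    if cd: "norm c \<le> t" "norm d' \<le> t" for c d'
  proof -
    obtain e where e: "norm e < \<rho>" "m d' e = c" using \<tau>(2)[of c d'] cd t by auto
    have er: "norm e < r" "norm d' < r" "norm e < \<delta>" "norm d' < \<delta>" using e(1) \<rho> d cd t by auto
    have le: "norm e \<le> 2 * norm (c - d')" by (rule quotient_bound[OF er(2,1) e(2)])
    have "C * norm e \<le> 1"
    proof -
      have "(C + 1) * norm e \<le> (C + 1) * (1 / (C + 1))" using e(1) \<rho>(4) C by (intro mult_left_mono) auto
      then show ?thesis using C by (simp add: algebra_simps) (smt (verit) norm_ge_zero)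
    qed
    have ge: "norm (g e) \<le> C * (norm e)\<^sup>2" using gC e(1) \<rho> by simp
    also have "\<dots> \<le> norm e"
      using mult_right_mono[OF \<open>C * norm e \<le> 1\<close>, of "norm e"] by (simp add: power2_eq_square mult.assoc)
    finally have "norm (g e) \<le> norm e" .
    then have fe: "norm (f e) \<le> 2 * norm e" using norm_triangle_sub[of "f e" e] by (simp add: g_def)
    have ge': "norm (g e) \<le> 4 * C * (norm (c - d'))\<^sup>2"
    proof -
      have "C * (norm e)\<^sup>2 \<le> C * (2 * norm (c - d'))\<^sup>2" using le C by (intro mult_left_mono power_mono) auto
      then show ?thesis using ge by (simp add: power2_eq_square)
    qed
    have "g c - g d' = (m (f d') (f e) - m d' (f e) - (f d' - d')) + (m d' (f e) - m d' e - (f e - e)) + g e"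
      using hom[of d' e] e(2) er by (simp add: g_def)
    then have "norm (g c - g d')
      \<le> norm (m (f d') (f e) - m d' (f e) - (f d' - d')) + norm (m d' (f e) - m d' e - (f e - e)) + norm (g e)"
      by (metis norm_triangle_mono norm_triangle_ineq order_refl)
    also have "\<dots> \<le> K * norm (g d') * norm (f e) + K * norm d' * norm (g e) + norm (g e)"
      unfolding g_def using er fr by (intro add_mono left_lipschitz right_lipschitz order_refl) auto
    also have "\<dots> \<le> K * norm (g d') * (2 * (2 * norm (c - d'))) + norm (g e) + norm (g e)"
    proof (intro add_mono order_refl mult_left_mono mult_nonneg_nonneg K norm_ge_zero)
      show "norm (f e) \<le> 2 * (2 * norm (c - d'))" using fe le by simp
      show "K * norm d' * norm (g e) \<le> norm (g e)"
        using mult_right_mono[of "K * norm d'" 1 "norm (g e)"] K_small[OF er(2)] by simp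
    qed
    also have "\<dots> \<le> 4 * K * norm (g d') * norm (c - d') + 8 * C * (norm (c - d'))\<^sup>2"
      using ge' by simp
    finally show ?thesis .
  qed
  have g0: "g 0 = 0" using d by (simp add: g_def)
  have half: "norm (g x) \<le> M / 2" if M: "\<And>x. norm x \<le> t \<Longrightarrow> norm (g x) \<le> M" and x: "norm x \<le> t" for M x
  proof -
    \<comment> \<open>Cutting the segment from 0 to x into N pieces adds up the linear terms but
      leaves only 1/N of the quadratic one.\<close>
    have bound: "norm (g x) \<le> 4 * K * M * norm x + 8 * C * (norm x)\<^sup>2 / real N" if N: "N \<ge> 1" for N
    proof -
      define c where "c k = (real k / real N) *\<^sub>R x" for k
      have c: "norm (c k) \<le> t" if "k \<le> N" for k
      proof -
        have "real k / real N \<le> 1" using that N by simp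
        then have "real k / real N * norm x \<le> 1 * norm x" by (rule mult_right_mono) simp
        then show ?thesis using x by (simp add: c_def)
      qed
      have diff: "c (Suc k) - c k = (1 / real N) *\<^sub>R x" for k
        by (simp add: c_def add_divide_distrib flip: scaleR_left_diff_distrib)
      have step: "norm (g (c (Suc k)) - g (c k)) \<le> 4 * K * M * norm x / real N + 8 * C * (norm x)\<^sup>2 / (real N)\<^sup>2"
        if "k < N" for k
      proof -
        have "norm (g (c (Suc k)) - g (c k))
          \<le> 4 * K * norm (g (c k)) * (norm x / real N) + 8 * C * (norm x / real N)\<^sup>2"
          using key[of "c (Suc k)" "c k"] c[of "Suc k"] c[of k] that by (simp add: diff)
        also have "\<dots> \<le> 4 * K * M * (norm x / real N) + 8 * C * (norm x / real N)\<^sup>2"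
          using M[OF c[of k]] that K by (intro add_mono mult_right_mono mult_left_mono) auto
        finally show ?thesis by (simp add: power_divide)
      qed
      define B where "B = 4 * K * M * norm x / real N + 8 * C * (norm x)\<^sup>2 / (real N)\<^sup>2"
      have "norm (g (c k)) \<le> real k * B" if "k \<le> N" for k
        using that
      proof (induction k)
        case (Suc k)
        have "norm (g (c (Suc k))) \<le> norm (g (c k)) + norm (g (c (Suc k)) - g (c k))" by (rule norm_triangle_sub)
        then show ?case using Suc step[of k, folded B_def] by (simp add: algebra_simps)
      qed (simp add: c_def g0)
      from this[of N] show ?thesis using N by (simp add: c_def B_def power2_eq_square distrib_left)
    qed
    have "(\<lambda>N. 4 * K * M * norm x + 8 * C * (norm x)\<^sup>2 / real N) \<longlonglongrightarrow> 4 * K * M * norm x + 0"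
      by (intro tendsto_add tendsto_const lim_const_over_n)
    then have "norm (g x) \<le> 4 * K * M * norm x"
      using bound by (intro LIMSEQ_le_const[of _ "4 * K * M * norm x"]) auto
    also have "\<dots> = 4 * M * (K * norm x)" by simp
    also have "\<dots> \<le> 4 * M * (1 / 8)"
    proof (intro mult_left_mono)
      show "K * norm x \<le> 1/8" using mult_left_mono[OF x K] Kt by linarith
      show "0 \<le> 4 * M" using order_trans[OF norm_ge_zero M[OF x]] by simp
    qed
    finally show ?thesis by simp
  qed
  have small: "norm x \<le> t \<Longrightarrow> norm (g x) \<le> C * t\<^sup>2 / 2 ^ n" for n x
  proof (induction n arbitrary: x)
    case 0
    have "C * (norm x)\<^sup>2 \<le> C * t\<^sup>2" using 0 C by (intro mult_left_mono power_mono) auto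
    then show ?case using gC[of x] 0 t by simp
  next
    case (Suc n)
    then show ?case using half[of "C * t\<^sup>2 / 2 ^ n" x] by (simp add: mult.commute)
  qed
  show ?thesis
  proof (rule that[OF t(1)])
    fix a :: 'e assume a: "norm a \<le> t"
    have "(\<lambda>n. C * t\<^sup>2 * (1/2) ^ n) \<longlonglongrightarrow> C * t\<^sup>2 * 0"
      by (intro tendsto_mult tendsto_const LIMSEQ_power_zero) simp
    moreover have "norm (g a) \<le> C * t\<^sup>2 * (1/2) ^ n" for n
      using small[OF a, of n] by (simp add: power_one_over)
    ultimately have "norm (g a) \<le> C * t\<^sup>2 * 0" 
      using LIMSEQ_le_const[of "\<lambda>n. C * t\<^sup>2 * (1/2) ^ n" "C * t\<^sup>2 * 0" "norm (g a)"] by blast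
    then show "f a = a" by (simp add: g_def)
  qed
qed

text \<open>The equation m (f b) a = m a b expresses that f is conjugation by a without an inverse.
  It makes f b - b a difference of two product errors, of total size 3 K |a||b| since |f b| \<le> 2
  |b|; rescaling b carries the bound to the derivative. This is the source of the continuity of
  Ad.\<close>

lemma conjugation_derivative_bound:
  assumes a: "norm a < r" and d: "\<delta> > 0" "\<delta> \<le> r"
    and f: "\<And>b. norm b < \<delta> \<Longrightarrow> norm (f b) < r \<and> m (f b) a = m a b" "f 0 = 0"
    and L: "(f has_derivative L) (at 0)"
  shows "norm (L h - h) \<le> 3 * K * norm a * norm h"
proof -
  have bnd: "norm (f b - b) \<le> 3 * K * norm a * norm b" if b: "norm b < \<delta>" for b
  proof -
    have br: "norm b < r" "norm (f b) < r" "m (f b) a = m a b" using b d f by auto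
    have 1: "norm (m (f b) a - f b - a) \<le> K * norm (f b) * norm a" "norm (m (f b) a - f b - a) \<le> norm (f b) / 4"
      using product_estimate product_estimate' br a by blast+
    have 2: "norm (m a b - a - b) \<le> K * norm a * norm b" "norm (m a b - a - b) \<le> norm b / 4"
      using product_estimate product_estimate' br a by blast+
    have "f b - b = (m a b - a - b) - (m (f b) a - f b - a)" using br(3) by simp
    then have le: "norm (f b - b) \<le> norm (m a b - a - b) + norm (m (f b) a - f b - a)"
      by (metis norm_triangle_ineq4)
    have "norm (f b) \<le> 2 * norm b"
      using le 1(2) 2(2) norm_triangle_sub[of "f b" b] norm_ge_zero[of b] by linarith
    then have "K * norm (f b) * norm a \<le> K * (2 * norm b) * norm a"
      using K by (intro mult_right_mono mult_left_mono) auto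
    then show ?thesis using le 1(1) 2(1) by (simp add: mult_ac)
  qed
  define g where "g b = f b - b" for b
  have gder: "(g has_derivative (\<lambda>h. L h - h)) (at 0)"
    unfolding g_def by (intro has_derivative_diff L has_derivative_ident)
  have "((\<lambda>s. g (s *\<^sub>R h)) has_derivative (\<lambda>s. L (s *\<^sub>R h) - s *\<^sub>R h)) (at 0)"
    by (rule has_derivative_compose[of "\<lambda>s. s *\<^sub>R h" "\<lambda>s. s *\<^sub>R h" 0 UNIV g])
       (use gder in \<open>auto intro!: derivative_eq_intros\<close>)
  moreover have "L (s *\<^sub>R h) - s *\<^sub>R h = s *\<^sub>R (L h - h)" for s
    using has_derivative_linear[OF L] by (simp add: linear_scale scaleR_right_diff_distrib)
  moreover have "g 0 = 0" using f(2) by (simp add: g_def)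
  ultimately have "((\<lambda>s. norm (g (s *\<^sub>R h) - s *\<^sub>R (L h - h)) / norm s) \<longlongrightarrow> 0) (at 0)"
    by (simp add: has_derivative_at)
  then have "((\<lambda>s. g (s *\<^sub>R h) /\<^sub>R s - (L h - h)) \<longlongrightarrow> 0) (at 0)"
  proof (rule Lim_null_comparison[rotated])
    have "norm (g (s *\<^sub>R h) /\<^sub>R s - v) \<le> norm (g (s *\<^sub>R h) - s *\<^sub>R v) / norm s" if "s \<noteq> 0" for s v
    proof -
      have "g (s *\<^sub>R h) /\<^sub>R s - v = (g (s *\<^sub>R h) - s *\<^sub>R v) /\<^sub>R s"
        using that by (simp add: scaleR_right_diff_distrib)
      then show ?thesis by (simp add: divide_inverse mult.commute)
    qed
    then show "\<forall>\<^sub>F s in at 0. norm (g (s *\<^sub>R h) /\<^sub>R s - (L h - h)) \<le> norm (g (s *\<^sub>R h) - s *\<^sub>R (L h - h)) / norm s"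
      unfolding eventually_at by (intro exI[of _ 1]) auto
  qed
  then have lim: "((\<lambda>s. g (s *\<^sub>R h) /\<^sub>R s) \<longlongrightarrow> L h - h) (at 0)" by (rule LIM_zero_cancel)
  show ?thesis
  proof (rule tendsto_upperbound[OF tendsto_norm[OF lim]])
    have "norm (g (s *\<^sub>R h) /\<^sub>R s) \<le> 3 * K * norm a * norm h" if "s \<noteq> 0" "\<bar>s\<bar> < \<delta> / (norm h + 1)" for s
    proof -
      have "\<bar>s\<bar> * (norm h + 1) < \<delta>" using that(2) norm_ge_zero[of h] by (simp add: field_simps)
      then have "norm (s *\<^sub>R h) < \<delta>" by (simp add: algebra_simps)
      from bnd[OF this] have "norm (g (s *\<^sub>R h)) \<le> 3 * K * norm a * (\<bar>s\<bar> * norm h)" by (simp add: g_def)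
      then show ?thesis using that(1) by (simp add: field_simps)
    qed
    then show "\<forall>\<^sub>F s in at 0. norm (g (s *\<^sub>R h) /\<^sub>R s) \<le> 3 * K * norm a * norm h"
      unfolding eventually_at using d norm_ge_zero[of h]
      by (intro exI[of _ "\<delta> / (norm h + 1)"]) (auto simp: dist_norm add_nonneg_pos)
  qed simp
qed

end

section \<open>Topological groups with a chart at the identity\<close>

text \<open>What is kept of the Lie structure: a connected topological group and one chart,
  translated to send the identity to 0, with inverse \<psi> on a ball whose products stay in the
  chart domain. Smoothness survives in the two Lipschitz estimates.\<close>

locale chart_group = group G for G :: "'g monoid" (structure) +
  fixes X :: "'g topology" and \<phi> :: "'g \<Rightarrow> 'e::euclidean_space" and \<psi> :: "'e \<Rightarrow> 'g"
    and U :: "'g set" and r K :: real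
  assumes top: "topspace X = carrier G"
    and hausdorff: "Hausdorff_space X"
    and connected: "connected_space X"
    and mult_cont: "continuous_map (prod_topology X X) X (\<lambda>(x, y). x \<otimes> y)"
    and inv_cont: "continuous_map X X (\<lambda>x. inv x)"
    and U: "openin X U" "\<one> \<in> U"
    and \<phi>_cont: "continuous_map (subtopology X U) euclidean \<phi>"
    and \<phi>_one: "\<phi> \<one> = 0"
    and \<psi>\<phi>: "x \<in> U \<Longrightarrow> \<psi> (\<phi> x) = x"
    and r_pos: "r > 0"
    and \<psi>: "norm a < r \<Longrightarrow> \<psi> a \<in> U" "norm a < r \<Longrightarrow> \<phi> (\<psi> a) = a"
    and \<psi>_cont: "continuous_map (top_of_set (ball 0 r)) X \<psi>"
    and prod_U: "norm a < r \<Longrightarrow> norm b < r \<Longrightarrow> \<psi> a \<otimes> \<psi> b \<in> U"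
    and K_nonneg: "K \<ge> 0" and K_r: "K * r \<le> 1/4"
    and left_lip: "norm a < r \<Longrightarrow> norm a' < r \<Longrightarrow> norm b < r \<Longrightarrow>
      norm (\<phi> (\<psi> a \<otimes> \<psi> b) - \<phi> (\<psi> a' \<otimes> \<psi> b) - (a - a')) \<le> K * norm (a - a') * norm b"
    and right_lip: "norm a < r \<Longrightarrow> norm b < r \<Longrightarrow> norm b' < r \<Longrightarrow>
      norm (\<phi> (\<psi> a \<otimes> \<psi> b) - \<phi> (\<psi> a \<otimes> \<psi> b') - (b - b')) \<le> K * norm a * norm (b - b')"
begin

definition "m a b = \<phi> (\<psi> a \<otimes> \<psi> b)"
definition "nbhd \<epsilon> = {x \<in> U. norm (\<phi> x) < \<epsilon>}"

lemma U_carrier: "x \<in> U \<Longrightarrow> x \<in> carrier G"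
  using openin_subset[OF U(1)] top by blast

lemma \<psi>_carrier [simp]: "norm a < r \<Longrightarrow> \<psi> a \<in> carrier G"
  using \<psi> U_carrier by blast

lemma \<psi>_zero [simp]: "\<psi> 0 = \<one>"
  using \<psi>\<phi>[OF U(2)] \<phi>_one by simp

lemma openin_nbhd: "openin X (nbhd \<epsilon>)"
proof -
  have "openin (subtopology X U) {x \<in> topspace (subtopology X U). \<phi> x \<in> ball 0 \<epsilon>}"
    by (rule openin_continuous_map_preimage[OF \<phi>_cont]) simp
  moreover have "{x \<in> topspace (subtopology X U). \<phi> x \<in> ball 0 \<epsilon>} = nbhd \<epsilon>"
    using U_carrier by (auto simp: nbhd_def top)
  ultimately show ?thesis using U(1) openin_trans_full by auto
qed

lemma one_nbhd: "\<epsilon> > 0 \<Longrightarrow> \<one> \<in> nbhd \<epsilon>"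
  using U \<phi>_one by (simp add: nbhd_def)

lemma chart_small:
  assumes "openin X V" "\<one> \<in> V"
  obtains \<delta> where "\<delta> > 0" "\<delta> \<le> r" "\<And>a. norm a < \<delta> \<Longrightarrow> \<psi> a \<in> V"
proof -
  have "openin (top_of_set (ball 0 r)) {a \<in> topspace (top_of_set (ball 0 r)). \<psi> a \<in> V}"
    by (rule openin_continuous_map_preimage[OF \<psi>_cont assms(1)])
  then have "open {a \<in> ball 0 r. \<psi> a \<in> V}" by (simp add: openin_open_eq)
  moreover have "0 \<in> {a \<in> ball 0 r. \<psi> a \<in> V}" using assms r_pos by simp
  ultimately obtain \<delta> where "\<delta> > 0" "ball 0 \<delta> \<subseteq> {a \<in> ball 0 r. \<psi> a \<in> V}"
    using openE by blast
  then show ?thesis using that[of "min \<delta> r"] r_pos by (auto simp: subset_iff)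
qed

lemma translation_open:
  assumes "openin X V" "x \<in> carrier G"
  shows "openin X {y \<in> carrier G. inv x \<otimes> y \<in> V}"
proof -
  have "continuous_map X (prod_topology X X) (\<lambda>y. (inv x, y))"
    using assms(2) top by (intro continuous_map_pairedI continuous_map_const[THEN iffD2]) auto
  then have "continuous_map X X ((\<lambda>(x, y). x \<otimes> y) \<circ> (\<lambda>y. (inv x, y)))"
    by (rule continuous_map_compose[OF _ mult_cont])
  from openin_continuous_map_preimage[OF this assms(1)] show ?thesis by (simp add: top)
qed

lemma division_ex:
  assumes "\<rho> > 0"
  shows "\<exists>\<sigma>>0. \<forall>c d. norm c < \<sigma> \<longrightarrow> norm d < \<sigma> \<longrightarrow> (\<exists>e. norm e < \<rho> \<and> m d e = c)"
proof -
  let ?V = "nbhd (min \<rho> r)"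
  let ?f = "\<lambda>p. inv (fst p) \<otimes> snd p"
  have "continuous_map (prod_topology X X) (prod_topology X X) (\<lambda>p. (inv (fst p), snd p))"
    using continuous_map_compose[OF continuous_map_fst inv_cont]
    by (intro continuous_map_pairedI continuous_map_snd) (simp add: o_def)
  from continuous_map_compose[OF this mult_cont]
  have "continuous_map (prod_topology X X) X ?f" by (simp add: o_def)
  then have "openin (prod_topology X X) {p \<in> topspace (prod_topology X X). ?f p \<in> ?V}"
    by (rule openin_continuous_map_preimage) (rule openin_nbhd)
  moreover have "(\<one>, \<one>) \<in> {p \<in> topspace (prod_topology X X). ?f p \<in> ?V}"
    using assms r_pos one_nbhd by (simp add: top)
  ultimately obtain A B where AB: "openin X A" "openin X B" "\<one> \<in> A" "\<one> \<in> B"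
    "A \<times> B \<subseteq> {p \<in> topspace (prod_topology X X). ?f p \<in> ?V}"
    unfolding openin_prod_topology_alt by meson
  obtain \<sigma> where \<sigma>: "\<sigma> > 0" "\<sigma> \<le> r" "\<And>a. norm a < \<sigma> \<Longrightarrow> \<psi> a \<in> A \<inter> B"
    using chart_small[of "A \<inter> B"] AB by blast
  have "\<exists>e. norm e < \<rho> \<and> m d e = c" if cd: "norm c < \<sigma>" "norm d < \<sigma>" for c d
  proof (intro exI conjI)
    let ?x = "inv (\<psi> d) \<otimes> \<psi> c"
    have "(\<psi> d, \<psi> c) \<in> A \<times> B" using \<sigma>(3) cd by simp
    then have "(\<psi> d, \<psi> c) \<in> {p \<in> topspace (prod_topology X X). ?f p \<in> ?V}" using AB(5) by blast
    then have "?x \<in> ?V" by simp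
    then have x: "?x \<in> U" "norm (\<phi> ?x) < \<rho>" by (auto simp: nbhd_def)
    show "norm (\<phi> ?x) < \<rho>" by (rule x)
    have "\<psi> d \<in> carrier G" "\<psi> c \<in> carrier G" using cd \<sigma> by auto
    then show "m d (\<phi> ?x) = c"
      using \<psi>(2)[of c] cd \<sigma> by (simp add: m_def \<psi>\<phi>[OF x(1)] flip: m_assoc)
  qed
  then show ?thesis using \<sigma> by blast
qed

sublocale local_group m r K
proof
  show "norm a < r \<Longrightarrow> m a 0 = a" "norm a < r \<Longrightarrow> m 0 a = a" for a
    by (simp_all add: m_def \<psi>)
qed (use r_pos K_nonneg K_r left_lip right_lip division_ex in \<open>auto simp: m_def\<close>)

definition endo :: "('g \<Rightarrow> 'g) \<Rightarrow> bool" where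
  "endo \<alpha> \<longleftrightarrow> \<alpha> \<in> hom G G \<and> continuous_map X X \<alpha>"

definition loc :: "('g \<Rightarrow> 'g) \<Rightarrow> 'e \<Rightarrow> 'e" where
  "loc \<alpha> a = \<phi> (\<alpha> (\<psi> a))"

text \<open>The derivative at the identity; the model space of the chart serves as the tangent
  space.\<close>

definition diff :: "('g \<Rightarrow> 'g) \<Rightarrow> 'e \<Rightarrow> 'e" where
  "diff \<alpha> = frechet_derivative (loc \<alpha>) (at 0)"

lemma endo_hom: "endo \<alpha> \<Longrightarrow> group_hom G G \<alpha>"
  by (simp add: endo_def group_hom_def group_hom_axioms_def is_group)

lemma endo_closed: "endo \<alpha> \<Longrightarrow> x \<in> carrier G \<Longrightarrow> \<alpha> x \<in> carrier G"
  by (auto simp: endo_def hom_def)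

lemma endo_small:
  assumes "endo \<alpha>" "\<epsilon> > 0"
  obtains \<delta> where "\<delta> > 0" "\<delta> \<le> r" "\<And>a. norm a < \<delta> \<Longrightarrow> \<alpha> (\<psi> a) \<in> U \<and> norm (loc \<alpha> a) < \<epsilon>"
proof -
  interpret group_hom G G \<alpha> using assms(1) by (rule endo_hom)
  have "openin X {x \<in> topspace X. \<alpha> x \<in> nbhd \<epsilon>}"
    using assms(1) by (intro openin_continuous_map_preimage[OF _ openin_nbhd]) (simp add: endo_def)
  moreover have "\<one> \<in> {x \<in> topspace X. \<alpha> x \<in> nbhd \<epsilon>}"
    using one_nbhd[OF assms(2)] by (simp add: top)
  ultimately obtain \<delta> where "\<delta> > 0" "\<delta> \<le> r" "\<And>a. norm a < \<delta> \<Longrightarrow> \<psi> a \<in> {x \<in> topspace X. \<alpha> x \<in> nbhd \<epsilon>}"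
    using chart_small by blast
  then show ?thesis using that[of \<delta>] by (auto simp: nbhd_def loc_def)
qed

lemma local_hom_loc:
  assumes "endo \<alpha>"
  obtains \<delta> where "local_hom (loc \<alpha>) \<delta>" "\<And>a. norm a < \<delta> \<Longrightarrow> \<alpha> (\<psi> a) \<in> U"
proof -
  interpret group_hom G G \<alpha> using assms(1) by (rule endo_hom)
  obtain \<delta> where \<delta>: "\<delta> > 0" "\<delta> \<le> r" "\<And>a. norm a < \<delta> \<Longrightarrow> \<alpha> (\<psi> a) \<in> U \<and> norm (loc \<alpha> a) < r"
    using endo_small[OF assms r_pos] by blast
  have "loc \<alpha> (m a b) = m (loc \<alpha> a) (loc \<alpha> b)" if "norm a < \<delta>" "norm b < \<delta>" for a b
  proof -
    have "loc \<alpha> (m a b) = \<phi> (\<alpha> (\<psi> a \<otimes> \<psi> b))"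
      using that \<delta> by (simp add: loc_def m_def \<psi>\<phi> prod_U)
    also have "\<dots> = m (loc \<alpha> a) (loc \<alpha> b)"
      using that \<delta> by (simp add: loc_def m_def \<psi>\<phi>)
    finally show ?thesis .
  qed
  then show ?thesis using that[of \<delta>] \<delta> by (simp add: local_hom_def) (simp add: loc_def \<phi>_one)
qed

lemma diff_works:
  assumes "endo \<alpha>" shows "(loc \<alpha> has_derivative diff \<alpha>) (at 0)"
proof -
  obtain \<delta> where "local_hom (loc \<alpha>) \<delta>" using local_hom_loc[OF assms] by blast
  then obtain L where "(loc \<alpha> has_derivative L) (at 0)" using local_hom_derivative by blast
  then show ?thesis unfolding diff_def using differentiableI frechet_derivative_works by blast
qed

lemma diff_unique: "endo \<alpha> \<Longrightarrow> (loc \<alpha> has_derivative L) (at 0) \<Longrightarrow> diff \<alpha> = L"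
  using diff_works has_derivative_unique by blast

lemma linear_diff: "endo \<alpha> \<Longrightarrow> linear (diff \<alpha>)"
  using diff_works has_derivative_linear by blast

lemma diff_compose:
  assumes "endo \<alpha>" "endo \<beta>" "endo \<gamma>" "\<And>x. x \<in> carrier G \<Longrightarrow> \<gamma> x = \<alpha> (\<beta> x)"
  shows "diff \<gamma> = diff \<alpha> \<circ> diff \<beta>"
proof (rule diff_unique[OF assms(3)])
  interpret group_hom G G \<beta> using assms(2) by (rule endo_hom)
  obtain \<delta> where \<delta>: "\<delta> > 0" "\<delta> \<le> r" "\<And>a. norm a < \<delta> \<Longrightarrow> \<beta> (\<psi> a) \<in> U \<and> norm (loc \<beta> a) < r"
    using endo_small[OF assms(2) r_pos] by blast
  have "\<beta> \<one> = \<one>" by (rule hom_one)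
  then have "loc \<beta> 0 = 0" by (simp only: loc_def \<psi>_zero \<phi>_one)
  then have "((\<lambda>a. loc \<alpha> (loc \<beta> a)) has_derivative (\<lambda>h. diff \<alpha> (diff \<beta> h))) (at 0)"
    by (intro has_derivative_compose[OF diff_works[OF assms(2)]]) (simp add: diff_works assms)
  then have "(loc \<gamma> has_derivative (\<lambda>h. diff \<alpha> (diff \<beta> h))) (at 0)"
  proof (rule has_derivative_transform_within[OF _ \<delta>(1)])
    fix a :: 'e assume "dist a 0 < \<delta>"
    then have "norm a < \<delta>" by simp
    then show "loc \<alpha> (loc \<beta> a) = loc \<gamma> a"
      using \<delta> assms(4) by (simp add: loc_def \<psi>\<phi>)
  qed simp
  then show "(loc \<gamma> has_derivative diff \<alpha> \<circ> diff \<beta>) (at 0)" by (simp add: o_def)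
qed

lemma endo_identity: "(\<And>x. x \<in> carrier G \<Longrightarrow> \<alpha> x = x) \<Longrightarrow> endo \<alpha>"
  unfolding endo_def by (auto simp: hom_def top intro: continuous_map_eq[of X X "\<lambda>x. x"] )

lemma diff_identity:
  assumes "\<And>x. x \<in> carrier G \<Longrightarrow> \<alpha> x = x"
  shows "diff \<alpha> = (\<lambda>x. x)"
proof (rule diff_unique[OF endo_identity[OF assms]])
  show "(loc \<alpha> has_derivative (\<lambda>x. x)) (at 0)"
    by (rule has_derivative_transform_within[OF has_derivative_ident r_pos])
       (simp_all add: loc_def assms \<psi>)
qed

text \<open>The fixed points form a subgroup. It is closed because X is Hausdorff, and open because
  \<open>local_hom_identity\<close> puts a neighbourhood of the identity into it; connectedness does
  the rest.\<close>

lemma endo_eq_identity: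
  assumes \<alpha>: "endo \<alpha>" and d: "diff \<alpha> = (\<lambda>x. x)" and x: "x \<in> carrier G"
  shows "\<alpha> x = x"
proof -
  interpret group_hom G G \<alpha> using \<alpha> by (rule endo_hom)
  obtain \<delta> where \<delta>: "local_hom (loc \<alpha>) \<delta>" "\<And>a. norm a < \<delta> \<Longrightarrow> \<alpha> (\<psi> a) \<in> U"
    using local_hom_loc[OF \<alpha>] by blast
  obtain t where t: "t > 0" "\<And>a. norm a \<le> t \<Longrightarrow> loc \<alpha> a = a"
    using local_hom_identity[OF \<delta>(1)] diff_works[OF \<alpha>] d by metis
  define \<epsilon> where "\<epsilon> = min t \<delta>"
  have e: "\<epsilon> > 0" "\<delta> \<le> r" using t \<delta>(1) by (auto simp: \<epsilon>_def local_hom_def)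
  have fixed: "\<alpha> y = y" if "y \<in> nbhd \<epsilon>" for y
  proof -
    have y: "y \<in> U" "norm (\<phi> y) < t" "norm (\<phi> y) < \<delta>" using that by (auto simp: nbhd_def \<epsilon>_def)
    then have "\<phi> (\<alpha> y) = \<phi> y" "\<alpha> y \<in> U"
      using t(2)[of "\<phi> y"] \<delta>(2)[of "\<phi> y"] by (simp_all add: loc_def \<psi>\<phi>)
    then show ?thesis using \<psi>\<phi> y(1) by metis
  qed
  let ?H = "{y \<in> topspace X. \<alpha> y = y}"
  have "closedin X ?H"
    using \<alpha> by (intro closedin_continuous_maps_eq[OF hausdorff]) (auto simp: endo_def)
  moreover have "openin X ?H"
  proof (subst openin_subopen, clarify)
    fix y assume y: "y \<in> topspace X" "\<alpha> y = y"
    let ?T = "{z \<in> carrier G. inv y \<otimes> z \<in> nbhd \<epsilon>}"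
    have "openin X ?T" by (rule translation_open) (use y openin_nbhd top in auto)
    moreover have "y \<in> ?T" using y top one_nbhd[OF e(1)] by simp
    moreover have "?T \<subseteq> ?H"
    proof clarify
      fix z assume z: "z \<in> carrier G" "inv y \<otimes> z \<in> nbhd \<epsilon>"
      have yG: "y \<in> carrier G" using y top by simp
      have "inv y \<otimes> \<alpha> z = inv y \<otimes> z" using fixed[OF z(2)] z(1) yG y(2) by simp
      then show "z \<in> topspace X \<and> \<alpha> z = z" using z(1) yG top by simp
    qed
    ultimately show "\<exists>T. openin X T \<and> y \<in> T \<and> T \<subseteq> ?H" by blast
  qed
  ultimately have "?H = {} \<or> ?H = topspace X" using connected connected_space_clopen_in by blast
  moreover have "\<one> \<in> ?H" by (simp add: top)
  ultimately show ?thesis using x top by blast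
qed

text \<open>\<open>Aut\<close> asks only the map itself to be continuous, so inverses need an
  argument. In the chart \<alpha> is continuous and injective between spaces of equal dimension,
  hence open by invariance of domain; translations spread this over the group.\<close>

lemma continuous_inverse:
  assumes \<alpha>: "endo \<alpha>" and bij: "bij_betw \<alpha> (carrier G) (carrier G)"
    and \<beta>: "\<And>x. x \<in> carrier G \<Longrightarrow> \<beta> x \<in> carrier G" "\<And>x. x \<in> carrier G \<Longrightarrow> \<beta> (\<alpha> x) = x"
      "\<And>x. x \<in> carrier G \<Longrightarrow> \<alpha> (\<beta> x) = x"
  shows "continuous_map X X \<beta>"
  unfolding continuous_map_alt
proof (intro conjI allI impI)
  interpret group_hom G G \<alpha> using \<alpha> by (rule endo_hom)
  show "\<beta> \<in> topspace X \<rightarrow> topspace X" using \<beta>(1) top by auto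
  fix V assume V: "openin X V"
  obtain \<delta> where \<delta>: "local_hom (loc \<alpha>) \<delta>" "\<And>a. norm a < \<delta> \<Longrightarrow> \<alpha> (\<psi> a) \<in> U"
    using local_hom_loc[OF \<alpha>] by blast
  have \<delta>r: "\<delta> > 0" "\<delta> \<le> r" using \<delta>(1) by (auto simp: local_hom_def)
  have "continuous_map (top_of_set (ball 0 \<delta>)) X \<psi>"
    using \<psi>_cont \<delta>r continuous_map_from_subtopology_mono[of euclidean "ball 0 r" X \<psi> "ball 0 \<delta>"]
      subset_ball[OF \<delta>r(2)] by blast
  then have "continuous_map (top_of_set (ball 0 \<delta>)) X (\<alpha> \<circ> \<psi>)"
    using \<alpha> by (intro continuous_map_compose) (auto simp: endo_def)
  then have "continuous_map (top_of_set (ball 0 \<delta>)) (subtopology X U) (\<alpha> \<circ> \<psi>)"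
    using \<delta>(2) by (auto simp: continuous_map_in_subtopology)
  from continuous_map_compose[OF this \<phi>_cont]
  have cont: "continuous_on (ball 0 \<delta>) (loc \<alpha>)"
    by (simp add: o_def loc_def[abs_def] continuous_map_iff_continuous)
  have inj: "inj_on (loc \<alpha>) (ball 0 \<delta>)"
  proof (rule inj_onI)
    fix a b assume ab: "a \<in> ball 0 \<delta>" "b \<in> ball 0 \<delta>" "loc \<alpha> a = loc \<alpha> b"
    then have "\<alpha> (\<psi> a) = \<alpha> (\<psi> b)" using \<delta>(2) \<psi>\<phi> unfolding loc_def by (metis mem_ball_0)
    then have "\<psi> a = \<psi> b" using bij ab \<delta>r by (auto simp: bij_betw_def inj_on_def)
    then show "a = b" using \<psi>(2) ab \<delta>r by (metis mem_ball_0 order_less_le_trans)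
  qed
  show "openin X (\<beta> -` V \<inter> topspace X)"
  proof (subst openin_subopen, clarify)
    fix y assume y: "y \<in> topspace X" "\<beta> y \<in> V"
    then have yG: "y \<in> carrier G" "\<beta> y \<in> carrier G" using top \<beta>(1) by auto
    have "openin X {z \<in> carrier G. inv (inv (\<beta> y)) \<otimes> z \<in> V}"
      by (rule translation_open) (use V yG in auto)
    moreover have "\<one> \<in> {z \<in> carrier G. inv (inv (\<beta> y)) \<otimes> z \<in> V}" using y yG by simp
    ultimately obtain \<delta>' where \<delta>': "\<delta>' > 0" "\<And>a. norm a < \<delta>' \<Longrightarrow> \<psi> a \<in> {z \<in> carrier G. inv (inv (\<beta> y)) \<otimes> z \<in> V}"
      using chart_small by metis
    define \<eta> where "\<eta> = min \<delta> \<delta>'"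
    have \<eta>: "\<eta> > 0" using \<delta>r \<delta>' by (simp add: \<eta>_def)
    have "open (loc \<alpha> ` ball 0 \<eta>)"
      by (rule invariance_of_domain)
         (use cont inj continuous_on_subset inj_on_subset in \<open>auto simp: \<eta>_def intro!: continuous_on_subset[OF cont] inj_on_subset[OF inj]\<close>)
    moreover have "0 \<in> loc \<alpha> ` ball 0 \<eta>"
      using \<eta> \<delta>(1) by (intro image_eqI[of _ _ 0]) (auto simp: local_hom_def)
    ultimately obtain \<epsilon> where \<epsilon>: "\<epsilon> > 0" "ball 0 \<epsilon> \<subseteq> loc \<alpha> ` ball 0 \<eta>" using openE by blast
    let ?T = "{z \<in> carrier G. inv y \<otimes> z \<in> nbhd \<epsilon>}"
    have "openin X ?T" by (rule translation_open) (use yG openin_nbhd in auto)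
    moreover have "y \<in> ?T" using yG one_nbhd[OF \<epsilon>(1)] by simp
    moreover have "?T \<subseteq> \<beta> -` V \<inter> topspace X"
    proof clarify
      fix z assume z: "z \<in> carrier G" "inv y \<otimes> z \<in> nbhd \<epsilon>"
      then have zU: "inv y \<otimes> z \<in> U" "\<phi> (inv y \<otimes> z) \<in> ball 0 \<epsilon>" by (auto simp: nbhd_def)
      then obtain a where a: "a \<in> ball 0 \<eta>" "\<phi> (inv y \<otimes> z) = \<phi> (\<alpha> (\<psi> a))"
        using \<epsilon>(2) unfolding loc_def by blast
      have a': "norm a < \<delta>" "norm a < \<delta>'" using a(1) by (auto simp: \<eta>_def)
      then have aG: "\<psi> a \<in> carrier G" using \<delta>r by simp
      have "inv y \<otimes> z = \<alpha> (\<psi> a)" using a(2) zU(1) \<delta>(2)[OF a'(1)] \<psi>\<phi> by metis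
      then have "z = y \<otimes> \<alpha> (\<psi> a)" using z(1) yG aG by (metis inv_solve_left hom_closed m_closed inv_closed)
      also have "\<dots> = \<alpha> (\<beta> y \<otimes> \<psi> a)" using yG aG \<beta>(3) by simp
      finally have "\<beta> z = \<beta> y \<otimes> \<psi> a" using \<beta>(2)[OF m_closed[OF yG(2) aG]] by (simp only:)
      then show "z \<in> \<beta> -` V \<inter> topspace X" using \<delta>'(2)[OF a'(2)] yG z top by simp
    qed
    ultimately show "\<exists>T. openin X T \<and> y \<in> T \<and> T \<subseteq> \<beta> -` V \<inter> topspace X" by blast
  qed
qed

definition conj :: "'g \<Rightarrow> 'g \<Rightarrow> 'g" where
  "conj g = (\<lambda>x\<in>carrier G. g \<otimes> x \<otimes> inv g)"

lemma endo_conj: assumes "g \<in> carrier G" shows "endo (conj g)"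
proof -
  have "continuous_map X (prod_topology X X) (\<lambda>y. (g, y))"
    using assms top by (intro continuous_map_pairedI continuous_map_const[THEN iffD2]) auto
  from continuous_map_compose[OF this mult_cont] have "continuous_map X X (\<lambda>y. g \<otimes> y)"
    by (simp add: o_def)
  then have "continuous_map X (prod_topology X X) (\<lambda>y. (g \<otimes> y, inv g))"
    using assms top by (intro continuous_map_pairedI continuous_map_const[THEN iffD2]) auto
  from continuous_map_compose[OF this mult_cont] have "continuous_map X X (\<lambda>y. g \<otimes> y \<otimes> inv g)"
    by (simp add: o_def)
  then have "continuous_map X X (conj g)"
    by (rule continuous_map_eq) (simp add: conj_def top)
  moreover have "conj g \<in> hom G G"
  proof (rule homI)
    fix x y assume xy: "x \<in> carrier G" "y \<in> carrier G"
    have "g \<otimes> (x \<otimes> y) \<otimes> inv g = (g \<otimes> x \<otimes> inv g) \<otimes> (g \<otimes> y \<otimes> inv g)"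
    proof -
      have "(g \<otimes> x \<otimes> inv g) \<otimes> (g \<otimes> y \<otimes> inv g) = g \<otimes> x \<otimes> (inv g \<otimes> (g \<otimes> (y \<otimes> inv g)))"
        using assms xy by (simp add: m_assoc)
      also have "inv g \<otimes> (g \<otimes> (y \<otimes> inv g)) = y \<otimes> inv g" using assms xy by (simp flip: m_assoc)
      finally show ?thesis using assms xy by (simp add: m_assoc)
    qed
    then show "conj g (x \<otimes> y) = conj g x \<otimes> conj g y" using assms xy by (simp add: conj_def)
  qed (use assms in \<open>simp add: conj_def\<close>)
  ultimately show ?thesis by (simp add: endo_def)
qed

lemma diff_conj_bound:
  assumes a: "norm a < r"
  shows "norm (diff (conj (\<psi> a)) h - h) \<le> 3 * K * norm a * norm h"
proof -
  have e: "endo (conj (\<psi> a))" using endo_conj a by simp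
  obtain \<delta> where \<delta>: "\<delta> > 0" "\<delta> \<le> r" "\<And>b. norm b < \<delta> \<Longrightarrow> conj (\<psi> a) (\<psi> b) \<in> U \<and> norm (loc (conj (\<psi> a)) b) < r"
    using endo_small[OF e r_pos] by blast
  show ?thesis
  proof (rule conjugation_derivative_bound[OF a \<delta>(1,2) _ _ diff_works[OF e]])
    fix b :: 'e assume b: "norm b < \<delta>"
    have G: "\<psi> a \<in> carrier G" "\<psi> b \<in> carrier G" using a b \<delta> by auto
    have "\<psi> (loc (conj (\<psi> a)) b) = \<psi> a \<otimes> \<psi> b \<otimes> inv \<psi> a"
      using \<delta>(3)[OF b] G by (simp add: loc_def \<psi>\<phi> conj_def)
    then have "\<psi> (loc (conj (\<psi> a)) b) \<otimes> \<psi> a = \<psi> a \<otimes> \<psi> b" using G by (simp add: m_assoc)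
    then show "norm (loc (conj (\<psi> a)) b) < r \<and> m (loc (conj (\<psi> a)) b) a = m a b"
      using \<delta>(3)[OF b] by (simp add: m_def)
  next
    show "loc (conj (\<psi> a)) 0 = 0" using a by (simp add: loc_def conj_def \<phi>_one)
  qed
qed

end

section \<open>Subgroups of finite index, and continuous maps with finite image\<close>

lemma (in group) pointwise_stabilizer_finite_index:
  assumes fin: "finite S"
    and act: "\<And>a s. a \<in> carrier G \<Longrightarrow> s \<in> S \<Longrightarrow> act a s \<in> S"
    and act_mult: "\<And>a b s. a \<in> carrier G \<Longrightarrow> b \<in> carrier G \<Longrightarrow> s \<in> S \<Longrightarrow> act (a \<otimes> b) s = act a (act b s)"
    and act_one: "\<And>s. s \<in> S \<Longrightarrow> act \<one> s = s"
  defines "L \<equiv> {a \<in> carrier G. \<forall>s\<in>S. act a s = s}"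
  shows "subgroup L G" "finite (rcosets L)"
proof -
  show L: "subgroup L G"
  proof
    show "inv a \<in> L" if a: "a \<in> L" for a
    proof -
      have "act (inv a) s = s" if s: "s \<in> S" for s
      proof -
        have "act (inv a) s = act (inv a) (act a s)" using a s by (simp add: L_def)
        also have "\<dots> = s" using act_mult[of "inv a" a s] act_one[OF s] s a unfolding L_def by simp
        finally show ?thesis .
      qed
      then show ?thesis using a by (simp add: L_def)
    qed
  qed (auto simp: L_def act_mult act_one)
  \<comment> \<open>The right cosets of a and b agree when a b^-1 fixes S pointwise, that is, when
    the inverses of a and b act alike.\<close>
  define F where "F a = restrict (act (inv a)) S" for a
  have "F ` carrier G \<subseteq> S \<rightarrow>\<^sub>E S" using act by (auto simp: F_def)
  then have finF: "finite (F ` carrier G)"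
    by (rule finite_subset) (use fin in \<open>simp add: finite_PiE\<close>)
  have eq: "L #> a = L #> b" if ab: "a \<in> carrier G" "b \<in> carrier G" "F a = F b" for a b
  proof -
    have "act (a \<otimes> inv b) s = s" if s: "s \<in> S" for s
    proof -
      have "act (inv b) s = act (inv a) s" using ab(3) s unfolding F_def by (metis restrict_apply')
      then have "act (a \<otimes> inv b) s = act a (act (inv a) s)" using ab s by (simp add: act_mult)
      also have "\<dots> = s" using ab s by (simp add: act_one flip: act_mult)
      finally show ?thesis .
    qed
    then have "a \<otimes> inv b \<in> L" using ab by (simp add: L_def)
    moreover have "a = (a \<otimes> inv b) \<otimes> b" using ab by (simp add: m_assoc)
    ultimately have "a \<in> L #> b" unfolding r_coset_def by blast
    then show ?thesis using repr_independence[OF _ ab(2) L] by simp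
  qed
  have "rcosets L \<subseteq> (\<lambda>f. L #> (SOME a. a \<in> carrier G \<and> F a = f)) ` (F ` carrier G)"
  proof
    fix c assume "c \<in> rcosets L"
    then obtain a where a: "a \<in> carrier G" "c = L #> a" unfolding RCOSETS_def by blast
    let ?b = "SOME b. b \<in> carrier G \<and> F b = F a"
    have "?b \<in> carrier G \<and> F ?b = F a" by (rule someI[of _ a]) (use a in simp)
    then have "c = L #> ?b" using eq a by metis
    then show "c \<in> (\<lambda>f. L #> (SOME a. a \<in> carrier G \<and> F a = f)) ` (F ` carrier G)" using a by blast
  qed
  then show "finite (rcosets L)" using finF finite_subset by blast
qed

text \<open>\<open>L\<close> may fail to be normal, so the order in a quotient group is replaced by
  pigeonhole: among the cosets L a^i two agree, and a^d lies in \<open>L\<close> for some d between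
  1 and the index. The factorial of the index is a multiple of every such d.\<close>

lemma (in group) finite_index_power:
  assumes L: "subgroup L G" and fin: "finite (rcosets L)"
  shows "\<exists>n::nat. n \<ge> 1 \<and> (\<forall>a\<in>carrier G. a [^] n \<in> L)"
proof (intro exI conjI ballI)
  let ?N = "card (rcosets L)"
  show "1 \<le> (fact ?N :: nat)" by (simp add: fact_ge_1)
  fix a assume a: "a \<in> carrier G"
  have "(\<lambda>i::nat. L #> a [^] i) ` {0..?N} \<subseteq> rcosets L"
    using a unfolding RCOSETS_def by auto
  then have "card ((\<lambda>i::nat. L #> a [^] i) ` {0..?N}) \<le> ?N" using fin card_mono by blast
  then have "\<not> inj_on (\<lambda>i::nat. L #> a [^] i) {0..?N}" using card_image by fastforce
  then obtain i j :: nat where ij: "i < j" "j \<le> ?N" "L #> a [^] i = L #> a [^] j"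
    unfolding inj_on_def by (metis atLeastAtMost_iff linorder_neqE_nat)
  have "a [^] j \<in> L #> a [^] i" using ij(3) rcos_self[OF _ L, of "a [^] j"] a by simp
  then obtain h where h: "h \<in> L" "a [^] j = h \<otimes> a [^] i" unfolding r_coset_def by blast
  have hG: "h \<in> carrier G" by (rule subgroup.mem_carrier[OF L h(1)])
  have "a [^] (j - i) \<otimes> a [^] i = h \<otimes> a [^] i" using ij(1) a h(2) by (simp add: nat_pow_mult)
  then have k: "a [^] (j - i) \<in> L" using a hG h(1) by simp
  have "(j - i) dvd (fact ?N :: nat)" using ij by (intro dvd_fact) auto
  then obtain q where "(fact ?N :: nat) = (j - i) * q" by blast
  then have "a [^] (fact ?N :: nat) = (a [^] (j - i)) [^] q" using a by (simp add: nat_pow_pow)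
  moreover have "(a [^] (j - i)) [^] q \<in> L"
    by (induction q) (simp_all add: k subgroup.one_closed[OF L] subgroup.m_closed[OF L])
  ultimately show "a [^] (fact ?N :: nat) \<in> L" by simp
qed

lemma connected_finite_image_constant:
  assumes X: "connected_space X" and Y: "Hausdorff_space Y" and f: "continuous_map X Y f"
    and fin: "finite (f ` topspace X)" and xy: "x \<in> topspace X" "y \<in> topspace X"
  shows "f x = f y"
proof -
  let ?F = "{z \<in> topspace X. f z \<in> {f x}}" and ?C = "{z \<in> topspace X. f z \<in> f ` topspace X - {f x}}"
  have im: "f ` topspace X \<subseteq> topspace Y" using f continuous_map_image_subset_topspace by blast
  have cl: "closedin Y S" if "S \<subseteq> f ` topspace X" for S
    using closedin_Hausdorff_finite[OF Y _ finite_subset[OF that fin]] that im by blast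
  have "closedin X ?F" "closedin X ?C"
    by (rule closedin_continuous_map_preimage[OF f cl]; use xy in blast)+
  moreover have "topspace X - ?C = ?F" by auto
  ultimately have "closedin X ?F" "openin X ?F" using openin_diff[OF openin_topspace, of X ?C] by simp_all
  then have "?F = {} \<or> ?F = topspace X" using X connected_space_clopen_in by blast
  moreover have "x \<in> ?F" using xy by simp
  ultimately have "y \<in> ?F" using xy(2) by blast
  then show ?thesis by simp
qed

text \<open>A finite type indexing the basis, so that linear maps of the tangent space become square
  complex matrices, to which the linear algebra above applies.\<close>

typedef (overloaded) 'e basis_index = "Basis :: 'e::euclidean_space set"
  using nonempty_Basis by blast

instance basis_index :: (euclidean_space) finite
proof
  have "UNIV = Abs_basis_index ` (Basis :: 'a set)"
    using type_definition.univ[OF type_definition_basis_index] .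
  then show "finite (UNIV :: 'a basis_index set)" by (metis finite_Basis finite_imageI)
qed

lemma bij_Rep_basis_index: "bij_betw Rep_basis_index UNIV (Basis :: 'e::euclidean_space set)"
  by (metis Rep_basis_index_inject bij_betw_def inj_onI type_definition.Rep_range type_definition_basis_index)

lemma Rep_basis_index_Basis [simp]: "Rep_basis_index i \<in> Basis"
  using Rep_basis_index .

definition to_mat :: "('e \<Rightarrow> 'e) \<Rightarrow> complex^('e::euclidean_space basis_index)^('e basis_index)" where
  "to_mat L = (\<chi> i j. of_real (L (Rep_basis_index j) \<bullet> Rep_basis_index i))"

lemma to_mat_compose:
  assumes "linear L"
  shows "to_mat (L \<circ> M) = to_mat L ** to_mat M"
proof -
  have "L (M a) \<bullet> b = (\<Sum>k\<in>UNIV. (L (Rep_basis_index k) \<bullet> b) * (M a \<bullet> Rep_basis_index k))" for a b :: 'a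
  proof -
    have "L (M a) = L (\<Sum>c\<in>Basis. (M a \<bullet> c) *\<^sub>R c)" by (simp add: euclidean_representation)
    also have "\<dots> = (\<Sum>c\<in>Basis. (M a \<bullet> c) *\<^sub>R L c)" by (simp add: linear_sum[OF assms] linear_scale[OF assms])
    finally have "L (M a) \<bullet> b = (\<Sum>c\<in>Basis. (L c \<bullet> b) * (M a \<bullet> c))"
      by (simp add: inner_sum_left mult.commute)
    then show ?thesis by (simp add: sum.reindex_bij_betw[OF bij_Rep_basis_index, of "\<lambda>c. (L c \<bullet> b) * (M a \<bullet> c)"])
  qed
  then show ?thesis by (simp add: to_mat_def matrix_matrix_mult_def vec_eq_iff)
qed

lemma to_mat_identity: "to_mat (\<lambda>x. x) = mat 1"
  by (simp add: to_mat_def mat_def vec_eq_iff inner_Basis Rep_basis_index_inject)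

lemma to_mat_eq_one:
  assumes "linear L" "to_mat L = mat 1"
  shows "L = (\<lambda>x. x)"
proof (rule linear_eq_stdbasis[OF assms(1) linear_ident])
  fix b :: 'a assume b: "b \<in> Basis"
  have "L b \<bullet> c = b \<bullet> c" if c: "c \<in> Basis" for c
  proof -
    obtain i j where ij: "Rep_basis_index i = b" "Rep_basis_index j = c"
      using b c Abs_basis_index_inverse by metis
    have "to_mat L $ j $ i = mat 1 $ j $ i" using assms(2) by simp
    then have "complex_of_real (L b \<bullet> c) = (if j = i then 1 else 0)"
      using ij by (simp add: to_mat_def mat_def)
    also have "\<dots> = complex_of_real (b \<bullet> c)" using b c ij by (auto simp: inner_Basis Rep_basis_index_inject)
    finally show ?thesis by simp
  qed
  then show "L b = b" by (rule euclidean_eqI)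
qed

lemma norm_vec_le_sum: "norm (v :: 'b::real_normed_vector ^ 'n) \<le> (\<Sum>i\<in>UNIV. norm (v $ i))"
  unfolding norm_vec_def by (rule L2_set_le_sum) simp

lemma norm_matrix_le: "norm (A :: complex^'n^'n) \<le> (\<Sum>i\<in>UNIV. \<Sum>j\<in>UNIV. norm (A $ i $ j))"
  by (rule order_trans[OF norm_vec_le_sum sum_mono[OF norm_vec_le_sum]])

lemma norm_to_mat_diff_one:
  fixes L :: "'e::euclidean_space \<Rightarrow> 'e"
  assumes "\<And>h. norm (L h - h) \<le> c * norm h"
  shows "norm (to_mat L - mat 1) \<le> (real CARD('e basis_index))\<^sup>2 * c"
proof -
  have "norm ((to_mat L - mat 1) $ i $ j) \<le> c" for i j
  proof -
    have "to_mat L - mat 1 = to_mat L - to_mat (\<lambda>x. x)" by (simp add: to_mat_identity)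
    then have "(to_mat L - mat 1) $ i $ j
      = of_real ((L (Rep_basis_index j) - Rep_basis_index j) \<bullet> Rep_basis_index i)"
      by (simp add: to_mat_def inner_diff_left)
    then have "norm ((to_mat L - mat 1) $ i $ j) \<le> norm (L (Rep_basis_index j) - Rep_basis_index j)"
      by (simp add: Basis_le_norm)
    also have "\<dots> \<le> c" using assms[of "Rep_basis_index j"] by simp
    finally show ?thesis .
  qed
  then have "(\<Sum>i\<in>UNIV. \<Sum>j\<in>UNIV. norm ((to_mat L - mat 1) $ i $ j))
    \<le> (\<Sum>i\<in>(UNIV::'e basis_index set). \<Sum>j\<in>(UNIV::'e basis_index set). c)"
    by (intro sum_mono)
  then show ?thesis using norm_matrix_le[of "to_mat L - mat 1"] by (simp add: power2_eq_square mult.assoc)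
qed

section \<open>The adjoint representation and its continuity\<close>

context chart_group
begin

definition "ad g = to_mat (diff (conj g))"

lemma compose_endo:
  assumes "endo \<alpha>" "endo \<beta>" shows "endo (\<lambda>x. \<alpha> (\<beta> x))"
  using assms continuous_map_compose[of X X \<beta> X \<alpha>] unfolding endo_def hom_def by (simp add: o_def Pi_iff)

lemma to_mat_diff_mult:
  assumes "endo \<alpha>" "endo \<beta>" "endo \<gamma>" "\<And>x. x \<in> carrier G \<Longrightarrow> \<gamma> x = \<alpha> (\<beta> x)"
  shows "to_mat (diff \<gamma>) = to_mat (diff \<alpha>) ** to_mat (diff \<beta>)"
  using diff_compose[OF assms] to_mat_compose[OF linear_diff[OF assms(1)]] by simp

lemma ad_mult: "g \<in> carrier G \<Longrightarrow> h \<in> carrier G \<Longrightarrow> ad (g \<otimes> h) = ad g ** ad h"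
  unfolding ad_def
  by (rule to_mat_diff_mult[OF endo_conj endo_conj endo_conj]) (simp_all add: conj_def inv_mult_group m_assoc)

lemma ad_one: "ad \<one> = mat 1"
  unfolding ad_def by (subst diff_identity) (simp_all add: conj_def to_mat_identity)

lemma ad_inv: "g \<in> carrier G \<Longrightarrow> ad g ** ad (inv g) = mat 1" "g \<in> carrier G \<Longrightarrow> ad (inv g) ** ad g = mat 1"
  by (simp_all add: ad_one flip: ad_mult)

lemma ad_eq_one_central:
  assumes "g \<in> carrier G" "ad g = mat 1" "x \<in> carrier G"
  shows "g \<otimes> x = x \<otimes> g"
proof -
  have "diff (conj g) = (\<lambda>x. x)"
    using to_mat_eq_one linear_diff endo_conj assms unfolding ad_def by blast
  then have "conj g x = x" by (rule endo_eq_identity[OF endo_conj[OF assms(1)] _ assms(3)])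
  then have "g \<otimes> x \<otimes> inv g = x" using assms by (simp add: conj_def)
  then show ?thesis using assms by (metis inv_closed inv_solve_right m_closed)
qed

text \<open>Both sides are the derivative of x -> \<alpha>(g x g^-1) = \<alpha>(g) \<alpha>(x)
  \<alpha>(g)^-1.\<close>

lemma ad_equivariant:
  assumes "endo \<alpha>" "g \<in> carrier G"
  shows "to_mat (diff \<alpha>) ** ad g = ad (\<alpha> g) ** to_mat (diff \<alpha>)"
proof -
  interpret h: group_hom G G \<alpha> using assms(1) by (rule endo_hom)
  have ag: "\<alpha> g \<in> carrier G" using assms endo_closed by blast
  have e: "endo (\<lambda>x. \<alpha> (conj g x))" by (rule compose_endo[OF assms(1) endo_conj[OF assms(2)]])
  have "to_mat (diff (\<lambda>x. \<alpha> (conj g x))) = to_mat (diff \<alpha>) ** ad g"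
    unfolding ad_def by (rule to_mat_diff_mult[OF assms(1) endo_conj[OF assms(2)] e]) simp
  moreover have "to_mat (diff (\<lambda>x. \<alpha> (conj g x))) = ad (\<alpha> g) ** to_mat (diff \<alpha>)"
    unfolding ad_def by (rule to_mat_diff_mult[OF endo_conj[OF ag] assms(1) e]) (use assms(2) in \<open>simp add: conj_def\<close>)
  ultimately show ?thesis by simp
qed

text \<open>By multiplicativity everything reduces to the identity, where
  \<open>diff_conj_bound\<close> gives |Ad(\<psi> a) - 1| = O(|a|).\<close>

lemma continuous_ad: "continuous_map X euclidean ad"
  unfolding continuous_map_alt
proof (intro conjI allI impI)
  fix V :: "(complex^'e basis_index^'e basis_index) set" assume V: "openin euclidean V"
  show "openin X (ad -` V \<inter> topspace X)"
  proof (subst openin_subopen, clarify)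
    fix g assume g: "g \<in> topspace X" "ad g \<in> V"
    then have gG: "g \<in> carrier G" using top by simp
    have "continuous_on UNIV (\<lambda>M :: complex^'e basis_index^'e basis_index. ad g ** M)"
      by (intro linear_continuous_on_compose[OF continuous_on_id] linearI)
         (simp_all add: matrix_add_ldistrib matrix_scalar_ac scalar_matrix_assoc)
    then have "open ((\<lambda>M. ad g ** M) -` V)" using V by (simp add: open_vimage)
    moreover have "mat 1 \<in> (\<lambda>M. ad g ** M) -` V" using g by simp
    ultimately obtain \<epsilon> where \<epsilon>: "\<epsilon> > 0" "ball (mat 1) \<epsilon> \<subseteq> (\<lambda>M. ad g ** M) -` V" using openE by blast
    define n where "n = (real CARD('e basis_index))\<^sup>2"
    have n: "n \<ge> 0" by (simp add: n_def)
    \<comment> \<open>The 1 in the denominator covers K = 0.\<close>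
    define \<delta> where "\<delta> = min r (\<epsilon> / (n * (3 * K) + 1))"
    have nK: "n * (3 * K) \<ge> 0" using n K_nonneg by simp
    have pos: "n * (3 * K) + 1 > 0" using nK by linarith
    have \<delta>: "\<delta> > 0" "\<delta> \<le> r" using r_pos divide_pos_pos[OF \<epsilon>(1) pos] by (simp_all add: \<delta>_def)
    let ?T = "{y \<in> carrier G. inv g \<otimes> y \<in> nbhd \<delta>}"
    have "openin X ?T" by (rule translation_open[OF openin_nbhd gG])
    moreover have "g \<in> ?T" using gG one_nbhd[OF \<delta>(1)] by simp
    moreover have "?T \<subseteq> ad -` V \<inter> topspace X"
    proof clarify
      fix y assume y: "y \<in> carrier G" "inv g \<otimes> y \<in> nbhd \<delta>"
      define a where "a = \<phi> (inv g \<otimes> y)"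
      have a: "norm a < \<delta>" "\<psi> a = inv g \<otimes> y" using y(2) by (auto simp: nbhd_def a_def \<psi>\<phi>)
      have "norm (ad (\<psi> a) - mat 1) \<le> n * (3 * K * norm a)"
        unfolding ad_def n_def by (rule norm_to_mat_diff_one) (rule diff_conj_bound, use a \<delta> in simp)
      also have "\<dots> \<le> n * (3 * K) * \<delta>" using a(1) n K_nonneg by (simp add: mult_left_mono mult.assoc)
      also have "\<dots> \<le> n * (3 * K) * (\<epsilon> / (n * (3 * K) + 1))"
        using nK by (intro mult_left_mono) (simp_all add: \<delta>_def)
      also have "\<dots> < \<epsilon>" using pos \<epsilon>(1) by (simp add: divide_less_eq distrib_left)
      finally have "ad (\<psi> a) \<in> ball (mat 1) \<epsilon>" by (simp add: dist_norm norm_minus_commute)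
      then have "ad g ** ad (inv g \<otimes> y) \<in> V" using \<epsilon>(2) a(2) by auto
      then show "y \<in> ad -` V \<inter> topspace X"
        using y(1) gG by (simp add: top ad_mult[symmetric] m_assoc[symmetric])
    qed
    ultimately show "\<exists>T. openin X T \<and> g \<in> T \<and> T \<subseteq> ad -` V \<inter> topspace X" by blast
  qed
qed simp

end

section \<open>Twisted conjugacy classes\<close>

lemma (in twisted_monoid) mat_prod_long_zero:
  assumes k: "\<And>xs. set xs \<subseteq> I \<Longrightarrow> length xs = k \<Longrightarrow> mat_prod xs = 0"
    and xs: "set xs \<subseteq> I" "length xs \<ge> k"
  shows "mat_prod xs = 0"
proof -
  have "mat_prod (take k xs) = 0" using xs set_take_subset[of k xs] by (intro k) auto
  then have "mat_prod (take k xs @ drop k xs) = 0" by (simp only: mat_prod_append times0_left)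
  then show ?thesis by simp
qed

text \<open>Matrices that behave like products of \<open>i\<close> elements of the augmentation ideal, when all
  products of \<open>k\<close> elements vanish.\<close>
definition (in twisted_monoid) ideal_degree :: "nat \<Rightarrow> nat \<Rightarrow> (complex^'n^'n) set" where
  "ideal_degree k i = {x. \<forall>as bs. set as \<subseteq> I \<longrightarrow> set bs \<subseteq> I \<longrightarrow> k \<le> length as + length bs + i \<longrightarrow>
      mat_prod as ** x ** mat_prod bs = 0}"

context twisted_monoid
begin

lemma ideal_degreeD:
  "x \<in> ideal_degree k i \<Longrightarrow> set as \<subseteq> I \<Longrightarrow> set bs \<subseteq> I \<Longrightarrow> k \<le> length as + length bs + i \<Longrightarrow>
    mat_prod as ** x ** mat_prod bs = 0"
  by (simp add: ideal_degree_def)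

lemma ideal_degree_add: "x \<in> ideal_degree k i \<Longrightarrow> y \<in> ideal_degree k i \<Longrightarrow> x + y \<in> ideal_degree k i"
  by (simp add: ideal_degree_def matrix_add_ldistrib matrix_add_rdistrib)

lemma ideal_degree_diff: "x \<in> ideal_degree k i \<Longrightarrow> y \<in> ideal_degree k i \<Longrightarrow> x - y \<in> ideal_degree k i"
  by (simp add: ideal_degree_def matrix_diff_ldistrib matrix_diff_rdistrib)

lemma ideal_degree_zero: "0 \<in> ideal_degree k i"
  by (simp add: ideal_degree_def)

lemma ideal_degree_mult_I:
  assumes x: "x \<in> ideal_degree k i" and y: "y \<in> I"
  shows "x ** y \<in> ideal_degree k (Suc i)" "y ** x \<in> ideal_degree k (Suc i)"
proof -
  have "mat_prod as ** (x ** y) ** mat_prod bs = 0" "mat_prod as ** (y ** x) ** mat_prod bs = 0"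
    if ab: "set as \<subseteq> I" "set bs \<subseteq> I" "k \<le> length as + length bs + Suc i" for as bs
  proof -
    have "mat_prod as ** x ** mat_prod (y # bs) = 0" by (rule ideal_degreeD[OF x]) (use ab y in auto)
    then show "mat_prod as ** (x ** y) ** mat_prod bs = 0" by (simp add: matrix_mul_assoc)
    have "mat_prod (as @ [y]) ** x ** mat_prod bs = 0" by (rule ideal_degreeD[OF x]) (use ab y in auto)
    then show "mat_prod as ** (y ** x) ** mat_prod bs = 0" by (simp add: mat_prod_append matrix_mul_assoc)
  qed
  then show "x ** y \<in> ideal_degree k (Suc i)" "y ** x \<in> ideal_degree k (Suc i)"
    by (simp_all add: ideal_degree_def)
qed

lemma ideal_degree_mult_R:
  assumes x: "x \<in> ideal_degree k i" and r: "r \<in> R"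
  shows "x ** r \<in> ideal_degree k i"
proof -
  have "mat_prod as ** (x ** r) ** mat_prod bs = 0"
    if ab: "set as \<subseteq> I" "set bs \<subseteq> I" "k \<le> length as + length bs + i" for as bs
  proof -
    have "mat_prod as ** x ** mat_prod ((r - mat 1) # bs) = 0"
      by (rule ideal_degreeD[OF x]) (use ab diff_I[OF r one] in auto)
    moreover have "mat_prod as ** x ** mat_prod bs = 0" by (rule ideal_degreeD[OF x ab])
    moreover have "mat_prod as ** (x ** r) ** mat_prod bs
        = mat_prod as ** x ** mat_prod ((r - mat 1) # bs) + mat_prod as ** x ** mat_prod bs"
      by (simp add: matrix_mul_assoc matrix_diff_ldistrib matrix_diff_rdistrib)
    ultimately show ?thesis by simp
  qed
  then show ?thesis by (simp add: ideal_degree_def)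
qed

lemma I_ideal_degree:
  assumes k: "\<And>xs. set xs \<subseteq> I \<Longrightarrow> length xs = k \<Longrightarrow> mat_prod xs = 0" and x: "x \<in> I"
  shows "x \<in> ideal_degree k 1"
proof -
  have "mat_prod as ** x ** mat_prod bs = 0"
    if ab: "set as \<subseteq> I" "set bs \<subseteq> I" "k \<le> length as + length bs + 1" for as bs
  proof -
    have "mat_prod (as @ x # bs) = 0"
      by (rule mat_prod_long_zero[OF k]) (use ab x in auto)
    then show ?thesis by (simp add: mat_prod_append matrix_mul_assoc)
  qed
  then show ?thesis by (simp add: ideal_degree_def)
qed

lemma ideal_degree_top: "x \<in> ideal_degree k k \<Longrightarrow> x = 0"
  using ideal_degreeD[of x k k "[]" "[]"] by simp

lemma ideal_degree_Suc: "x \<in> ideal_degree k (Suc i) \<Longrightarrow> x \<in> ideal_degree k i"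
  by (auto simp: ideal_degree_def)

lemma conj_algebra_ideal:
  assumes J: "algebra_ideal A J"
  shows "algebra_ideal A ((\<lambda>m. \<alpha> ** m ** \<alpha>') ` J)"
proof -
  have J': "complex_subspace J" "J \<subseteq> A" "\<And>a j. a \<in> A \<Longrightarrow> j \<in> J \<Longrightarrow> a ** j \<in> J" "\<And>a j. a \<in> A \<Longrightarrow> j \<in> J \<Longrightarrow> j ** a \<in> J"
    using J by (auto simp: algebra_ideal_def)
  have "complex_subspace ((\<lambda>m. \<alpha> ** m ** \<alpha>') ` J)"
  proof (rule complex_subspaceI)
    show "0 \<in> (\<lambda>m. \<alpha> ** m ** \<alpha>') ` J" using complex_subspaceD(1)[OF J'(1)] by force
    fix x c assume "x \<in> (\<lambda>m. \<alpha> ** m ** \<alpha>') ` J"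
    then obtain m where m: "m \<in> J" "x = \<alpha> ** m ** \<alpha>'" by blast
    have "mat c ** x = \<alpha> ** (mat c ** m) ** \<alpha>'" unfolding m(2) mult_mat_left by (simp only: matrix_mul_assoc)
    then show "mat c ** x \<in> (\<lambda>m. \<alpha> ** m ** \<alpha>') ` J" using complex_subspaceD(3)[OF J'(1) m(1)] by blast
  next
    fix x y assume "x \<in> (\<lambda>m. \<alpha> ** m ** \<alpha>') ` J" "y \<in> (\<lambda>m. \<alpha> ** m ** \<alpha>') ` J"
    then obtain m n where m: "m \<in> J" "x = \<alpha> ** m ** \<alpha>'" "n \<in> J" "y = \<alpha> ** n ** \<alpha>'" by blast
    have "x + y = \<alpha> ** (m + n) ** \<alpha>'" unfolding m by (simp only: matrix_add_ldistrib matrix_add_rdistrib)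
    then show "x + y \<in> (\<lambda>m. \<alpha> ** m ** \<alpha>') ` J" using complex_subspaceD(2)[OF J'(1) m(1,3)] by blast
  qed
  moreover have "(\<lambda>m. \<alpha> ** m ** \<alpha>') ` J \<subseteq> A" using conj_A(1) J'(2) by blast
  moreover have "a ** (\<alpha> ** m ** \<alpha>') \<in> (\<lambda>m. \<alpha> ** m ** \<alpha>') ` J \<and> (\<alpha> ** m ** \<alpha>') ** a \<in> (\<lambda>m. \<alpha> ** m ** \<alpha>') ` J"
    if a: "a \<in> A" and m: "m \<in> J" for a m
  proof -
    let ?a = "\<alpha>' ** a ** \<alpha>"
    have "a ** (\<alpha> ** m ** \<alpha>') = (\<alpha> ** \<alpha>') ** a ** \<alpha> ** m ** \<alpha>'" by (simp add: inverse matrix_mul_assoc)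
    also have "\<dots> = \<alpha> ** (?a ** m) ** \<alpha>'" by (simp only: matrix_mul_assoc)
    finally have 1: "a ** (\<alpha> ** m ** \<alpha>') = \<alpha> ** (?a ** m) ** \<alpha>'" .
    have "(\<alpha> ** m ** \<alpha>') ** a = \<alpha> ** m ** \<alpha>' ** a ** (\<alpha> ** \<alpha>')" by (simp add: inverse)
    also have "\<dots> = \<alpha> ** (m ** ?a) ** \<alpha>'" by (simp only: matrix_mul_assoc)
    finally have 2: "(\<alpha> ** m ** \<alpha>') ** a = \<alpha> ** (m ** ?a) ** \<alpha>'" .
    show ?thesis unfolding 1 2 using J'(3,4)[OF conj_A(2)[OF a] m] by blast
  qed
  ultimately show ?thesis unfolding algebra_ideal_def by blast
qed

lemma twisted_monoid_inverse: "twisted_monoid R \<alpha>' \<alpha>"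
  by unfold_locales (auto simp: one mult inverse conj)

lemma conj_maximal_algebra_ideal:
  assumes M: "maximal_algebra_ideal A M"
  shows "maximal_algebra_ideal A ((\<lambda>m. \<alpha> ** m ** \<alpha>') ` M)"
proof -
  interpret i: twisted_monoid R \<alpha>' \<alpha> by (rule twisted_monoid_inverse)
  have cc: "\<alpha>' ** (\<alpha> ** m ** \<alpha>') ** \<alpha> = m" "\<alpha> ** (\<alpha>' ** m ** \<alpha>) ** \<alpha>' = m" for m
    by (simp_all add: matrix_mul_assoc inverse) (simp_all add: inverse flip: matrix_mul_assoc)
  have one1: "\<alpha> ** mat 1 ** \<alpha>' = mat 1" "\<alpha>' ** mat 1 ** \<alpha> = mat 1" by (simp_all add: inverse)
  have M': "algebra_ideal A M" "mat 1 \<notin> M" "\<And>J. algebra_ideal A J \<Longrightarrow> M \<subseteq> J \<Longrightarrow> J = M \<or> mat 1 \<in> J"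
    using M by (auto simp: maximal_algebra_ideal_def)
  have "mat 1 \<notin> (\<lambda>m. \<alpha> ** m ** \<alpha>') ` M"
  proof
    assume "mat 1 \<in> (\<lambda>m. \<alpha> ** m ** \<alpha>') ` M"
    then obtain m where "m \<in> M" "mat 1 = \<alpha> ** m ** \<alpha>'" by blast
    then show False using cc(1)[of m] one1 M'(2) by simp
  qed
  moreover have "J = (\<lambda>m. \<alpha> ** m ** \<alpha>') ` M \<or> mat 1 \<in> J"
    if J: "algebra_ideal A J" and sub: "(\<lambda>m. \<alpha> ** m ** \<alpha>') ` M \<subseteq> J" for J
  proof -
    let ?J = "(\<lambda>m. \<alpha>' ** m ** \<alpha>) ` J"
    have eqJ: "J = (\<lambda>m. \<alpha> ** m ** \<alpha>') ` ?J" by (simp add: image_image cc)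
    have "algebra_ideal A ?J" by (rule i.conj_algebra_ideal[OF J])
    moreover have "M \<subseteq> ?J"
    proof
      fix m assume "m \<in> M"
      then have "\<alpha>' ** (\<alpha> ** m ** \<alpha>') ** \<alpha> \<in> ?J" by (intro imageI subsetD[OF sub])
      then show "m \<in> ?J" by (simp only: cc)
    qed
    ultimately have "?J = M \<or> mat 1 \<in> ?J" by (rule M'(3))
    then show ?thesis
    proof
      assume "?J = M" then show ?thesis using eqJ by simp
    next
      assume "mat 1 \<in> ?J"
      then have "\<alpha> ** mat 1 ** \<alpha>' \<in> J" by (subst eqJ) (rule imageI)
      then show ?thesis using one1 by simp
    qed
  qed
  ultimately show ?thesis
    unfolding maximal_algebra_ideal_def using conj_algebra_ideal[OF M'(1)] by blast
qed

end

section \<open>From a nilpotent augmentation ideal to a nilpotent group\<close>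

context chart_group
begin

abbreviation "R \<equiv> ad ` carrier G"

text \<open>With A = Ad(x) and B = Ad(y), Ad(x y x^-1 y^-1) - 1 = ((A - 1)(B - 1) - (B - 1)(A - 1))
  A^-1 B^-1, so each commutator raises the degree by one. The index is shifted because G itself, the
  term 0, already has degree 1.\<close>

lemma lower_central_ideal_degree:
  assumes T: "twisted_monoid R a a'"
    and k: "\<And>xs. set xs \<subseteq> augmentation_ideal R \<Longrightarrow> length xs = k \<Longrightarrow> mat_prod xs = 0"
  shows "lower_central G n \<subseteq> {g \<in> carrier G. ad g - mat 1 \<in> twisted_monoid.ideal_degree R k (Suc n)}"
proof -
  interpret T: twisted_monoid R a a' by (rule T)
  \<comment> \<open>Each term of the series is a generated subgroup, so the degree condition has to
    define a subgroup. For products this is Ad(x y) - 1 = (Ad(x) - 1) Ad(y) + (Ad(y) - 1).\<close>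
  have sg: "subgroup {g \<in> carrier G. ad g - mat 1 \<in> T.ideal_degree k i} G" for i
  proof
    fix x y assume xy: "x \<in> {g \<in> carrier G. ad g - mat 1 \<in> T.ideal_degree k i}" "y \<in> {g
      \<in> carrier G. ad g - mat 1 \<in> T.ideal_degree k i}"
    then have "(ad x - mat 1) ** ad y + (ad y - mat 1) \<in> T.ideal_degree k i"
      by (intro T.ideal_degree_add T.ideal_degree_mult_R) auto
    moreover have "ad (x \<otimes> y) - mat 1 = (ad x - mat 1) ** ad y + (ad y - mat 1)"
      using xy by (simp add: ad_mult matrix_diff_rdistrib)
    ultimately show "x \<otimes> y \<in> {g \<in> carrier G. ad g - mat 1 \<in> T.ideal_degree k i}"
      using xy by (simp only: mem_Collect_eq m_closed)
  next
    fix x assume x: "x \<in> {g \<in> carrier G. ad g - mat 1 \<in> T.ideal_degree k i}"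
    then have "0 - (ad x - mat 1) ** ad (inv x) \<in> T.ideal_degree k i"
      by (intro T.ideal_degree_diff[OF T.ideal_degree_zero] T.ideal_degree_mult_R) auto
    moreover have "ad (inv x) - mat 1 = 0 - (ad x - mat 1) ** ad (inv x)"
      using x by (simp add: matrix_diff_rdistrib ad_inv)
    ultimately show "inv x \<in> {g \<in> carrier G. ad g - mat 1 \<in> T.ideal_degree k i}"
      using x by (simp only: mem_Collect_eq inv_closed)
  qed (auto simp: ad_one T.ideal_degree_zero)
  show ?thesis
  proof (induction n)
    case 0
    have "ad g - mat 1 \<in> T.ideal_degree k 1" if "g \<in> carrier G" for g
      using that T.diff_I T.one by (intro T.I_ideal_degree k) auto
    then show ?case by auto
  next
    case (Suc n)
    show ?case unfolding lower_central.simps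
    proof (rule generate_subgroup_incl[OF _ sg], clarify)
      fix x y assume x: "x \<in> carrier G" and "y \<in> lower_central G n"
      then have y: "y \<in> carrier G" "ad y - mat 1 \<in> T.ideal_degree k (Suc n)" using Suc by auto
      let ?A = "ad x" and ?B = "ad y"
      have "ad (x \<otimes> y \<otimes> inv x \<otimes> inv y) = ?A ** ?B ** ad (inv x) ** ad (inv y)"
        using x y by (simp add: ad_mult)
      moreover have "?B ** ?A ** ad (inv x) ** ad (inv y) = mat 1"
      proof -
        have "?B ** ?A ** ad (inv x) ** ad (inv y) = ?B ** (?A ** ad (inv x)) ** ad (inv y)"
          by (simp only: matrix_mul_assoc)
        then show ?thesis using x y by (simp add: ad_inv)
      qed
      ultimately have "ad (x \<otimes> y \<otimes> inv x \<otimes> inv y) - mat 1 = (?A ** ?B - ?B ** ?A) ** ad (inv x) ** ad (inv y)"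
        by (simp add: matrix_diff_rdistrib)
      also have "?A ** ?B - ?B ** ?A = (?A - mat 1) ** (?B - mat 1) - (?B - mat 1) ** (?A - mat 1)"
        by (simp add: matrix_diff_rdistrib matrix_diff_ldistrib)
      finally have eq: "ad (x \<otimes> y \<otimes> inv x \<otimes> inv y) - mat 1
          = ((?A - mat 1) ** (?B - mat 1) - (?B - mat 1) ** (?A - mat 1)) ** ad (inv x) ** ad (inv y)" .
      have "?A - mat 1 \<in> T.I" using x T.one by (intro T.diff_I) auto
      then have "(?A - mat 1) ** (?B - mat 1) - (?B - mat 1) ** (?A - mat 1) \<in> T.ideal_degree k (Suc (Suc n))"
        using T.ideal_degree_mult_I[OF y(2)] by (intro T.ideal_degree_diff) auto
      then show "x \<otimes> y \<otimes> inv x \<otimes> inv y \<in> carrier G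
        \<and> ad (x \<otimes> y \<otimes> inv x \<otimes> inv y) - mat 1 \<in> T.ideal_degree k (Suc (Suc n))"
        unfolding eq using x y by (intro conjI T.ideal_degree_mult_R) auto
    qed
  qed
qed

lemma nilpotent_if_augmentation_nilpotent:
  assumes T: "twisted_monoid R a a'"
    and k: "\<And>xs. set xs \<subseteq> augmentation_ideal R \<Longrightarrow> length xs = k \<Longrightarrow> mat_prod xs = 0"
  shows "nilpotent_group G"
proof -
  interpret T: twisted_monoid R a a' by (rule T)
  have central: "g \<in> carrier G \<and> ad g = mat 1" if "g \<in> lower_central G k" for g
  proof -
    have g: "g \<in> carrier G" "ad g - mat 1 \<in> T.ideal_degree k (Suc k)"
      using lower_central_ideal_degree[OF T k] that by blast+
    then show ?thesis using T.ideal_degree_top[OF T.ideal_degree_Suc[OF g(2)]] by simp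
  qed
  have triv: "x \<otimes> y \<otimes> inv x \<otimes> inv y = \<one>" if "x \<in> carrier G" "y \<in> lower_central G k" for x y
    using ad_eq_one_central[of y x] central[OF that(2)] that(1)
      by (metis inv_solve_right' m_closed r_inv inv_closed m_assoc r_one)
  have "lower_central G (Suc k) = {\<one>}"
  proof
    show "lower_central G (Suc k) \<subseteq> {\<one>}"
      unfolding lower_central.simps using triv by (intro generate_subgroup_incl triv_subgroup) auto
    show "{\<one>} \<subseteq> lower_central G (Suc k)" by (auto intro: generate.one)
  qed
  then show ?thesis unfolding nilpotent_group_def by blast
qed

section \<open>Automorphisms, their derivatives and their twisted classes\<close>

lemma AutD:
  assumes "\<alpha> \<in> carrier (Aut G X)"
  shows "endo \<alpha>" "bij_betw \<alpha> (carrier G) (carrier G)" "\<alpha> \<in> extensional (carrier G)"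
  using assms by (auto simp: Aut_def endo_def iso_def)

lemma AutI:
  assumes "endo \<alpha>" "bij_betw \<alpha> (carrier G) (carrier G)" "\<alpha> \<in> extensional (carrier G)"
  shows "\<alpha> \<in> carrier (Aut G X)"
  using assms by (auto simp: Aut_def endo_def iso_def)

lemma endo_cong: "endo \<alpha> \<Longrightarrow> (\<And>x. x \<in> carrier G \<Longrightarrow> \<beta> x = \<alpha> x) \<Longrightarrow> endo \<beta>"
  unfolding endo_def hom_def
  by (auto simp: top Pi_iff intro: continuous_map_eq[of X X \<alpha>])

lemma group_Aut: "group (Aut G X)"
proof (rule groupI)
  fix x y assume xy: "x \<in> carrier (Aut G X)" "y \<in> carrier (Aut G X)"
  have "compose (carrier G) x y \<in> carrier (Aut G X)"
  proof (rule AutI)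
    show "endo (compose (carrier G) x y)"
      by (rule endo_cong[OF compose_endo[OF AutD(1)[OF xy(1)] AutD(1)[OF xy(2)]]]) (simp add: compose_eq)
    show "bij_betw (compose (carrier G) x y) (carrier G) (carrier G)"
      using bij_betw_compose[OF AutD(2)[OF xy(2)] AutD(2)[OF xy(1)]] .
  qed simp
  then show "x \<otimes>\<^bsub>Aut G X\<^esub> y \<in> carrier (Aut G X)" by (simp add: Aut_def)
next
  show "\<one>\<^bsub>Aut G X\<^esub> \<in> carrier (Aut G X)"
    by (rule AutI) (auto simp: Aut_def bij_betw_def inj_on_def intro: endo_identity)
next
  fix x y z assume "x \<in> carrier (Aut G X)" "y \<in> carrier (Aut G X)" "z \<in> carrier (Aut G X)"
  then show "x \<otimes>\<^bsub>Aut G X\<^esub> y \<otimes>\<^bsub>Aut G X\<^esub> z = x \<otimes>\<^bsub>Aut G X\<^esub> (y \<otimes>\<^bsub>Aut G X\<^esub> z)"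
    using endo_closed[OF AutD(1)] by (auto simp: Aut_def compose_def fun_eq_iff)
next
  fix x assume x: "x \<in> carrier (Aut G X)"
  show "\<one>\<^bsub>Aut G X\<^esub> \<otimes>\<^bsub>Aut G X\<^esub> x = x"
    using endo_closed[OF AutD(1)[OF x]] AutD(3)[OF x] Id_compose[of x "carrier G" "carrier G"]
    by (simp add: Aut_def Pi_iff)
  note bij = AutD(2)[OF x]
  define y where "y = restrict (inv_into (carrier G) x) (carrier G)"
  have y: "y z \<in> carrier G" "x (y z) = z" "y (x z) = z" if "z \<in> carrier G" for z
    using that bij_betwE[OF bij_betw_inv_into[OF bij]] endo_closed[OF AutD(1)[OF x]]
    by (simp_all add: y_def bij_betw_inv_into_right[OF bij] bij_betw_inv_into_left[OF bij])
  have "y \<in> carrier (Aut G X)"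
  proof (rule AutI)
    have "y \<in> hom G G"
    proof (rule homI)
      interpret h: group_hom G G x using endo_hom AutD(1)[OF x] by blast
      fix a b assume ab: "a \<in> carrier G" "b \<in> carrier G"
      have "x (y a \<otimes> y b) = a \<otimes> b" using ab y by simp
      then show "y (a \<otimes> b) = y a \<otimes> y b" using ab y(1,3) by (metis m_closed)
    qed (rule y)
    moreover have "continuous_map X X y"
      by (rule continuous_inverse[OF AutD(1)[OF x] bij]) (use y in auto)
    ultimately show "endo y" by (simp add: endo_def)
    show "bij_betw y (carrier G) (carrier G)"
      by (rule bij_betw_byWitness[of _ x]) (use y endo_closed[OF AutD(1)[OF x]] in auto)
  qed (simp add: y_def)
  moreover have "y \<otimes>\<^bsub>Aut G X\<^esub> x = \<one>\<^bsub>Aut G X\<^esub>"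
    using y(3) by (auto simp: Aut_def compose_def fun_eq_iff)
  ultimately show "\<exists>y\<in>carrier (Aut G X). y \<otimes>\<^bsub>Aut G X\<^esub> x = \<one>\<^bsub>Aut G X\<^esub>" by blast
qed

definition "mt \<alpha> = to_mat (diff \<alpha>)"

lemma mt_mult:
  assumes "\<alpha> \<in> carrier (Aut G X)" "\<beta> \<in> carrier (Aut G X)"
  shows "mt (\<alpha> \<otimes>\<^bsub>Aut G X\<^esub> \<beta>) = mt \<alpha> ** mt \<beta>"
  unfolding mt_def
proof (rule to_mat_diff_mult[OF AutD(1)[OF assms(1)] AutD(1)[OF assms(2)]])
  interpret Au: group "Aut G X" by (rule group_Aut)
  show "endo (\<alpha> \<otimes>\<^bsub>Aut G X\<^esub> \<beta>)" using AutD(1) assms by blast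
qed (simp add: Aut_def compose_eq)

lemma mt_one: "mt \<one>\<^bsub>Aut G X\<^esub> = mat 1"
  unfolding mt_def by (subst diff_identity) (simp_all add: Aut_def to_mat_identity)

lemma mt_inv:
  assumes "\<alpha> \<in> carrier (Aut G X)"
  shows "mt \<alpha> ** mt (inv\<^bsub>Aut G X\<^esub> \<alpha>) = mat 1" "mt (inv\<^bsub>Aut G X\<^esub> \<alpha>) ** mt \<alpha> = mat 1"
proof -
  interpret Au: group "Aut G X" by (rule group_Aut)
  show "mt \<alpha> ** mt (inv\<^bsub>Aut G X\<^esub> \<alpha>) = mat 1" "mt (inv\<^bsub>Aut G X\<^esub> \<alpha>) ** mt \<alpha> = mat 1"
    using assms by (simp_all add: mt_one flip: mt_mult)
qed

lemma mt_conj_ad: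
  assumes "\<alpha> \<in> carrier (Aut G X)" "g \<in> carrier G"
  shows "mt \<alpha> ** ad g ** mt (inv\<^bsub>Aut G X\<^esub> \<alpha>) = ad (\<alpha> g)"
  using ad_equivariant[OF AutD(1)[OF assms(1)] assms(2)] mt_inv[OF assms(1)]
  unfolding mt_def by (metis matrix_mul_assoc matrix_mul_rid)

lemma twisted_monoid_Aut:
  assumes "\<alpha> \<in> carrier (Aut G X)"
  shows "twisted_monoid R (mt \<alpha>) (mt (inv\<^bsub>Aut G X\<^esub> \<alpha>))"
proof -
  interpret Au: group "Aut G X" by (rule group_Aut)
  have i: "inv\<^bsub>Aut G X\<^esub> \<alpha> \<in> carrier (Aut G X)" using assms by simp
  show ?thesis
  proof
    show "mat 1 \<in> R" using ad_one one_closed by (metis imageI)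
    show "s ** t \<in> R" if "s \<in> R" "t \<in> R" for s t using that ad_mult by (auto simp: image_iff) (metis m_closed)
    show "mt \<alpha> ** s ** mt (inv\<^bsub>Aut G X\<^esub> \<alpha>) \<in> R" if "s \<in> R" for s
      using that mt_conj_ad[OF assms] endo_closed[OF AutD(1)[OF assms]] by auto
    show "mt (inv\<^bsub>Aut G X\<^esub> \<alpha>) ** s ** mt \<alpha> \<in> R" if "s \<in> R" for s
      using that mt_conj_ad[OF i] endo_closed[OF AutD(1)[OF i]] assms by auto
  qed (rule mt_inv[OF assms])+
qed

lemma finite_classes_finite_eigenvalues:
  assumes \<alpha>: "\<alpha> \<in> carrier (Aut G X)" and fin: "finite (twisted_classes G \<alpha>)"
  shows "finite (\<Union>g\<in>carrier G. eigenvalues (ad g ** mt \<alpha>))"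
proof -
  define E where "E g = eigenvalues (ad g ** mt \<alpha>)" for g
  define C where "C x = {y \<in> carrier G. \<exists>g\<in>carrier G. y = g \<otimes> x \<otimes> inv (\<alpha> g)}" for x
  interpret h: group_hom G G \<alpha> using endo_hom AutD(1)[OF \<alpha>] by blast
  have inv1: "E y = E x" if xy: "x \<in> carrier G" "y \<in> C x" for x y
  proof -
    obtain g where g: "g \<in> carrier G" "y = g \<otimes> x \<otimes> \<alpha> (inv g)" using xy by (auto simp: C_def)
    have "ad y ** mt \<alpha> = ad g ** ad x ** (ad (\<alpha> (inv g)) ** mt \<alpha>)"
      using g xy by (simp add: ad_mult matrix_mul_assoc)
    \<comment> \<open>Moving Ad(\<alpha>(g^-1)) past D\<alpha> untwists the class: what remains is
      ordinary conjugation by Ad(g).\<close>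
    also have "ad (\<alpha> (inv g)) ** mt \<alpha> = mt \<alpha> ** ad (inv g)"
      using ad_equivariant[OF AutD(1)[OF \<alpha>], of "inv g"] g by (simp add: mt_def)
    finally have "ad y ** mt \<alpha> = ad g ** (ad x ** mt \<alpha>) ** ad (inv g)" by (simp only: matrix_mul_assoc)
    then show ?thesis unfolding E_def using eigenvalues_similar[OF ad_inv[OF g(1)]] by simp
  qed
  have self: "x \<in> C x" if "x \<in> carrier G" for x
    using that by (auto simp: C_def intro!: bexI[of _ \<one>])
  have "E ` carrier G \<subseteq> (\<lambda>c. E (SOME y. y \<in> c)) ` twisted_classes G \<alpha>"
  proof clarify
    fix x assume x: "x \<in> carrier G"
    have "(SOME y. y \<in> C x) \<in> C x" using self[OF x] by (rule someI)
    then have "E x = E (SOME y. y \<in> C x)" using inv1[OF x] by simp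
    moreover have "C x \<in> twisted_classes G \<alpha>" unfolding twisted_classes_def C_def using x by blast
    ultimately show "E x \<in> (\<lambda>c. E (SOME y. y \<in> c)) ` twisted_classes G \<alpha>" by blast
  qed
  then have "finite (E ` carrier G)" using fin finite_surj by blast
  moreover have "finite (E g)" for g unfolding E_def by (rule finite_eigenvalues)
  ultimately show ?thesis unfolding E_def[symmetric] by (metis (mono_tags, lifting) finite_Union imageE)
qed

lemma trace_constant:
  assumes \<alpha>: "\<alpha> \<in> carrier (Aut G X)" and fin: "finite (twisted_classes G \<alpha>)"
    and N: "matrix_algebra N" "\<And>g. g \<in> carrier G \<Longrightarrow> ad g ** mt \<alpha> \<in> N" and e: "compressible N e"
    and gh: "g \<in> carrier G" "h \<in> carrier G"
  shows "trace (e ** ad g ** mt \<alpha> ** e) = trace (e ** ad h ** mt \<alpha> ** e)"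
proof -
  let ?f = "\<lambda>g. trace (e ** ad g ** mt \<alpha> ** e)"
  let ?t = "\<lambda>M. trace (e ** M ** mt \<alpha> ** e)"
  have "linear ?t"
  proof (rule linearI)
    show "?t (M + M') = ?t M + ?t M'" for M M' by (simp add: matrix_add_ldistrib matrix_add_rdistrib trace_add)
    show "?t (c *\<^sub>R M) = c *\<^sub>R ?t M" for c M
      unfolding scaleR_eq_mat_mul mult_mat_left
      by (simp add: trace_mat_mul scaleR_conv_of_real[where 'a = complex] flip: matrix_mul_assoc)
  qed
  then have "continuous_on UNIV ?t" by (rule linear_continuous_on_compose[OF continuous_on_id])
  then have "continuous_map euclidean euclidean ?t" by simp
  from continuous_map_compose[OF continuous_ad this]
  have cont: "continuous_map X euclidean ?f" by (simp add: o_def)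
  have "finite ((\<lambda>x. trace (e ** x ** e)) ` ((\<lambda>g. ad g ** mt \<alpha>) ` carrier G))"
  proof (rule finite_trace_compressions[OF N(1) e])
    show "(\<lambda>g. ad g ** mt \<alpha>) ` carrier G \<subseteq> N" using N(2) by blast
    show "finite (\<Union>x\<in>(\<lambda>g. ad g ** mt \<alpha>) ` carrier G. eigenvalues x)"
      using finite_classes_finite_eigenvalues[OF \<alpha> fin] by simp
  qed
  then have "finite (?f ` topspace X)" by (simp add: image_image matrix_mul_assoc top)
  then show ?thesis
    using connected_finite_image_constant[OF connected Hausdorff_space_euclidean cont, of g h] gh top by simp
qed

definition "alg = matrix_algebra hull R"

lemma nilpotent_if_finite_classes:
  assumes \<alpha>: "\<alpha> \<in> carrier (Aut G X)" and fin: "finite (twisted_classes G \<alpha>)"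
    and fix_max: "\<And>M. maximal_algebra_ideal alg M \<Longrightarrow> (\<lambda>m. mt \<alpha> ** m ** mt (inv\<^bsub>Aut G X\<^esub> \<alpha>)) ` M = M"
  shows "nilpotent_group G"
proof -
  let ?i = "mt (inv\<^bsub>Aut G X\<^esub> \<alpha>)"
  interpret T: twisted_monoid R "mt \<alpha>" ?i by (rule twisted_monoid_Aut[OF \<alpha>])
  have A: "T.A = alg" by (simp add: T.A_def alg_def)
  have fm: "?i ** m ** mt \<alpha> \<in> M" if M: "maximal_algebra_ideal T.A M" and m: "m \<in> M" for M m
  proof -
    \<comment> \<open>The ideal equals its conjugate, so m is itself the conjugate of some n in M,
      and undoing the conjugation stays in M.\<close>
    obtain n where n: "n \<in> M" "m = mt \<alpha> ** n ** ?i" using fix_max[of M] M m A by auto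
    then have "?i ** m ** mt \<alpha> = (?i ** mt \<alpha>) ** n ** (?i ** mt \<alpha>)" by (simp only: matrix_mul_assoc)
    then show ?thesis using n(1) by (simp add: T.inverse)
  qed
  have tr: "trace (e ** s ** mt \<alpha> ** e) = trace (e ** t ** mt \<alpha> ** e)"
    if e: "compressible T.B e" and st: "s \<in> R" "t \<in> R" for e s t
  proof -
    obtain g h where "g \<in> carrier G" "s = ad g" "h \<in> carrier G" "t = ad h" using st by blast
    then show ?thesis
      using trace_constant[OF \<alpha> fin T.B _ e] T.BD(5)[OF T.A_B[OF T.R_A] T.alpha_B] by blast
  qed
  obtain k where "\<And>xs. set xs \<subseteq> T.I \<Longrightarrow> length xs = k \<Longrightarrow> mat_prod xs = 0"
    using T.augmentation_ideal_nilpotent[OF fm tr] by blast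
  then show ?thesis by (rule nilpotent_if_augmentation_nilpotent[OF T.twisted_monoid_axioms])
qed

lemma finite_index_subgroup_infinite_classes:
  assumes "\<not> nilpotent_group G"
  obtains L where "subgroup L (Aut G X)" "finite (rcosets\<^bsub>Aut G X\<^esub> L)"
    "\<And>\<alpha>. \<alpha> \<in> L \<Longrightarrow> infinite (twisted_classes G \<alpha>)"
proof -
  interpret Au: group "Aut G X" by (rule group_Aut)
  let ?S = "{M. maximal_algebra_ideal alg M}"
  define act where "act \<alpha> M = (\<lambda>m. mt \<alpha> ** m ** mt (inv\<^bsub>Aut G X\<^esub> \<alpha>)) ` M" for \<alpha> M
  let ?L = "{\<alpha> \<in> carrier (Aut G X). \<forall>M\<in>?S. act \<alpha> M = M}"
  have fin: "finite ?S" by (rule finite_maximal_ideals) (simp add: alg_def matrix_algebra_hull)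
  have a1: "act \<alpha> M \<in> ?S" if "\<alpha> \<in> carrier (Aut G X)" "M \<in> ?S" for \<alpha> M
  proof -
    interpret T: twisted_monoid R "mt \<alpha>" "mt (inv\<^bsub>Aut G X\<^esub> \<alpha>)" by (rule twisted_monoid_Aut[OF that(1)])
    show ?thesis using T.conj_maximal_algebra_ideal[of M] that(2) by (simp add: act_def alg_def T.A_def)
  qed
  have a2: "act (\<alpha> \<otimes>\<^bsub>Aut G X\<^esub> \<beta>) M = act \<alpha> (act \<beta> M)"
    if "\<alpha> \<in> carrier (Aut G X)" "\<beta> \<in> carrier (Aut G X)" for \<alpha> \<beta> M
    using that by (simp add: act_def image_image mt_mult Au.inv_mult_group matrix_mul_assoc)
  have a3: "act \<one>\<^bsub>Aut G X\<^esub> M = M" for M by (simp add: act_def mt_one)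
  have "subgroup ?L (Aut G X)" "finite (rcosets\<^bsub>Aut G X\<^esub> ?L)"
    using Au.pointwise_stabilizer_finite_index[OF fin, of act] a1 a2 a3 by blast+
  moreover have "infinite (twisted_classes G \<alpha>)" if "\<alpha> \<in> ?L" for \<alpha>
    using nilpotent_if_finite_classes[of \<alpha>] that assms unfolding act_def by blast
  ultimately show ?thesis using that by blast
qed

text \<open>The commutator with \<open>b\<close> is continuous in \<open>a\<close> and has finitely
  many values, so on the connected group it keeps its value at a = 1.\<close>

lemma commutator_const:
  assumes fin: "finite Z" and b: "b \<in> carrier G"
    and Z: "\<And>a. a \<in> carrier G \<Longrightarrow> a \<otimes> b \<otimes> inv a \<otimes> inv b \<in> Z" and a: "a \<in> carrier G"
  shows "a \<otimes> b \<otimes> inv a \<otimes> inv b = \<one>"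
proof -
  let ?f = "\<lambda>a. a \<otimes> b \<otimes> inv a \<otimes> inv b"
  have const: "continuous_map X X (\<lambda>x. c)" if "c \<in> carrier G" for c
    using that top by (intro continuous_map_const[THEN iffD2]) auto
  have mult: "continuous_map X X (\<lambda>x. f x \<otimes> g x)" if "continuous_map X X f" "continuous_map X X g" for f g
    using continuous_map_compose[OF continuous_map_pairedI[OF that] mult_cont] by (simp add: o_def)
  have "continuous_map X X ?f"
    by (intro mult const inv_cont continuous_map_id[unfolded id_def]) (use b in auto)
  moreover have "finite (?f ` topspace X)" by (rule finite_subset[OF _ fin]) (use Z top in auto)
  ultimately have "?f a = ?f \<one>"
    using connected_finite_image_constant[OF connected hausdorff, of ?f a \<one>] a top by simp
  then show ?thesis using b by simp
qed

lemma nilpotent_infinite_classes: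
  assumes nil: "nilpotent_group G" and nt: "carrier G \<noteq> {\<one>}"
  shows "infinite (twisted_classes G (\<lambda>x. x))"
proof
  assume fin: "finite (twisted_classes G (\<lambda>x. x))"
  let ?Z = "{z \<in> carrier G. \<forall>x\<in>carrier G. x \<otimes> z = z \<otimes> x}"
  have "{z} \<in> twisted_classes G (\<lambda>x. x)" if z: "z \<in> ?Z" for z
  proof -
    have "g \<otimes> z \<otimes> inv g = z" if "g \<in> carrier G" for g using that z by (simp add: m_assoc)
    then have "{y \<in> carrier G. \<exists>g\<in>carrier G. y = g \<otimes> z \<otimes> inv g} = {z}"
      using z by (auto intro!: bexI[of _ \<one>])
    then show ?thesis unfolding twisted_classes_def using z by blast
  qed
  then have "(\<lambda>z. {z}) ` ?Z \<subseteq> twisted_classes G (\<lambda>x. x)" by blast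
  then have "finite ((\<lambda>z. {z}) ` ?Z)" using fin by (rule finite_subset)
  then have finZ: "finite ?Z" by (rule finite_imageD) (simp add: inj_on_def)
  obtain n where n: "lower_central G n = {\<one>}" using nil unfolding nilpotent_group_def by blast
  \<comment> \<open>By minimality the preceding term is nontrivial, and it is central because its
    commutators lie in the trivial term k.\<close>
  define k where "k = (LEAST n. lower_central G n = {\<one>})"
  have k: "lower_central G k = {\<one>}" unfolding k_def using n by (rule LeastI)
  then have "k \<noteq> 0" using nt by (metis lower_central.simps(1))
  then obtain l where l: "k = Suc l" using not0_implies_Suc by blast
  have nl: "lower_central G l \<noteq> {\<one>}"
    using l not_less_Least[of l "\<lambda>n. lower_central G n = {\<one>}"] by (simp add: k_def)
  have lc: "lower_central G i \<subseteq> carrier G" for i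
  proof (induction i)
    case (Suc i)
    then show ?case unfolding lower_central.simps by (intro generate_incl) auto
  qed simp
  have lZ: "b \<in> ?Z" if b: "b \<in> lower_central G l" for b
  proof -
    have bG: "b \<in> carrier G" using lc b by blast
    have "x \<otimes> b = b \<otimes> x" if x: "x \<in> carrier G" for x
    proof -
      have "x \<otimes> b \<otimes> inv x \<otimes> inv b \<in> lower_central G k"
        unfolding l lower_central.simps by (rule generate.incl) (use b x in blast)
      then have c: "x \<otimes> b \<otimes> inv x \<otimes> inv b = \<one>" using k by simp
      have "x \<otimes> b = (x \<otimes> b \<otimes> inv x \<otimes> inv b) \<otimes> b \<otimes> x" using x bG by (simp add: m_assoc)
      then show ?thesis using c x bG by simp
    qed
    then show ?thesis using bG by simp
  qed
  show False
  proof (cases l)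
    \<comment> \<open>Here G is its own centre, so it is finite and connected, hence
      trivial.\<close>
    case 0
    then have "finite (carrier G)" using lZ finZ finite_subset[of "carrier G" ?Z] by auto
    moreover have "continuous_map X X (\<lambda>x. x)" using continuous_map_id by (simp add: id_def)
    ultimately have "x = \<one>" if "x \<in> carrier G" for x
      using connected_finite_image_constant[OF connected hausdorff, of "\<lambda>x. x" x \<one>] that top by simp
    then show False using nt one_closed by blast
  next
    case (Suc j)
    have "a \<otimes> b \<otimes> inv a \<otimes> inv b = \<one>" if a: "a \<in> carrier G" and b: "b \<in> lower_central G j" for a b
    proof (rule commutator_const[OF finZ _ _ a])
      show "b \<in> carrier G" using lc b by blast
      show "x \<otimes> b \<otimes> inv x \<otimes> inv b \<in> ?Z" if "x \<in> carrier G" for x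
      proof (rule lZ)
        show "x \<otimes> b \<otimes> inv x \<otimes> inv b \<in> lower_central G l"
          unfolding Suc lower_central.simps by (rule generate.incl) (use b that in blast)
      qed
    qed
    then have "lower_central G l \<subseteq> {\<one>}"
      unfolding Suc lower_central.simps by (intro generate_subgroup_incl triv_subgroup) auto
    moreover have "\<one> \<in> lower_central G l" unfolding Suc lower_central.simps by (rule generate.one)
    ultimately show False using nl by blast
  qed
qed

theorem infinite_conjugacy_classes:
  assumes "carrier G \<noteq> {\<one>}"
  shows "infinite (twisted_classes G (\<lambda>x. x))"
proof (cases "nilpotent_group G")
  case True then show ?thesis using nilpotent_infinite_classes assms by blast
next
  case False
  then obtain L where L: "subgroup L (Aut G X)" "\<And>\<alpha>. \<alpha> \<in> L \<Longrightarrow> infinite (twisted_classes G \<alpha>)"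
    using finite_index_subgroup_infinite_classes by blast
  have "infinite (twisted_classes G \<one>\<^bsub>Aut G X\<^esub>)" using L subgroup.one_closed by blast
  \<comment> \<open>The unit of \<open>Aut\<close> is the identity restricted to the carrier, and
    the classes see only values there.\<close>
  moreover have "twisted_classes G \<one>\<^bsub>Aut G X\<^esub> = twisted_classes G (\<lambda>x. x)"
    unfolding twisted_classes_def Aut_def by (intro image_cong refl Collect_cong conj_cong bex_cong) auto
  ultimately show ?thesis by simp
qed

end

section \<open>From the atlas to one chart at the identity\<close>

lemma lie_group_chart_group:
  fixes G :: "'g monoid" and X :: "'g topology" and A :: "('g set \<times> ('g \<Rightarrow> 'e::euclidean_space)) set"
  assumes lie: "lie_group G X A" and conn: "connected_space X"
  obtains \<phi> :: "'g \<Rightarrow> 'e" and \<psi> U r K where "chart_group G X \<phi> \<psi> U r K"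
proof -
  have grp: "group G" and top: "topspace X = carrier G" and haus: "Hausdorff_space X" and atl: "smooth_atlas X A"
    and mult: "smooth_map (prod_topology X X) (product_atlas A A) X A (\<lambda>(x,y). x \<otimes>\<^bsub>G\<^esub> y)"
    and inv: "smooth_map X A X A (\<lambda>x. inv\<^bsub>G\<^esub> x)"
    using lie by (auto simp: lie_group_def smooth_manifold_def)
  interpret group G by (rule grp)
  have mult_cont: "continuous_map (prod_topology X X) X (\<lambda>(x,y). x \<otimes>\<^bsub>G\<^esub> y)"
    and inv_cont: "continuous_map X X (\<lambda>x. inv\<^bsub>G\<^esub> x)"
    using mult inv unfolding smooth_map_def by blast+
  have "\<one>\<^bsub>G\<^esub> \<in> (\<Union>(U,cf)\<in>A. U)" using atl top unfolding smooth_atlas_def by auto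
  then obtain U cf where U: "(U, cf) \<in> A" "\<one>\<^bsub>G\<^esub> \<in> U" by auto
  have chart: "is_chart X U cf" using atl U(1) unfolding smooth_atlas_def by blast
  then have Uo: "openin X U" and Vo: "open (cf ` U)"
    and hm: "homeomorphic_map (subtopology X U) (top_of_set (cf ` U)) cf"
    by (auto simp: is_chart_def)
  have UG: "U \<subseteq> carrier G" using openin_subset[OF Uo] top by simp
  have topU: "topspace (subtopology X U) = U" using UG top by auto
  have inj: "inj_on cf U" using hm homeomorphic_imp_injective_map topU by metis
  let ?V = "cf ` U"
  define g where "g = inv_into U cf"
  have gcf: "g (cf x) = x" if "x \<in> U" for x using inv_into_f_f[OF inj that] by (simp add: g_def)
  have cfg: "cf (g a) = a" "g a \<in> U" if "a \<in> ?V" for a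
    using f_inv_into_f[OF that] inv_into_into[OF that] by (simp_all add: g_def)
  have cf_cont: "continuous_map (subtopology X U) (top_of_set ?V) cf"
    using hm homeomorphic_imp_continuous_map by blast
  \<comment> \<open>\<open>smooth_map\<close> refers to \<open>inv_into\<close>, while the
    homeomorphism supplies some inverse g'. The two agree on the image of the chart, which makes
    \<open>inv_into\<close> continuous.\<close>
  obtain g' where g': "homeomorphic_maps (subtopology X U) (top_of_set ?V) cf g'"
    using hm homeomorphic_map_maps by blast
  have g_cont: "continuous_map (top_of_set ?V) X g"
  proof (rule continuous_map_eq[of _ _ g'])
    have "continuous_map (top_of_set ?V) (subtopology X U) g'" using g' by (simp add: homeomorphic_maps_def)
    then show "continuous_map (top_of_set ?V) X g'" using continuous_map_in_subtopology by blast
    fix a assume "a \<in> topspace (top_of_set ?V)"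
    then obtain x where x: "x \<in> U" "a = cf x" by auto
    then have "g' a = x" using g' topU by (simp add: homeomorphic_maps_def)
    then show "g' a = g a" using x gcf by simp
  qed
  define p where "p = cf \<one>\<^bsub>G\<^esub>"
  have pV: "p \<in> ?V" and gp: "g p = \<one>\<^bsub>G\<^esub>" using U(2) gcf by (auto simp: p_def)
  let ?h = "\<lambda>(x, y). (cf x, cf y)"
  define S where "S = ?h ` {z \<in> U \<times> U. (\<lambda>(x,y). x \<otimes>\<^bsub>G\<^esub> y) z \<in> U}"
  \<comment> \<open>\<open>F\<close> has literally the form found in \<open>smooth_map\<close> for
    the product chart; it is identified below with the group law in coordinates.\<close>
  define F where "F = cf \<circ> (\<lambda>(x,y). x \<otimes>\<^bsub>G\<^esub> y) \<circ> inv_into (U \<times> U) ?h"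
  have "(U \<times> U, ?h) \<in> product_atlas A A" using U(1) unfolding product_atlas_def by blast
  then have sm: "smooth_on S F"
    using mult U(1) unfolding smooth_map_def S_def F_def by fast
  have inj_h: "inj_on ?h (U \<times> U)" using inj by (auto simp: inj_on_def)
  have F: "F (a, b) = cf (g a \<otimes>\<^bsub>G\<^esub> g b)" if "a \<in> ?V" "b \<in> ?V" for a b
  proof -
    have "inv_into (U \<times> U) ?h (a, b) = (g a, g b)"
      by (rule inv_into_f_eq[OF inj_h]) (use cfg that in auto)
    then show ?thesis by (simp add: F_def)
  qed
  have S: "S = {z \<in> ?V \<times> ?V. g (fst z) \<otimes>\<^bsub>G\<^esub> g (snd z) \<in> U}"
  proof
    show "S \<subseteq> {z \<in> ?V \<times> ?V. g (fst z) \<otimes>\<^bsub>G\<^esub> g (snd z) \<in> U}" using gcf by (auto simp: S_def)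
    show "{z \<in> ?V \<times> ?V. g (fst z) \<otimes>\<^bsub>G\<^esub> g (snd z) \<in> U} \<subseteq> S"
    proof
      fix z assume z: "z \<in> {z \<in> ?V \<times> ?V. g (fst z) \<otimes>\<^bsub>G\<^esub> g (snd z) \<in> U}"
      then show "z \<in> S" unfolding S_def using cfg
        by (intro image_eqI[of _ _ "(g (fst z), g (snd z))"]) auto
    qed
  qed
  have S_open: "open S"
  proof -
    have "continuous_map (top_of_set (?V \<times> ?V)) X (\<lambda>z. g (fst z))"
      by (rule continuous_map_compose[OF _ g_cont, unfolded o_def])
         (auto simp: continuous_map_in_subtopology intro!: continuous_intros)
    moreover have "continuous_map (top_of_set (?V \<times> ?V)) X (\<lambda>z. g (snd z))"
      by (rule continuous_map_compose[OF _ g_cont, unfolded o_def])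
         (auto simp: continuous_map_in_subtopology intro!: continuous_intros)
    ultimately have "continuous_map (top_of_set (?V \<times> ?V)) X (\<lambda>z. g (fst z) \<otimes>\<^bsub>G\<^esub> g (snd z))"
      using continuous_map_compose[OF continuous_map_pairedI mult_cont] by (simp add: o_def)
    from openin_continuous_map_preimage[OF this Uo]
    have "openin (top_of_set (?V \<times> ?V)) S" by (simp add: S)
    then show ?thesis using Vo open_Times openin_open_trans by blast
  qed
  have pS: "(p, p) \<in> S" using pV gp U(2) by (simp add: S)
  have SV: "a \<in> ?V" "b \<in> ?V" if "(a, b) \<in> S" for a b using that by (auto simp: S)
  have u1: "F (a, p) = a" if "(a, p) \<in> S" for a
    using SV[OF that] cfg UG by (auto simp: F gp subset_iff)
  have u2: "F (p, b) = b" if "(p, b) \<in> S" for b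
    using SV[OF that] cfg UG by (auto simp: F gp subset_iff)
  obtain r K where r: "r > 0" "K \<ge> 0" "ball p r \<times> ball p r \<subseteq> S"
    "\<And>a a' b. a \<in> ball p r \<Longrightarrow> a' \<in> ball p r \<Longrightarrow> b \<in> ball p r \<Longrightarrow>
       norm (F (a, b) - F (a', b) - (a - a')) \<le> K * norm (a - a') * norm (b - p)"
    "\<And>a b b'. a \<in> ball p r \<Longrightarrow> b \<in> ball p r \<Longrightarrow> b' \<in> ball p r \<Longrightarrow>
       norm (F (a, b) - F (a, b') - (b - b')) \<le> K * norm (a - p) * norm (b - b')"
    using smooth_unital_product_estimate[OF sm S_open pS u1 u2] by metis
  \<comment> \<open>The radius is shrunk to achieve K s \<le> 1/4, with K + 1 in place of K to cover
    K = 0.\<close>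
  define s where "s = min r (1 / (4 * (K + 1)))"
  have s: "s > 0" "s \<le> r" using r(1,2) by (simp_all add: s_def)
  have Ks: "K * s \<le> 1/4"
  proof -
    have "K * s \<le> (K + 1) * (1 / (4 * (K + 1)))" using r(2) s by (intro mult_mono) (auto simp: s_def)
    also have "\<dots> = 1/4" using r(2) by (simp add: field_simps)
    finally show ?thesis .
  qed
  have in_ball: "a + p \<in> ball p r" if "norm a < s" for a using that s by (simp add: dist_norm)
  have inV: "a + p \<in> ?V" if "norm a < s" for a
    using in_ball[OF that] r(3) SV by (metis mem_Sigma_iff subsetD)
  have prodU: "g (a + p) \<otimes>\<^bsub>G\<^esub> g (b + p) \<in> U" if "norm a < s" "norm b < s" for a b
  proof -
    have "(a + p, b + p) \<in> S" using in_ball that r(3) by blast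
    then show ?thesis by (simp add: S)
  qed
  have "chart_group G X (\<lambda>x. cf x - p) (\<lambda>a. g (a + p)) U s K"
  proof
    show "continuous_map (subtopology X U) euclidean (\<lambda>x. cf x - p)"
      using cf_cont by (intro continuous_map_diff continuous_map_const[THEN iffD2]) (auto simp: continuous_map_in_subtopology)
    have "continuous_map (top_of_set (ball 0 s)) (top_of_set ?V) (\<lambda>a. a + p)"
      using inV by (auto simp: continuous_map_in_subtopology intro!: continuous_intros)
    from continuous_map_compose[OF this g_cont]
    show "continuous_map (top_of_set (ball 0 s)) X (\<lambda>a. g (a + p))" by (simp add: o_def)
    show "norm (cf (g (a + p) \<otimes>\<^bsub>G\<^esub> g (b + p)) - p - (cf (g (a' + p) \<otimes>\<^bsub>G\<^esub> g (b + p)) - p) - (a - a'))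
      \<le> K * norm (a - a') * norm b"
      if "norm a < s" "norm a' < s" "norm b < s" for a a' b
      using r(4)[of "a + p" "a' + p" "b + p"] that in_ball by (simp add: F inV)
    show "norm (cf (g (a + p) \<otimes>\<^bsub>G\<^esub> g (b + p)) - p - (cf (g (a + p) \<otimes>\<^bsub>G\<^esub> g (b' + p)) - p) - (b - b'))
      \<le> K * norm a * norm (b - b')"
      if "norm a < s" "norm b < s" "norm b' < s" for a b b'
      using r(5)[of "a + p" "b + p" "b' + p"] that in_ball by (simp add: F inV)
  qed (use top haus conn mult_cont inv_cont Uo U gcf cfg inV prodU s r(2) Ks in \<open>auto simp: p_def\<close>)
  then show ?thesis using that by blast
qed

theorem theorem4p1:
  fixes G :: "'g monoid" and X :: "'g topology"
    and A :: "('g set \<times> ('g \<Rightarrow> 'e::euclidean_space)) set"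
  assumes "lie_group G X A"
    and "connected_space X"
    and "carrier G \<noteq> {\<one>\<^bsub>G\<^esub>}"
  shows "reidemeister_infinite G (\<lambda>x. x)
     \<and> (\<not> nilpotent_group G \<longrightarrow>
          (\<exists>L. subgroup L (Aut G X) \<and> finite (rcosets\<^bsub>Aut G X\<^esub> L) \<and>
               (\<forall>\<alpha>\<in>L. reidemeister_infinite G \<alpha>))
        \<and> (\<exists>n::nat. n \<ge> 1 \<and> (\<forall>cf\<in>carrier (Aut G X).
               reidemeister_infinite G (cf [^]\<^bsub>Aut G X\<^esub> n))))"
proof -
  obtain \<phi> :: "'g \<Rightarrow> 'e" and \<psi> U r K where "chart_group G X \<phi> \<psi> U r K"
    using lie_group_chart_group[OF assms(1,2)] .
  then interpret chart_group G X \<phi> \<psi> U r K .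
  interpret Au: group "Aut G X" by (rule group_Aut)
  show ?thesis unfolding reidemeister_infinite_def
  proof (intro conjI impI)
    show "infinite (twisted_classes G (\<lambda>x. x))" by (rule infinite_conjugacy_classes[OF assms(3)])
    assume "\<not> nilpotent_group G"
    then obtain L where L: "subgroup L (Aut G X)" "finite (rcosets\<^bsub>Aut G X\<^esub> L)"
      "\<And>\<alpha>. \<alpha> \<in> L \<Longrightarrow> infinite (twisted_classes G \<alpha>)"
      using finite_index_subgroup_infinite_classes by blast
    then show "\<exists>L. subgroup L (Aut G X) \<and> finite (rcosets\<^bsub>Aut G X\<^esub> L) \<and> (\<forall>\<alpha>\<in>L. infinite (twisted_classes G \<alpha>))"
      by blast
    show "\<exists>n::nat. n \<ge> 1 \<and> (\<forall>cf\<in>carrier (Aut G X). infinite (twisted_classes G (cf [^]\<^bsub>Aut G X\<^esub> n)))"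
      using Au.finite_index_power[OF L(1,2)] L(3) by blast
  qed
qed

end
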